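(* Let $\mathcal{A}$ be the cluster algebra of type $A_n$ ($n\ge1$), or $B_n$ or $C_n$ ($n\ge2$), with the special frozen variables coming from the polygon model. Then the elements of the set $$\mathcal{G}=\{v(l): l\text{ is a diagonal or edge of }\mathbf{P}_N\text{ of non-maximal length}\}$$ generate the rays of the Gröbner cone $\mathcal{C}_{\mathcal{A}}$ modulo lineality space (i.e. the images of the elements of $\mathcal{G}$ in the quotient of $\mathbb{R}^{\mathcal{V}\cup\mathcal{W}}$ by the lineality space of $\mathcal{C}_{\mathcal{A}}$ are generators of the rays of the image of $\mathcal{C}_{\mathcal{A}}$: each generates a ray, and every ray is generated by one of them).
   Context: **Cluster algebras and Gröbner cone.** Cluster algebras are of geometric type over a field $\mathbb{K}$ of characteristic zero, generated as $\mathbb{K}$-algebras by all cluster variables and all frozen variables (frozen variables are not inverted). Let $\mathcal{V}$ be the (finite) set of cluster variables and $\mathcal{W}$ the set of frozen variables. Let $\mathbb{K}[\mathbf{z}]=\mathbb{K}[z_v\mid v\in\mathcal{V}\cup\mathcal{W}]$, let $I_{\mathcal{A}}$ be the kernel of $\mathbb{K}[\mathbf{z}]\to\mathcal{A}$, $z_v\mapsto v$, and let $I_{\mathcal{A}}^{\times}$ be the ideal generated by all $z_vz_w$ with $v,w\in\mathcal{V}$ not in a common cluster. For $\omega\in\mathbb{R}^{\mathcal{V}\cup\mathcal{W}}$, $\mathrm{In}_\omega(f)$ is the sum of the terms of $f$ of maximal $\omega$-weight and $\mathrm{In}_\omega(I)=\langle\mathrm{In}_\omega(f):f\in I\rangle$.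 The Gröbner cone $\mathcal{C}_{\mathcal{A}}$ is the closure of $\{\omega\in\mathbb{R}^{\mathcal{V}\cup\mathcal{W}}:\mathrm{In}_\omega(I_{\mathcal{A}})=I_{\mathcal{A}}^{\times}\}$. **Polygon models (Fomin–Zelevinsky).** $\mathbf{P}_N$ is a regular $N$-gon with vertices $1,\dots,N$ (modulo $N$) labeled counterclockwise; $[i,j]$ denotes the edge or diagonal with endpoints $i,j$ (diagonals join non-adjacent vertices). For $N$ even, $\overline{i}$ is the vertex antipodal to $i$, $\overline{[i,j]}=[\overline i,\overline j]$, and a diameter is a diagonal $[i,\overline i]$. Type $A_n$, $n\ge1$, $N=n+3$: $\mathcal{A}$ is the cluster algebra of type $A_n$ whose cluster variables $x_l$ correspond to diagonals $l$ and frozen variables $x_l$ to edges $l$ of $\mathbf{P}_N$; clusters correspond to triangulations (maximal sets of non-crossing diagonals), and the exchange relations are $x_{[a,c]}x_{[b,d]}=x_{[a,b]}x_{[c,d]}+x_{[a,d]}x_{[b,c]}$ for crossing diagonals $[a,c],[b,d]$. Types $B_n,C_n$, $n\ge2$, $N=2n+2$: $\mathcal{A}$ is the cluster algebra of that type whose cluster variables $x_l=x_{\overline l}$ correspond to diagonal pairs $\{l,\overline l\}$ (a diameter is a degenerate pair, $l=\overline l$) and frozen variables to pairs of edges $\{l,\overline l\}$; clusters correspond to centrally symmetric triangulations. With $r=1$ in type $B_n$ and $r=2$ in type $C_n$, the exchange relations are exactly: $x_{[a,c]}x_{[b,d]}=x_{[a,b]}x_{[c,d]}+x_{[a,d]}x_{[b,c]}$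 for $a,b,c,d,\overline a$ in counterclockwise order; $x_{[a,c]}x_{[a,\overline b]}=x_{[a,b]}x_{[a,\overline c]}+x_{[a,\overline a]}^{2/r}x_{[b,c]}$ for $a,b,c,\overline a$ in counterclockwise order; $x_{[a,\overline a]}x_{[b,\overline b]}=x_{[a,b]}^r+x_{[a,\overline b]}^r$ for $b\ne a,\overline a$. **The vectors $v(l)$.** The length of $[i,j]$ is the number of edges in a shortest boundary path (arc) of $\mathbf{P}_N$ between $i$ and $j$; if the two arcs between $i$ and $j$ have different lengths, the shorter is the minor arc. An edge or diagonal is of non-maximal length if its length is less than $\lfloor N/2\rfloor$. For such $l$, let $F_l$ be the set of all diagonals and edges of $\mathbf{P}_N$ with both endpoints on the minor arc of $l$. Let $e_l$ (type $A_n$) resp. $e_{\{l,\overline l\}}$ (types $B_n,C_n$) denote the standard basis vectors of $\mathbb{R}^{\mathcal{V}\cup\mathcal{W}}$. Then $v(l)=-\sum_{k\in F_l}e_k$ in type $A_n$, and $v(l)=-\sum_{k\in F_l}e_{\{k,\overline k\}}$ in types $B_n,C_n$. *)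

theory Defs
  imports "HOL-Analysis.Analysis" "HOL-Analysis.Finite_Function_Topology"
begin

text \<open>Polynomials with variables of type \<open>'v\<close>; exponent vectors are finitely supported functions.\<close>

type_synonym ('v, 'k) mpoly = "('v \<Rightarrow>\<^sub>0 nat) \<Rightarrow>\<^sub>0 'k"

definition Var :: "'v \<Rightarrow> ('v, 'k::comm_ring_1) mpoly" where
  "Var v = Poly_Mapping.single (Poly_Mapping.single v 1) 1"

definition poly_ring :: "'v set \<Rightarrow> ('v, 'k::comm_ring_1) mpoly set" where
  "poly_ring S = {p. \<forall>m\<in>Poly_Mapping.keys p. Poly_Mapping.keys m \<subseteq> S}"

definition ideal_gen :: "'v set \<Rightarrow> ('v, 'k::comm_ring_1) mpoly set \<Rightarrow> ('v, 'k) mpoly set" where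
  "ideal_gen S G =
     {\<Sum>g\<in>H. c g * g | H c. finite H \<and> H \<subseteq> G \<and> (\<forall>g\<in>H. c g \<in> poly_ring S)}"

definition field_embedding :: "('k::field \<Rightarrow> 'f::field) \<Rightarrow> bool" where
  "field_embedding \<iota> \<longleftrightarrow>
     \<iota> 1 = 1 \<and> (\<forall>a b. \<iota> (a + b) = \<iota> a + \<iota> b) \<and> (\<forall>a b. \<iota> (a * b) = \<iota> a * \<iota> b)"

definition eval_mpoly :: "('k::field \<Rightarrow> 'f::field) \<Rightarrow> ('v \<Rightarrow> 'f) \<Rightarrow> ('v, 'k) mpoly \<Rightarrow> 'f" where
  "eval_mpoly \<iota> x p =
     (\<Sum>m\<in>Poly_Mapping.keys p. \<iota> (Poly_Mapping.lookup p m) *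
        (\<Prod>v\<in>Poly_Mapping.keys m. x v ^ Poly_Mapping.lookup m v))"

text \<open>
  A labelled seed \<open>(x, B)\<close> of rank \<open>n\<close>: the variables \<open>x i\<close> with \<open>i < n\<close> form the cluster and those
  with \<open>n \<le> i < m\<close> are frozen; the extended exchange matrix has the entries \<open>B i k\<close> for \<open>i < m\<close> and
  \<open>k < n\<close>. Entries outside these ranges play no role. The ambient field is the type \<open>'f\<close>, which is a
  field extension of \<open>'k\<close> by means of \<open>\<iota>\<close>.
\<close>

type_synonym 'f seed = "(nat \<Rightarrow> 'f) \<times> (nat \<Rightarrow> nat \<Rightarrow> int)"

definition skew_symmetrizable :: "nat \<Rightarrow> (nat \<Rightarrow> nat \<Rightarrow> int) \<Rightarrow> bool" where
  "skew_symmetrizable n B \<longleftrightarrow>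
     (\<exists>d. (\<forall>i<n. 0 < d i) \<and> (\<forall>i<n. \<forall>j<n. d i * B i j = - (d j * B j i)))"

definition algebraically_independent :: "('k::field \<Rightarrow> 'f::field) \<Rightarrow> nat \<Rightarrow> (nat \<Rightarrow> 'f) \<Rightarrow> bool" where
  "algebraically_independent \<iota> m x \<longleftrightarrow>
     (\<forall>p\<in>poly_ring {..<m}. eval_mpoly \<iota> x p = 0 \<longrightarrow> p = 0)"

definition generates_field :: "('k::field \<Rightarrow> 'f::field) \<Rightarrow> nat \<Rightarrow> (nat \<Rightarrow> 'f) \<Rightarrow> bool" where
  "generates_field \<iota> m x \<longleftrightarrow>
     (\<forall>f. \<exists>p\<in>poly_ring {..<m}. \<exists>q\<in>poly_ring {..<m}.
        eval_mpoly \<iota> x q \<noteq> 0 \<and> f = eval_mpoly \<iota> x p / eval_mpoly \<iota> x q)"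

definition is_seed :: "('k::field \<Rightarrow> 'f::field) \<Rightarrow> nat \<Rightarrow> nat \<Rightarrow> 'f seed \<Rightarrow> bool" where
  "is_seed \<iota> n m s \<longleftrightarrow>
     n \<le> m \<and> algebraically_independent \<iota> m (fst s) \<and> generates_field \<iota> m (fst s) \<and>
     skew_symmetrizable n (snd s)"

definition mutated_var :: "nat \<Rightarrow> nat \<Rightarrow> 'f::field seed \<Rightarrow> 'f" where
  "mutated_var m k s =
     ((\<Prod>i<m. fst s i ^ nat (snd s i k)) + (\<Prod>i<m. fst s i ^ nat (- snd s i k))) / fst s k"

definition mutated_matrix :: "nat \<Rightarrow> (nat \<Rightarrow> nat \<Rightarrow> int) \<Rightarrow> nat \<Rightarrow> nat \<Rightarrow> int" where
  "mutated_matrix k B i j =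
     (if i = k \<or> j = k then - B i j
      else B i j + (\<bar>B i k\<bar> * B k j + B i k * \<bar>B k j\<bar>) div 2)"

definition mutate :: "nat \<Rightarrow> nat \<Rightarrow> 'f::field seed \<Rightarrow> 'f seed" where
  "mutate m k s = ((fst s)(k := mutated_var m k s), mutated_matrix k (snd s))"

inductive_set mutation_class :: "nat \<Rightarrow> nat \<Rightarrow> 'f::field seed \<Rightarrow> 'f seed set"
  for n m :: nat and s0 :: "'f seed" where
  initial: "s0 \<in> mutation_class n m s0"
| mutation: "s \<in> mutation_class n m s0 \<Longrightarrow> k < n \<Longrightarrow> mutate m k s \<in> mutation_class n m s0"

definition clusters :: "nat \<Rightarrow> nat \<Rightarrow> 'f::field seed \<Rightarrow> 'f set set" where
  "clusters n m s0 = (\<lambda>s. fst s ` {..<n}) ` mutation_class n m s0"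

definition cluster_vars :: "nat \<Rightarrow> nat \<Rightarrow> 'f::field seed \<Rightarrow> 'f set" where
  "cluster_vars n m s0 = \<Union> (clusters n m s0)"

definition frozen_vars :: "nat \<Rightarrow> nat \<Rightarrow> 'f seed \<Rightarrow> 'f set" where
  "frozen_vars n m s0 = fst s0 ` {n..<m}"

definition all_vars :: "nat \<Rightarrow> nat \<Rightarrow> 'f::field seed \<Rightarrow> 'f set" where
  "all_vars n m s0 = cluster_vars n m s0 \<union> frozen_vars n m s0"

text \<open>
  The exchange relations, each written as the polynomial \<open>z\<^sub>x * z\<^sub>y - M\<^sub>1 - M\<^sub>2\<close>, where \<open>x\<close>, \<open>y\<close> are the
  exchanged variables and \<open>M\<^sub>1\<close>, \<open>M\<^sub>2\<close> the two exchange monomials. A variable of the polynomial ring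
  is indexed by the element of the ambient field that it stands for.
\<close>

definition exchange_polys :: "nat \<Rightarrow> nat \<Rightarrow> 'f::field seed \<Rightarrow> ('f, 'k::comm_ring_1) mpoly set" where
  "exchange_polys n m s0 =
     {Var (fst s k) * Var (mutated_var m k s)
        - (\<Prod>i<m. Var (fst s i) ^ nat (snd s i k)) - (\<Prod>i<m. Var (fst s i) ^ nat (- snd s i k))
      | s k. s \<in> mutation_class n m s0 \<and> k < n}"

text \<open>The subalgebra generated by cluster and frozen variables (the latter are not inverted).\<close>

inductive_set cluster_algebra :: "('k::field \<Rightarrow> 'f::field) \<Rightarrow> nat \<Rightarrow> nat \<Rightarrow> 'f seed \<Rightarrow> 'f set"
  for \<iota> :: "'k::field \<Rightarrow> 'f::field" and n m :: nat and s0 :: "'f seed" where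
  scalar: "\<iota> c \<in> cluster_algebra \<iota> n m s0"
| var: "v \<in> all_vars n m s0 \<Longrightarrow> v \<in> cluster_algebra \<iota> n m s0"
| add: "a \<in> cluster_algebra \<iota> n m s0 \<Longrightarrow> b \<in> cluster_algebra \<iota> n m s0 \<Longrightarrow>
    a + b \<in> cluster_algebra \<iota> n m s0"
| mult: "a \<in> cluster_algebra \<iota> n m s0 \<Longrightarrow> b \<in> cluster_algebra \<iota> n m s0 \<Longrightarrow>
    a * b \<in> cluster_algebra \<iota> n m s0"

text \<open>The presentation sends the variable indexed by \<open>v\<close> to \<open>v\<close>.\<close>

definition presentation :: "('k::field \<Rightarrow> 'f::field) \<Rightarrow> ('f, 'k) mpoly \<Rightarrow> 'f" where
  "presentation \<iota> = eval_mpoly \<iota> (\<lambda>v. v)"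

text \<open>
  On \<open>K[z\<^sub>v | v \<in> all_vars]\<close> it is a surjection onto the cluster algebra, so the kernel of
  \<open>K[z] \<rightarrow> A\<close> may be computed in the ambient field.
\<close>

lemma field_embedding_0: "field_embedding \<iota> \<Longrightarrow> \<iota> 0 = 0"
  by (metis add_cancel_right_right field_embedding_def)

lemma eval_mpoly_superset:
  assumes "field_embedding \<iota>" "finite M" "Poly_Mapping.keys p \<subseteq> M"
  shows "eval_mpoly \<iota> x p =
    (\<Sum>m\<in>M. \<iota> (Poly_Mapping.lookup p m) *
       (\<Prod>v\<in>Poly_Mapping.keys m. x v ^ Poly_Mapping.lookup m v))"
  unfolding eval_mpoly_def using assms
  by (intro sum.mono_neutral_left) (auto simp: in_keys_iff field_embedding_0)

lemma eval_mpoly_add: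
  assumes "field_embedding \<iota>"
  shows "eval_mpoly \<iota> x (p + q) = eval_mpoly \<iota> x p + eval_mpoly \<iota> x q"
proof -
  let ?M = "Poly_Mapping.keys p \<union> Poly_Mapping.keys q"
  have "Poly_Mapping.keys (p + q) \<subseteq> ?M"
    by (rule Poly_Mapping.keys_add)
  then show ?thesis
    using assms
    by (simp add: eval_mpoly_superset[where M = ?M] lookup_add field_embedding_def
        distrib_right sum.distrib)
qed

lemma eval_mpoly_sum:
  assumes "field_embedding \<iota>"
  shows "eval_mpoly \<iota> x (\<Sum>i\<in>A. p i) = (\<Sum>i\<in>A. eval_mpoly \<iota> x (p i))"
proof (induction A rule: infinite_finite_induct)
  case (insert i A)
  then show ?case by (simp add: eval_mpoly_add[OF assms])
qed (simp_all add: eval_mpoly_def)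

lemma eval_mpoly_single:
  assumes "field_embedding \<iota>"
  shows "eval_mpoly \<iota> x (Poly_Mapping.single m c) =
    \<iota> c * (\<Prod>v\<in>Poly_Mapping.keys m. x v ^ Poly_Mapping.lookup m v)"
  using eval_mpoly_superset[OF assms, of "{m}" "Poly_Mapping.single m c" x] by simp

lemma prod_keys_add:
  fixes x :: "'v \<Rightarrow> 'f::comm_semiring_1"
  shows "(\<Prod>v\<in>Poly_Mapping.keys (a + b). x v ^ Poly_Mapping.lookup (a + b) v) =
    (\<Prod>v\<in>Poly_Mapping.keys a. x v ^ Poly_Mapping.lookup a v) *
    (\<Prod>v\<in>Poly_Mapping.keys b. x v ^ Poly_Mapping.lookup b v)"
proof -
  let ?M = "Poly_Mapping.keys a \<union> Poly_Mapping.keys b"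
  have *: "(\<Prod>v\<in>Poly_Mapping.keys c. x v ^ Poly_Mapping.lookup c v) =
      (\<Prod>v\<in>?M. x v ^ Poly_Mapping.lookup c v)" if "Poly_Mapping.keys c \<subseteq> ?M" for c :: "'v \<Rightarrow>\<^sub>0 nat"
    using that by (intro prod.mono_neutral_left) (auto simp: in_keys_iff)
  show ?thesis
    using Poly_Mapping.keys_add[of a b]
    by (subst *[of "a + b"], simp, subst *[of a], simp, subst *[of b], simp)
       (simp add: lookup_add power_add prod.distrib)
qed

lemma mpoly_sum_terms:
  fixes p :: "'a \<Rightarrow>\<^sub>0 'b::comm_monoid_add"
  shows "(\<Sum>a\<in>Poly_Mapping.keys p. Poly_Mapping.single a (Poly_Mapping.lookup p a)) = p"
  by (rule poly_mapping_eqI) (simp add: lookup_sum lookup_single when_def in_keys_iff)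

lemma eval_mpoly_mult:
  assumes "field_embedding \<iota>"
  shows "eval_mpoly \<iota> x (p * q) = eval_mpoly \<iota> x p * eval_mpoly \<iota> x q"
proof -
  have "p * q = (\<Sum>a\<in>Poly_Mapping.keys p. \<Sum>b\<in>Poly_Mapping.keys q.
      Poly_Mapping.single (a + b) (Poly_Mapping.lookup p a * Poly_Mapping.lookup q b))"
    by (subst mpoly_sum_terms[of p, symmetric], subst mpoly_sum_terms[of q, symmetric])
       (simp only: sum_product mult_single)
  then have "eval_mpoly \<iota> x (p * q) = (\<Sum>a\<in>Poly_Mapping.keys p. \<Sum>b\<in>Poly_Mapping.keys q.
      \<iota> (Poly_Mapping.lookup p a * Poly_Mapping.lookup q b) *
      (\<Prod>v\<in>Poly_Mapping.keys (a + b). x v ^ Poly_Mapping.lookup (a + b) v))"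
    by (simp add: eval_mpoly_sum[OF assms] eval_mpoly_single[OF assms])
  also have "\<dots> = eval_mpoly \<iota> x p * eval_mpoly \<iota> x q"
    using assms unfolding eval_mpoly_def prod_keys_add
    by (simp add: sum_product field_embedding_def mult_ac)
  finally show ?thesis .
qed

lemma poly_ring_add: "p \<in> poly_ring S \<Longrightarrow> q \<in> poly_ring S \<Longrightarrow> p + q \<in> poly_ring S"
  unfolding poly_ring_def using Poly_Mapping.keys_add[of p q] by blast

lemma poly_ring_mult: "p \<in> poly_ring S \<Longrightarrow> q \<in> poly_ring S \<Longrightarrow> p * q \<in> poly_ring S"
  unfolding poly_ring_def
  using keys_mult[of p q] Poly_Mapping.keys_add by (fastforce simp: subset_iff)

lemma cluster_algebra_prod:
  assumes "finite A" "field_embedding \<iota>" "\<And>v. v \<in> A \<Longrightarrow> v \<in> cluster_algebra \<iota> n m s0"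
  shows "(\<Prod>v\<in>A. v ^ e v) \<in> cluster_algebra \<iota> n m s0"
proof -
  have one: "1 \<in> cluster_algebra \<iota> n m s0"
    using cluster_algebra.scalar[of \<iota> 1] assms(2) by (simp add: field_embedding_def)
  have pow: "v ^ k \<in> cluster_algebra \<iota> n m s0" if "v \<in> A" for v k
    using that assms(3) by (induction k) (auto intro: one cluster_algebra.mult)
  show ?thesis
    using assms(1) pow by induction (auto intro: one cluster_algebra.mult)
qed

lemma presentation_image:
  fixes \<iota> :: "'k::field \<Rightarrow> 'f::field"
  assumes "field_embedding \<iota>"
  shows "presentation \<iota> ` poly_ring (all_vars n m s0) = cluster_algebra \<iota> n m s0"
proof (intro equalityI subsetI)
  fix a assume "a \<in> presentation \<iota> ` poly_ring (all_vars n m s0)"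
  then obtain p where p: "p \<in> poly_ring (all_vars n m s0)" and a: "a = presentation \<iota> p"
    by blast
  have zero: "0 \<in> cluster_algebra \<iota> n m s0"
    using cluster_algebra.scalar[of \<iota> 0] field_embedding_0[OF assms] by simp
  have "(\<Sum>k\<in>K. \<iota> (Poly_Mapping.lookup p k) *
      (\<Prod>v\<in>Poly_Mapping.keys k. v ^ Poly_Mapping.lookup k v)) \<in> cluster_algebra \<iota> n m s0"
    if "finite K" "K \<subseteq> Poly_Mapping.keys p" for K
    using that
  proof induction
    case (insert k K)
    have "(\<Prod>v\<in>Poly_Mapping.keys k. v ^ Poly_Mapping.lookup k v) \<in> cluster_algebra \<iota> n m s0"
      using insert.prems p assms
      by (intro cluster_algebra_prod) (auto simp: poly_ring_def intro: cluster_algebra.var)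
    with insert show ?case
      by (auto intro!: cluster_algebra.add cluster_algebra.mult cluster_algebra.scalar)
  qed (simp add: zero)
  then show "a \<in> cluster_algebra \<iota> n m s0"
    by (simp add: a presentation_def eval_mpoly_def)
next
  fix a assume "a \<in> cluster_algebra \<iota> n m s0"
  then show "a \<in> presentation \<iota> ` poly_ring (all_vars n m s0)"
  proof induction
    case (scalar c)
    show ?case
      by (rule image_eqI[of _ _ "Poly_Mapping.single 0 c"])
         (auto simp: presentation_def eval_mpoly_single[OF assms] poly_ring_def)
  next
    case (var v)
    then show ?case
      using assms
      by (intro image_eqI[of _ _ "Var v"])
         (auto simp: presentation_def Var_def eval_mpoly_single poly_ring_def field_embedding_def)
  next
    case (add a b)
    then obtain p q where pq: "p \<in> poly_ring (all_vars n m s0)" "q \<in> poly_ring (all_vars n m s0)"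
        "a = presentation \<iota> p" "b = presentation \<iota> q"
      by blast
    show ?case
      by (rule image_eqI[of _ _ "p + q"])
         (simp_all add: pq presentation_def eval_mpoly_add[OF assms] poly_ring_add)
  next
    case (mult a b)
    then obtain p q where pq: "p \<in> poly_ring (all_vars n m s0)" "q \<in> poly_ring (all_vars n m s0)"
        "a = presentation \<iota> p" "b = presentation \<iota> q"
      by blast
    show ?case
      by (rule image_eqI[of _ _ "p * q"])
         (simp_all add: pq presentation_def eval_mpoly_mult[OF assms] poly_ring_mult)
  qed
qed

definition cluster_ideal :: "('k::field \<Rightarrow> 'f::field) \<Rightarrow> nat \<Rightarrow> nat \<Rightarrow> 'f seed \<Rightarrow> ('f, 'k) mpoly set" where
  "cluster_ideal \<iota> n m s0 = {p \<in> poly_ring (all_vars n m s0). presentation \<iota> p = 0}"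

definition incompatible_ideal :: "nat \<Rightarrow> nat \<Rightarrow> 'f::field seed \<Rightarrow> ('f, 'k::comm_ring_1) mpoly set" where
  "incompatible_ideal n m s0 = ideal_gen (all_vars n m s0)
     {Var v * Var w | v w. v \<in> cluster_vars n m s0 \<and> w \<in> cluster_vars n m s0 \<and>
        \<not> (\<exists>C\<in>clusters n m s0. v \<in> C \<and> w \<in> C)}"

text \<open>
  The space \<open>\<real>\<^sup>S\<close> is the set of finitely supported functions with support in \<open>S\<close>. For finite \<open>S\<close>, the
  normed space structure on finitely supported functions induces the usual topology on it.
\<close>

definition weight_space :: "'v set \<Rightarrow> ('v \<Rightarrow>\<^sub>0 real) set" where
  "weight_space S = {\<omega>. Poly_Mapping.keys \<omega> \<subseteq> S}"

definition weight :: "('v \<Rightarrow>\<^sub>0 real) \<Rightarrow> ('v \<Rightarrow>\<^sub>0 nat) \<Rightarrow> real" where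
  "weight \<omega> m =
     (\<Sum>v\<in>Poly_Mapping.keys m. Poly_Mapping.lookup \<omega> v * real (Poly_Mapping.lookup m v))"

definition initial_form :: "('v \<Rightarrow>\<^sub>0 real) \<Rightarrow> ('v, 'k::comm_ring_1) mpoly \<Rightarrow> ('v, 'k) mpoly" where
  "initial_form \<omega> f =
     (\<Sum>m | m \<in> Poly_Mapping.keys f \<and> (\<forall>m'\<in>Poly_Mapping.keys f. weight \<omega> m' \<le> weight \<omega> m).
        Poly_Mapping.single m (Poly_Mapping.lookup f m))"

definition initial_ideal ::
    "'v set \<Rightarrow> ('v \<Rightarrow>\<^sub>0 real) \<Rightarrow> ('v, 'k::comm_ring_1) mpoly set \<Rightarrow> ('v, 'k) mpoly set" where
  "initial_ideal S \<omega> I = ideal_gen S (initial_form \<omega> ` I)"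

definition groebner_cone ::
    "('k::field \<Rightarrow> 'f::field) \<Rightarrow> nat \<Rightarrow> nat \<Rightarrow> 'f seed \<Rightarrow> ('f \<Rightarrow>\<^sub>0 real) set" where
  "groebner_cone \<iota> n m s0 =
     closure {\<omega> \<in> weight_space (all_vars n m s0).
        initial_ideal (all_vars n m s0) \<omega> (cluster_ideal \<iota> n m s0) = incompatible_ideal n m s0}"

definition lineality_space :: "'v::real_vector set \<Rightarrow> 'v set" where
  "lineality_space C = {w \<in> C. - w \<in> C}"

text \<open>
  Elements of the quotient space modulo \<open>L\<close> are cosets. A ray of the image of the cone \<open>C\<close> is a
  half-line, spanned by the image of an element of \<open>C\<close> outside \<open>L\<close>, that is a face of this image.
\<close>

definition quot_class :: "'v::real_vector set \<Rightarrow> 'v \<Rightarrow> 'v set" where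
  "quot_class L w = (+) w ` L"

definition generated_ray :: "'v::real_vector set \<Rightarrow> 'v \<Rightarrow> 'v set set" where
  "generated_ray L w = {quot_class L (c *\<^sub>R w) | c. 0 \<le> c}"

definition rays_mod_lineality :: "'v::real_vector set \<Rightarrow> 'v set set set" where
  "rays_mod_lineality C = (let L = lineality_space C in
     {R. (\<exists>w\<in>C. w \<notin> L \<and> R = generated_ray L w) \<and>
         (\<forall>y\<in>C. \<forall>z\<in>C. quot_class L (y + z) \<in> R \<longrightarrow> quot_class L y \<in> R \<and> quot_class L z \<in> R)})"

text \<open>
  The vertices of the \<open>N\<close>-gon are \<open>0, \<dots>, N - 1\<close> in counterclockwise order, the vertex labelled \<open>N\<close>
  being represented by \<open>0\<close>. The edge or diagonal with endpoints \<open>i\<close>, \<open>j\<close> is the set \<open>{i, j}\<close>.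
\<close>

definition ccw_offset :: "nat \<Rightarrow> nat \<Rightarrow> nat \<Rightarrow> nat" where
  "ccw_offset N i j = (j + N - i) mod N"

text \<open>The listed vertices are distinct and occur in this counterclockwise (cyclic) order.\<close>

definition ccw :: "nat \<Rightarrow> nat list \<Rightarrow> bool" where
  "ccw N vs \<longleftrightarrow> set vs \<subseteq> {..<N} \<and> sorted_wrt (<) (map (ccw_offset N (hd vs)) vs)"

definition seg_length :: "nat \<Rightarrow> nat \<Rightarrow> nat \<Rightarrow> nat" where
  "seg_length N i j = min (ccw_offset N i j) (ccw_offset N j i)"

definition edges :: "nat \<Rightarrow> nat set set" where
  "edges N = {{i, j} | i j. i < N \<and> j < N \<and> seg_length N i j = 1}"

definition diagonals :: "nat \<Rightarrow> nat set set" where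
  "diagonals N = {{i, j} | i j. i < N \<and> j < N \<and> 2 \<le> seg_length N i j}"

definition crossing :: "nat \<Rightarrow> nat set \<Rightarrow> nat set \<Rightarrow> bool" where
  "crossing N l k \<longleftrightarrow> (\<exists>a b c d. ccw N [a, b, c, d] \<and> l = {a, c} \<and> k = {b, d})"

definition triangulations :: "nat \<Rightarrow> nat set set set" where
  "triangulations N = {T. T \<subseteq> diagonals N \<and> (\<forall>l\<in>T. \<forall>k\<in>T. \<not> crossing N l k) \<and>
     (\<forall>l\<in>diagonals N - T. \<exists>k\<in>T. crossing N l k)}"

definition antipode :: "nat \<Rightarrow> nat \<Rightarrow> nat" where
  "antipode N i = (i + N div 2) mod N"

definition symmetric_triangulations :: "nat \<Rightarrow> nat set set set" where
  "symmetric_triangulations N = {T \<in> triangulations N. (\<lambda>l. antipode N ` l) ` T = T}"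

text \<open>For a segment whose two boundary arcs have different lengths, the vertices on the shorter one.\<close>

definition minor_arc :: "nat \<Rightarrow> nat \<Rightarrow> nat \<Rightarrow> nat set" where
  "minor_arc N i j =
     (if ccw_offset N i j < ccw_offset N j i
      then {k. k < N \<and> ccw_offset N i k \<le> ccw_offset N i j}
      else {k. k < N \<and> ccw_offset N j k \<le> ccw_offset N j i})"

definition segments_on_minor_arc :: "nat \<Rightarrow> nat \<Rightarrow> nat \<Rightarrow> nat set set" where
  "segments_on_minor_arc N i j =
     {{p, q} | p q. p \<in> minor_arc N i j \<and> q \<in> minor_arc N i j \<and> p \<noteq> q}"

datatype cluster_type = TypeA | TypeB | TypeC

text \<open>
  Cartan matrices, with rows and columns indexed from \<open>0\<close>, normalised by
  \<open>s\<^sub>i(\<alpha>\<^sub>j) = \<alpha>\<^sub>j - a\<^sub>i\<^sub>j \<alpha>\<^sub>i\<close>; the last simple root is short in type B and long in type C.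
\<close>

definition cartan_matrix :: "cluster_type \<Rightarrow> nat \<Rightarrow> nat \<Rightarrow> nat \<Rightarrow> int" where
  "cartan_matrix ty n i j =
     (if i = j then 2
      else if i = Suc j \<or> j = Suc i then
        (if (ty = TypeB \<and> Suc i = n \<and> i = Suc j) \<or> (ty = TypeC \<and> Suc j = n \<and> j = Suc i)
         then - 2 else - 1)
      else 0)"

definition cartan_counterpart :: "(nat \<Rightarrow> nat \<Rightarrow> int) \<Rightarrow> nat \<Rightarrow> nat \<Rightarrow> int" where
  "cartan_counterpart B i j = (if i = j then 2 else - \<bar>B i j\<bar>)"

definition has_type :: "cluster_type \<Rightarrow> nat \<Rightarrow> nat \<Rightarrow> 'f::field seed \<Rightarrow> bool" where
  "has_type ty n m s0 \<longleftrightarrow>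
     (\<exists>s\<in>mutation_class n m s0. \<exists>\<sigma>. bij_betw \<sigma> {..<n} {..<n} \<and>
        (\<forall>i<n. \<forall>j<n. cartan_counterpart (snd s) (\<sigma> i) (\<sigma> j) = cartan_matrix ty n i j))"

definition min_rank :: "cluster_type \<Rightarrow> nat" where
  "min_rank ty = (if ty = TypeA then 1 else 2)"

definition polygon_size :: "cluster_type \<Rightarrow> nat \<Rightarrow> nat" where
  "polygon_size ty n = (if ty = TypeA then n + 3 else 2 * n + 2)"

definition polygon_exchange_polys_A ::
    "nat \<Rightarrow> (nat set \<Rightarrow> 'f) \<Rightarrow> ('f, 'k::comm_ring_1) mpoly set" where
  "polygon_exchange_polys_A N x =
     {Var (x {a, c}) * Var (x {b, d})
        - Var (x {a, b}) * Var (x {c, d}) - Var (x {a, d}) * Var (x {b, c})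
      | a b c d. ccw N [a, b, c, d]}"

definition polygon_exchange_polys_BC ::
    "nat \<Rightarrow> nat \<Rightarrow> (nat set \<Rightarrow> 'f) \<Rightarrow> ('f, 'k::comm_ring_1) mpoly set" where
  "polygon_exchange_polys_BC r N x =
     {Var (x {a, c}) * Var (x {b, d})
        - Var (x {a, b}) * Var (x {c, d}) - Var (x {a, d}) * Var (x {b, c})
      | a b c d. ccw N [a, b, c, d, antipode N a]} \<union>
     {Var (x {a, c}) * Var (x {a, antipode N b})
        - Var (x {a, b}) * Var (x {a, antipode N c})
        - Var (x {a, antipode N a}) ^ (2 div r) * Var (x {b, c})
      | a b c. ccw N [a, b, c, antipode N a]} \<union>
     {Var (x {a, antipode N a}) * Var (x {b, antipode N b})
        - Var (x {a, b}) ^ r - Var (x {a, antipode N b}) ^ r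
      | a b. a < N \<and> b < N \<and> b \<noteq> a \<and> b \<noteq> antipode N a}"

text \<open>
  \<open>polygon_model_A \<iota> N n m s0 x\<close>: the variable attached to the segment \<open>l\<close> of the \<open>N\<close>-gon is \<open>x l\<close>. The
  argument \<open>\<iota>\<close> serves to fix the coefficient field of the exchange relations.
\<close>

definition polygon_model_A ::
    "('k::field \<Rightarrow> 'f::field) \<Rightarrow> nat \<Rightarrow> nat \<Rightarrow> nat \<Rightarrow> 'f seed \<Rightarrow> (nat set \<Rightarrow> 'f) \<Rightarrow> bool" where
  "polygon_model_A \<iota> N n m s0 x \<longleftrightarrow>
     bij_betw x (diagonals N) (cluster_vars n m s0) \<and>
     bij_betw x (edges N) (frozen_vars n m s0) \<and>
     clusters n m s0 = (\<lambda>T. x ` T) ` triangulations N \<and>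
     (exchange_polys n m s0 :: ('f, 'k) mpoly set) = polygon_exchange_polys_A N x"

text \<open>
  In types B and C variables are attached to antipodal pairs \<open>{l, l'}\<close>; \<open>x l\<close> is the one attached to
  the pair of \<open>l\<close>, so that \<open>x l = x k\<close> exactly if \<open>l\<close> and \<open>k\<close> define the same pair.
\<close>

definition polygon_model_BC ::
    "nat \<Rightarrow> ('k::field \<Rightarrow> 'f::field) \<Rightarrow> nat \<Rightarrow> nat \<Rightarrow> nat \<Rightarrow> 'f seed \<Rightarrow> (nat set \<Rightarrow> 'f) \<Rightarrow> bool" where
  "polygon_model_BC r \<iota> N n m s0 x \<longleftrightarrow>
     x ` diagonals N = cluster_vars n m s0 \<and>
     (\<forall>l\<in>diagonals N. \<forall>k\<in>diagonals N. x l = x k \<longleftrightarrow> k = l \<or> k = antipode N ` l) \<and>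
     x ` edges N = frozen_vars n m s0 \<and>
     (\<forall>l\<in>edges N. \<forall>k\<in>edges N. x l = x k \<longleftrightarrow> k = l \<or> k = antipode N ` l) \<and>
     clusters n m s0 = (\<lambda>T. x ` T) ` symmetric_triangulations N \<and>
     (exchange_polys n m s0 :: ('f, 'k) mpoly set) = polygon_exchange_polys_BC r N x"

fun polygon_model :: "cluster_type \<Rightarrow>
    ('k::field \<Rightarrow> 'f::field) \<Rightarrow> nat \<Rightarrow> nat \<Rightarrow> nat \<Rightarrow> 'f seed \<Rightarrow> (nat set \<Rightarrow> 'f) \<Rightarrow> bool" where
  "polygon_model TypeA = polygon_model_A"
| "polygon_model TypeB = polygon_model_BC 1"
| "polygon_model TypeC = polygon_model_BC 2"

text \<open>
  The vector \<open>v(l)\<close> for \<open>l = {i, j}\<close>. The basis vector attached to \<open>k\<close> (or to the antipodal pair of \<open>k\<close>)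
  is the one indexed by the variable \<open>x k\<close>.
\<close>

definition polygon_vector :: "nat \<Rightarrow> (nat set \<Rightarrow> 'f) \<Rightarrow> nat \<Rightarrow> nat \<Rightarrow> 'f \<Rightarrow>\<^sub>0 real" where
  "polygon_vector N x i j = - (\<Sum>k\<in>segments_on_minor_arc N i j. Poly_Mapping.single (x k) 1)"

definition polygon_vectors :: "nat \<Rightarrow> (nat set \<Rightarrow> 'f) \<Rightarrow> ('f \<Rightarrow>\<^sub>0 real) set" where
  "polygon_vectors N x =
     {polygon_vector N x i j | i j. i < N \<and> j < N \<and> i \<noteq> j \<and> seg_length N i j < N div 2}"

end

theory Submission
  imports Defs
begin

text \<open>
  Every pair of crossing segments has a straightening relation: the product of the two variables is a
  polynomial in which all other monomials are dominated as soon as \<open>\<omega>\<close> satisfies the strict Ptolemy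
  inequalities. (For crossing pairs in types B and C that are not exchangeable this relation is
  not an exchange relation; it is computed in \<open>s\<close>, \<open>t\<close> coordinates based at a vertex.) Since cluster
  monomials are linearly independent, the initial ideal is then exactly the ideal of incompatible pairs.
  Conversely, if the initial ideal is this monomial ideal, the exchange relations force the
  inequalities. Hence the Groebner cone is the closure of the solution set of the Ptolemy inequalities.

  These inequalities are nonnegative sums of the primitive ones, attached to pairs of nonadjacent boundary edges
  \<open>[a, a + 1]\<close>, \<open>[c, c + 1]\<close>, and the vector of a segment \<open>l\<close> is dual to the primitive inequality of the
  two edges at the ends of its minor arc. So the cone is an orthant modulo its lineality space and
  the vectors of the segments span its rays.

  For linear independence, all variables are expanded as Laurent polynomials in a fan
  triangulation at the vertex \<open>0\<close>. For suitable weights they have leading monomials, and a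
  noncrossing collection of segments can be reconstructed from the leading exponent as a
  parenthesization is reconstructed from its opening and closing brackets.
\<close>


text \<open>The weight \<open>\<omega>\<close> is real and need not be positive, so lowering the
  \<open>\<omega>\<close>-weight does not by itself end a rewriting process. A second, positive
  grading, for which all relations are homogeneous, confines the process to finitely many monomials.
  Linear independence then makes the normal form of a kernel element vanish, which is why no
  standard monomial survives in an initial form. The three types are treated together by counting
  the variable of a diameter with a multiplicity \<open>e\<close>: the rescaled weights
  \<open>W\<close> satisfy the same four-point inequalities in all types, and
  \<open>r * e = 2\<close> links type B (\<open>r = 1\<close>) with type C (\<open>r = 2\<close>).
  Characteristic zero enters through coefficients 2, for instance when the two exchange monomials of
  a mutation coincide. The difficulty of linear independence in types B and C is that a segment,
  taken modulo the antipodal map, can pass the centre on either side. Its leading exponent therefore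
  has to record, besides openings and closings, a winding about the centre.\<close>

abbreviation keys :: "('a \<Rightarrow>\<^sub>0 'b::zero) \<Rightarrow> 'a set" where
  "keys \<equiv> Poly_Mapping.keys"

abbreviation lookup :: "('a \<Rightarrow>\<^sub>0 'b::zero) \<Rightarrow> 'a \<Rightarrow> 'b" where
  "lookup \<equiv> Poly_Mapping.lookup"

abbreviation single :: "'a \<Rightarrow> 'b \<Rightarrow> 'a \<Rightarrow>\<^sub>0 'b::zero" where
  "single \<equiv> Poly_Mapping.single"

section \<open>Mutation preserves algebraic independence\<close>

lemma single_Var: "single (single v k) 1 = (Var v :: ('v, 'k::comm_ring_1) mpoly) ^ k"
proof (induction k)
  case (Suc k)
  have "single (single v (Suc k)) 1 =
      (Var v :: ('v, 'k) mpoly) * single (single v k) 1"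
    by (simp add: Var_def mult_single flip: single_add)
  then show ?case by (simp add: Suc)
qed simp

lemma eval_mpoly_one: "field_embedding \<iota> \<Longrightarrow> eval_mpoly \<iota> x 1 = 1"
  using eval_mpoly_single[of \<iota> x 0 1] by (simp add: field_embedding_def)

lemma eval_mpoly_Var: "field_embedding \<iota> \<Longrightarrow> eval_mpoly \<iota> x (Var v) = x v"
  unfolding Var_def by (simp add: eval_mpoly_single field_embedding_def)

lemma eval_mpoly_power: "field_embedding \<iota> \<Longrightarrow> eval_mpoly \<iota> x (p ^ k) = eval_mpoly \<iota> x p ^ k"
  by (induction k) (simp_all add: eval_mpoly_one eval_mpoly_mult)

lemma eval_mpoly_prod:
  "field_embedding \<iota> \<Longrightarrow> eval_mpoly \<iota> x (\<Prod>i\<in>A. p i) = (\<Prod>i\<in>A. eval_mpoly \<iota> x (p i))"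
  by (induction A rule: infinite_finite_induct) (simp_all add: eval_mpoly_one eval_mpoly_mult)

lemma eval_mpoly_zero [simp]: "eval_mpoly \<iota> x 0 = 0"
  by (simp add: eval_mpoly_def)

lemma eval_mpoly_diff:
  assumes "field_embedding \<iota>"
  shows "eval_mpoly \<iota> x (p - q) = eval_mpoly \<iota> x p - eval_mpoly \<iota> x q"
  using eval_mpoly_add[OF assms, of x "p - q" q] by simp

lemma poly_ring_0 [simp]: "0 \<in> poly_ring S"
  and poly_ring_1 [simp]: "1 \<in> poly_ring S"
  by (auto simp: poly_ring_def)

lemma poly_ring_Var: "v \<in> S \<Longrightarrow> Var v \<in> poly_ring S"
  by (auto simp: poly_ring_def Var_def)

lemma poly_ring_single: "keys a \<subseteq> S \<Longrightarrow> single a c \<in> poly_ring S"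
  by (auto simp: poly_ring_def)

lemma poly_ring_uminus: "p \<in> poly_ring S \<Longrightarrow> - p \<in> poly_ring S"
  by (simp add: poly_ring_def)

lemma poly_ring_diff: "p \<in> poly_ring S \<Longrightarrow> q \<in> poly_ring S \<Longrightarrow> p - q \<in> poly_ring S"
  using poly_ring_add[of p S "- q"] poly_ring_uminus[of q S] by simp

lemma poly_ring_power: "p \<in> poly_ring S \<Longrightarrow> p ^ k \<in> poly_ring S"
  by (induction k) (auto intro: poly_ring_mult)

lemma poly_ring_sum: "(\<And>i. i \<in> A \<Longrightarrow> p i \<in> poly_ring S) \<Longrightarrow> (\<Sum>i\<in>A. p i) \<in> poly_ring S"
  by (induction A rule: infinite_finite_induct) (auto intro: poly_ring_add)

lemma poly_ring_prod: "(\<And>i. i \<in> A \<Longrightarrow> p i \<in> poly_ring S) \<Longrightarrow> (\<Prod>i\<in>A. p i) \<in> poly_ring S"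
  by (induction A rule: infinite_finite_induct) (auto intro: poly_ring_mult)

lemma poly_ring_mono: "S \<subseteq> T \<Longrightarrow> p \<in> poly_ring S \<Longrightarrow> p \<in> poly_ring T"
  by (auto simp: poly_ring_def)

lemma single_one_eq_iff: "single a (Suc 0) = single b (Suc 0) \<longleftrightarrow> a = b"
proof
  assume "single a (Suc 0) = single b (Suc 0)"
  then have "keys (single a (Suc 0)) = keys (single b (Suc 0))"
    by simp
  then show "a = b" by simp
qed simp

lemma keys_nonempty_obtain:
  assumes "p \<noteq> 0" obtains a where "a \<in> keys p"
proof -
  have "\<exists>a. lookup p a \<noteq> 0"
  proof (rule ccontr)
    assume "\<not> ?thesis" then have "p = 0" by (intro poly_mapping_eqI) simp
    with assms show False by simp
  qed
  then show thesis using that by (auto simp: in_keys_iff)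
qed

lemma times_single_one_expand:
  fixes p :: "('v, 'k::comm_ring_1) mpoly"
  shows "p * single a 1 =
    (\<Sum>b\<in>keys p. single (b + a) (lookup p b))"
  by (subst mpoly_sum_terms[of p, symmetric]) (simp add: sum_distrib_right mult_single)

section \<open>Algebraic independence when one variable is replaced\<close>

definition poly_values :: "('k::field \<Rightarrow> 'f::field) \<Rightarrow> 'v set \<Rightarrow> ('v \<Rightarrow> 'f) \<Rightarrow> 'f set" where
  "poly_values \<iota> S x = eval_mpoly \<iota> x ` poly_ring S"

lemma poly_values_mult:
  "field_embedding \<iota> \<Longrightarrow> a \<in> poly_values \<iota> S x \<Longrightarrow> b \<in> poly_values \<iota> S x \<Longrightarrow> a * b \<in> poly_values \<iota> S x"
  unfolding poly_values_def
  by (auto simp: eval_mpoly_mult[symmetric] intro!: imageI poly_ring_mult)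

lemma poly_values_add:
  "field_embedding \<iota> \<Longrightarrow> a \<in> poly_values \<iota> S x \<Longrightarrow> b \<in> poly_values \<iota> S x \<Longrightarrow> a + b \<in> poly_values \<iota> S x"
  unfolding poly_values_def
  by (auto simp: eval_mpoly_add[symmetric] intro!: imageI poly_ring_add)

lemma poly_values_var: "field_embedding \<iota> \<Longrightarrow> v \<in> S \<Longrightarrow> x v \<in> poly_values \<iota> S x"
  unfolding poly_values_def using eval_mpoly_Var[of \<iota> x v] poly_ring_Var[of v S] by (metis imageI)

lemma poly_values_one: "field_embedding \<iota> \<Longrightarrow> 1 \<in> poly_values \<iota> S x"
  unfolding poly_values_def using eval_mpoly_one[of \<iota> x] poly_ring_1 by (metis imageI)

lemma poly_values_power: "field_embedding \<iota> \<Longrightarrow> a \<in> poly_values \<iota> S x \<Longrightarrow> a ^ k \<in> poly_values \<iota> S x"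
  by (induction k) (auto intro: poly_values_mult poly_values_one)

lemma poly_values_prod:
  "field_embedding \<iota> \<Longrightarrow> (\<And>i. i \<in> A \<Longrightarrow> f i \<in> poly_values \<iota> S x) \<Longrightarrow> (\<Prod>i\<in>A. f i) \<in> poly_values \<iota> S x"
  by (induction A rule: infinite_finite_induct) (auto intro: poly_values_mult poly_values_one)

text \<open>Lifting the coefficients to polynomials free of the \<open>k\<close>-th variable yields
  one polynomial that vanishes at \<open>x\<close>, hence is zero. Monomials coming from different
  powers of that variable are different, so each coefficient polynomial is zero on its own.\<close>

lemma algebraically_independent_transcendental:
  assumes emb: "field_embedding \<iota>" and ind: "algebraically_independent \<iota> m x" and k: "k < m"
    and g: "\<And>t. t \<le> D \<Longrightarrow> g t \<in> poly_values \<iota> ({..<m} - {k}) x"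
    and sum0: "(\<Sum>t\<le>D. g t * x k ^ t) = 0" and t: "t \<le> D"
  shows "g t = 0"
proof -
  have "\<forall>t\<in>{..D}. \<exists>G. G \<in> poly_ring ({..<m} - {k}) \<and> eval_mpoly \<iota> x G = g t"
    using g unfolding poly_values_def by (metis (no_types, lifting) atMost_iff imageE)
  then obtain G where G: "\<And>t. t \<le> D \<Longrightarrow> G t \<in> poly_ring ({..<m} - {k})"
      "\<And>t. t \<le> D \<Longrightarrow> eval_mpoly \<iota> x (G t) = g t"
    by (metis atMost_iff bchoice)
  define P where "P = (\<Sum>t\<le>D. G t * single (single k t) 1)"
  have "P \<in> poly_ring {..<m}"
    unfolding P_def using G(1) k
    by (intro poly_ring_sum poly_ring_mult poly_ring_single) (auto intro: poly_ring_mono[of "{..<m} - {k}"])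
  moreover have "eval_mpoly \<iota> x P = 0"
    using sum0 by (simp add: P_def eval_mpoly_sum emb eval_mpoly_mult G single_Var eval_mpoly_power eval_mpoly_Var)
  ultimately have "P = 0" using ind by (auto simp: algebraically_independent_def)
  have noK: "lookup \<mu> k = 0" if "\<mu> \<in> keys (G t')" "t' \<le> D" for \<mu> t'
  proof -
    have "keys \<mu> \<subseteq> {..<m} - {k}"
      using G(1)[OF that(2)] that(1) unfolding poly_ring_def by blast
    then have "k \<notin> keys \<mu>" by blast
    then show ?thesis by (simp add: in_keys_iff)
  qed
  have "G t = 0"
  proof (rule ccontr)
    assume "G t \<noteq> 0"
    then obtain \<nu> where \<nu>: "\<nu> \<in> keys (G t)" by (rule keys_nonempty_obtain)
    have "lookup (G t' * single (single k t') 1) (\<nu> + single k t)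
        = (if t' = t then lookup (G t) \<nu> else 0)" if "t' \<le> D" for t'
    proof -
      have "\<mu> + single k t' = \<nu> + single k t \<longleftrightarrow> t' = t \<and> \<mu> = \<nu>"
        if "\<mu> \<in> keys (G t')" for \<mu>
      proof
        assume eq: "\<mu> + single k t' = \<nu> + single k t"
        from arg_cong[OF eq, of "\<lambda>z. lookup z k"] have "t' = t"
          using noK[OF that \<open>t' \<le> D\<close>] noK[OF \<nu> t] by (simp add: lookup_add)
        with eq show "t' = t \<and> \<mu> = \<nu>" by simp
      qed simp
      then have "lookup (G t' * single (single k t') 1) (\<nu> + single k t)
        = (\<Sum>\<mu>\<in>keys (G t'). if t' = t \<and> \<mu> = \<nu> then lookup (G t') \<mu> else 0)"
        unfolding times_single_one_expand lookup_sum by (intro sum.cong) (auto simp: lookup_single when_def)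
      also have "\<dots> = (if t' = t then lookup (G t) \<nu> else 0)"
        using \<nu> by (auto simp: sum.delta')
      finally show ?thesis .
    qed
    then have "lookup P (\<nu> + single k t) = lookup (G t) \<nu>"
      using t by (simp add: P_def lookup_sum)
    with \<open>P = 0\<close> \<nu> show False by (simp add: in_keys_iff)
  qed
  then show ?thesis using G(2)[OF t] by simp
qed

text \<open>Sorted by powers of the \<open>k\<close>-th variable, a polynomial has coefficients with
  the same values at \<open>x\<close> and at \<open>x'\<close>. The hypothesis on
  \<open>x' k\<close> makes these values vanish, and independence of \<open>x\<close> then makes the
  coefficients themselves vanish.\<close>

lemma algebraically_independent_replace:
  assumes emb: "field_embedding \<iota>" and ind: "algebraically_independent \<iota> m x" and k: "k < m"
    and off: "\<And>i. i \<noteq> k \<Longrightarrow> x' i = x i"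
    and transc: "\<And>D g t. (\<And>t. t \<le> D \<Longrightarrow> g t \<in> poly_values \<iota> ({..<m} - {k}) x) \<Longrightarrow>
        (\<Sum>t\<le>D. g t * x' k ^ t) = 0 \<Longrightarrow> t \<le> D \<Longrightarrow> g t = 0"
  shows "algebraically_independent \<iota> m x'"
  unfolding algebraically_independent_def
proof (intro ballI impI)
  fix p assume p: "p \<in> poly_ring {..<m}" and ev: "eval_mpoly \<iota> x' p = 0"
  \<comment> \<open>\<open>r\<close> deletes the \<open>k\<close>-th variable from a monomial, so
    \<open>G t\<close> is the coefficient of the \<open>t\<close>-th power of that variable;
    \<open>D\<close> bounds the powers that occur.\<close>
  define r where "r = (\<lambda>\<mu>::nat \<Rightarrow>\<^sub>0 nat. Poly_Mapping.update k 0 \<mu>)"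
  have r: "\<mu> = r \<mu> + single k (lookup \<mu> k)" for \<mu>
    by (rule poly_mapping_eqI) (auto simp: r_def lookup_add lookup_single lookup_update when_def)
  have keys_r: "keys (r \<mu>) = keys \<mu> - {k}" for \<mu>
    by (simp add: r_def keys_update)
  define K where "K t = {\<mu> \<in> keys p. lookup \<mu> k = t}" for t
  define G where "G t = (\<Sum>\<mu>\<in>K t. single (r \<mu>) (lookup p \<mu>))" for t
  define D where "D = (\<Sum>\<mu>\<in>keys p. lookup \<mu> k)"
  have D: "lookup \<mu> k \<le> D" if "\<mu> \<in> keys p" for \<mu>
    unfolding D_def by (rule member_le_sum) (use that in auto)
  have G_ring: "G t \<in> poly_ring ({..<m} - {k})" for t
    unfolding G_def using p by (intro poly_ring_sum poly_ring_single) (auto simp: K_def keys_r poly_ring_def)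
  have mon: "(\<Prod>v\<in>keys \<mu>. x' v ^ lookup \<mu> v) =
      (\<Prod>v\<in>keys (r \<mu>). x v ^ lookup (r \<mu>) v) * x' k ^ lookup \<mu> k" for \<mu>
  proof -
    have "(\<Prod>v\<in>keys (r \<mu>). x' v ^ lookup (r \<mu>) v) =
        (\<Prod>v\<in>keys (r \<mu>). x v ^ lookup (r \<mu>) v)"
      by (intro prod.cong) (auto simp: keys_r off)
    then show ?thesis
      by (subst (1 2) r) (simp add: prod_keys_add)
  qed
  have "eval_mpoly \<iota> x' p = (\<Sum>t\<le>D. \<Sum>\<mu>\<in>K t. \<iota> (lookup p \<mu>) *
      (\<Prod>v\<in>keys \<mu>. x' v ^ lookup \<mu> v))"
    unfolding eval_mpoly_def K_def
    by (rule sum.group[symmetric]) (auto simp: D)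
  also have "\<dots> = (\<Sum>t\<le>D. eval_mpoly \<iota> x (G t) * x' k ^ t)"
    unfolding G_def eval_mpoly_sum[OF emb] eval_mpoly_single[OF emb] sum_distrib_right
    by (intro sum.cong refl) (auto simp: mon K_def mult_ac)
  finally have "(\<Sum>t\<le>D. eval_mpoly \<iota> x (G t) * x' k ^ t) = 0" using ev by simp
  then have "eval_mpoly \<iota> x (G t) = 0" if "t \<le> D" for t
    using transc[of D "\<lambda>t. eval_mpoly \<iota> x (G t)" t] that G_ring by (auto simp: poly_values_def)
  then have G0: "G t = 0" if "t \<le> D" for t
    using ind that poly_ring_mono[OF _ G_ring, of "{..<m}" t] by (auto simp: algebraically_independent_def)
  show "p = 0"
  proof (rule ccontr)
    assume "p \<noteq> 0"
    then obtain \<mu> where \<mu>: "\<mu> \<in> keys p" by (rule keys_nonempty_obtain)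
    let ?t = "lookup \<mu> k"
    have "lookup (G ?t) (r \<mu>) = (\<Sum>\<nu>\<in>K ?t. if \<nu> = \<mu> then lookup p \<mu> else 0)"
      unfolding G_def lookup_sum
    proof (intro sum.cong refl)
      fix \<nu> assume "\<nu> \<in> K ?t"
      then have "r \<nu> = r \<mu> \<longleftrightarrow> \<nu> = \<mu>" using r[of \<nu>] r[of \<mu>] by (auto simp: K_def)
      then show "lookup (single (r \<nu>) (lookup p \<nu>)) (r \<mu>) =
          (if \<nu> = \<mu> then lookup p \<mu> else 0)"
        by (auto simp: lookup_single when_def)
    qed
    also have "\<dots> = lookup p \<mu>" using \<mu> by (simp add: K_def)
    finally show False using G0[OF D[OF \<mu>]] \<mu> by (simp add: in_keys_iff)
  qed
qed

lemma algebraically_independent_nonzero: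
  assumes "field_embedding \<iota>" "algebraically_independent \<iota> m x" "i < m"
  shows "x i \<noteq> 0"
proof
  assume "x i = 0"
  then have "Var i = (0 :: (nat, 'a) mpoly)"
    using assms poly_ring_Var[of i "{..<m}"] eval_mpoly_Var[of \<iota> x i]
    unfolding algebraically_independent_def by (metis lessThan_iff)
  then show False by (simp add: Var_def flip: keys_eq_empty)
qed

lemma algebraically_independent_inj:
  fixes \<iota> :: "'k::field \<Rightarrow> 'f::field"
  assumes "field_embedding \<iota>" "algebraically_independent \<iota> m x"
  shows "inj_on x {..<m}"
proof (rule inj_onI, rule ccontr)
  fix i j assume ij: "i \<in> {..<m}" "j \<in> {..<m}" "x i = x j" "i \<noteq> j"
  let ?p = "Var i - Var j :: (nat, 'k) mpoly"
  have "?p \<in> poly_ring {..<m}"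
    using ij by (intro poly_ring_diff poly_ring_Var) auto
  moreover have "eval_mpoly \<iota> x ?p = 0"
    using ij by (simp add: eval_mpoly_diff eval_mpoly_Var assms(1))
  ultimately have "?p = 0" using assms(2) unfolding algebraically_independent_def by blast
  then have "lookup (Var i - Var j :: (nat, 'k) mpoly) (single i 1) = 0" by simp
  then show False
    using ij by (auto simp: Var_def lookup_minus lookup_single when_def single_one_eq_iff split: if_splits)
qed

lemma Var_power_prod:
  "finite A \<Longrightarrow> (\<Prod>i\<in>A. Var i ^ e i) =
    (single (\<Sum>i\<in>A. single i (e i)) 1 :: ('v, 'k::comm_ring_1) mpoly)"
  by (induction A rule: finite_induct) (simp_all add: single_Var[symmetric] mult_single)

section \<open>Mutation, and the exchange relations as identities in the field\<close>

definition exchange_numerator :: "nat \<Rightarrow> nat \<Rightarrow> 'f::field seed \<Rightarrow> 'f" where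
  "exchange_numerator m k s =
     (\<Prod>i<m. fst s i ^ nat (snd s i k)) + (\<Prod>i<m. fst s i ^ nat (- snd s i k))"

text \<open>As a polynomial, its coefficient at the first exchange monomial is 1, or 2 if the two
  exchange monomials coincide; here characteristic zero is used.\<close>

lemma exchange_numerator_nonzero:
  fixes \<iota> :: "'k::field_char_0 \<Rightarrow> 'f::field"
  assumes emb: "field_embedding \<iota>" and ind: "algebraically_independent \<iota> m (fst s)"
  shows "exchange_numerator m k s \<noteq> 0"
proof
  assume 0: "exchange_numerator m k s = 0"
  define P :: "(nat, 'k) mpoly" where
    "P = (\<Prod>i<m. Var i ^ nat (snd s i k)) + (\<Prod>i<m. Var i ^ nat (- snd s i k))"
  have "P \<in> poly_ring {..<m}"
    unfolding P_def by (intro poly_ring_add poly_ring_prod poly_ring_power poly_ring_Var) auto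
  moreover have "eval_mpoly \<iota> (fst s) P = 0"
    using 0 by (simp add: P_def exchange_numerator_def eval_mpoly_add eval_mpoly_prod eval_mpoly_power
      eval_mpoly_Var emb)
  ultimately have "P = 0" using ind by (auto simp: algebraically_independent_def)
  then have *: "lookup P (\<Sum>i<m. single i (nat (snd s i k))) = 0" by simp
  show False
    using * by (auto simp: P_def Var_power_prod lookup_add lookup_single when_def split: if_splits)
qed

text \<open>The new variable is \<open>Q / x k\<close> with a numerator \<open>Q\<close> that does
  not involve \<open>x k\<close>, because the diagonal entry is 0. Multiplied by
  \<open>x k ^ D\<close>, a polynomial relation for it becomes one for \<open>x k\<close>, with the
  coefficients in reverse order.\<close>

lemma algebraically_independent_mutate:
  fixes \<iota> :: "'k::field_char_0 \<Rightarrow> 'f::field"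
  assumes emb: "field_embedding \<iota>" and ind: "algebraically_independent \<iota> m (fst s)"
    and k: "k < m" and diag: "snd s k k = 0"
  shows "algebraically_independent \<iota> m (fst (mutate m k s))"
proof (rule algebraically_independent_replace[OF emb ind k])
  let ?x = "fst s" and ?Q = "exchange_numerator m k s" and ?R = "poly_values \<iota> ({..<m} - {k}) (fst s)"
  show "fst (mutate m k s) i = fst s i" if "i \<noteq> k" for i
    using that by (simp add: mutate_def)
  have xk: "?x k \<noteq> 0" using algebraically_independent_nonzero[OF emb ind k] .
  have Q: "?Q \<in> ?R"
    unfolding exchange_numerator_def
  proof (intro poly_values_add poly_values_prod emb)
    fix i assume "i \<in> {..<m}"
    then show "fst s i ^ nat (snd s i k) \<in> ?R" "fst s i ^ nat (- snd s i k) \<in> ?R"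
      using diag by (cases "i = k"; auto intro: poly_values_one poly_values_power poly_values_var emb)+
  qed
  fix D g and t :: nat
  assume g: "\<And>t. t \<le> D \<Longrightarrow> g t \<in> ?R"
    and sum0: "(\<Sum>t\<le>D. g t * fst (mutate m k s) k ^ t) = 0" and t: "t \<le> D"
  have "(\<Sum>t\<le>D. g t * (?Q / ?x k) ^ t) = 0"
    using sum0 by (simp add: mutate_def mutated_var_def exchange_numerator_def)
  then have "0 = (\<Sum>t\<le>D. g t * (?Q / ?x k) ^ t) * ?x k ^ D" by simp
  also have "\<dots> = (\<Sum>t\<le>D. (g t * ?Q ^ t) * ?x k ^ (D - t))"
    unfolding sum_distrib_right
    by (intro sum.cong) (auto simp: power_diff xk power_divide)
  also have "\<dots> = (\<Sum>t\<le>D. (g (D - t) * ?Q ^ (D - t)) * ?x k ^ t)"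
    by (rule sum.reindex_bij_witness[of _ "\<lambda>t. D - t" "\<lambda>t. D - t"]) auto
  finally have "(\<Sum>t\<le>D. (g (D - t) * ?Q ^ (D - t)) * ?x k ^ t) = 0" by simp
  moreover have "g (D - t) * ?Q ^ (D - t) \<in> ?R" for t
    by (intro poly_values_mult poly_values_power emb g Q) simp
  ultimately have "g (D - (D - t)) * ?Q ^ (D - (D - t)) = 0"
    by (intro algebraically_independent_transcendental[OF emb ind k, of D "\<lambda>t. g (D - t) * ?Q ^ (D - t)"]) auto
  then show "g t = 0" using exchange_numerator_nonzero[OF emb ind, of k] t by simp
qed

lemma skew_symmetrizable_diag:
  assumes "skew_symmetrizable n B" "k < n" shows "B k k = 0"
proof -
  obtain d where d: "\<forall>i<n. 0 < d i" "\<forall>i<n. \<forall>j<n. d i * B i j = - (d j * B j i)"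
    using assms by (auto simp: skew_symmetrizable_def)
  then have "d k * B k k = - (d k * B k k)" "0 < d k" using assms(2) by blast+
  then show ?thesis by auto
qed

text \<open>The same symmetrizer \<open>d\<close> works after the mutation.\<close>

lemma skew_symmetrizable_mutated_matrix:
  assumes "skew_symmetrizable n B" "k < n"
  shows "skew_symmetrizable n (mutated_matrix k B)"
proof -
  obtain d :: "nat \<Rightarrow> int" where d: "\<And>i. i < n \<Longrightarrow> 0 < d i"
      "\<And>i j. i < n \<Longrightarrow> j < n \<Longrightarrow> d i * B i j = - (d j * B j i)"
    using assms by (auto simp: skew_symmetrizable_def)
  have key: "d i * (\<bar>B i k\<bar> * B k j + B i k * \<bar>B k j\<bar>) = - (d j * (\<bar>B j k\<bar> * B k i + B j k * \<bar>B k i\<bar>))"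
    if "i < n" "j < n" for i j
  proof -
    have a: "d i * \<bar>B i k\<bar> = d k * \<bar>B k i\<bar>" "d j * \<bar>B j k\<bar> = d k * \<bar>B k j\<bar>"
      using d(1)[of i] d(1)[of k] d(1)[of j] d(2)[of i k] d(2)[of j k] that assms(2)
      by (metis abs_minus_cancel abs_mult abs_of_pos)+
    have "d i * (\<bar>B i k\<bar> * B k j + B i k * \<bar>B k j\<bar>) = (d i * \<bar>B i k\<bar>) * B k j + (d i * B i k) * \<bar>B k j\<bar>"
      by (simp add: algebra_simps)
    also have "\<dots> = \<bar>B k i\<bar> * (d k * B k j) - B k i * (d k * \<bar>B k j\<bar>)"
      using d(2)[of i k] that assms(2) a by (simp add: algebra_simps)
    also have "\<dots> = - \<bar>B k i\<bar> * (d j * B j k) - B k i * (d j * \<bar>B j k\<bar>)"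
      using d(2)[of k j] that assms(2) a by simp
    finally show ?thesis by (simp add: algebra_simps)
  qed
  \<comment> \<open>The division by 2 in the mutation rule is exact: the sum is 0 for opposite signs
    and twice \<open>\<bar>a\<bar> * b\<close> otherwise.\<close>
  have ev: "2 * ((\<bar>a\<bar> * b + a * \<bar>b\<bar>) div 2) = \<bar>a\<bar> * b + a * \<bar>b\<bar>" for a b :: int
    by (cases "a \<ge> 0"; cases "b \<ge> 0") (auto simp: abs_if)
  have "d i * mutated_matrix k B i j = - (d j * mutated_matrix k B j i)" if "i < n" "j < n" for i j
  proof (cases "i = k \<or> j = k")
    case True then show ?thesis using d(2)[OF that] by (auto simp: mutated_matrix_def)
  next
    case False
    have "2 * (d i * mutated_matrix k B i j) = 2 * (d i * B i j) + d i * (\<bar>B i k\<bar> * B k j + B i k * \<bar>B k j\<bar>)"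
      if "i \<noteq> k" "j \<noteq> k" for i j
      using that ev[of "B i k" "B k j"] unfolding mutated_matrix_def by (simp add: algebra_simps)
    from this[of i j] this[of j i] key[OF that] d(2)[OF that] False show ?thesis by auto
  qed
  then show ?thesis using d(1) by (auto simp: skew_symmetrizable_def)
qed

text \<open>Skew-symmetrizability is carried along because it forces the zero diagonal on which the
  independence of the next cluster relies.\<close>

lemma mutation_class_invariants:
  fixes \<iota> :: "'k::field_char_0 \<Rightarrow> 'f::field"
  assumes emb: "field_embedding \<iota>" and s0: "is_seed \<iota> n m s0" and s: "s \<in> mutation_class n m s0"
  shows "algebraically_independent \<iota> m (fst s) \<and> skew_symmetrizable n (snd s) \<and>
    (\<forall>i\<ge>n. fst s i = fst s0 i)"
  using s
proof induction
  case initial then show ?case using s0 by (auto simp: is_seed_def)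
next
  case (mutation s k)
  then have ih: "algebraically_independent \<iota> m (fst s)" "skew_symmetrizable n (snd s)"
    "\<forall>i\<ge>n. fst s i = fst s0 i" by auto
  have "k < m" using s0 mutation by (simp add: is_seed_def)
  then have "algebraically_independent \<iota> m (fst (mutate m k s))"
    by (rule algebraically_independent_mutate[OF emb ih(1) _ skew_symmetrizable_diag[OF ih(2) mutation(2)]])
  moreover have "skew_symmetrizable n (snd (mutate m k s))"
    using skew_symmetrizable_mutated_matrix[OF ih(2) mutation(2)] by (simp add: mutate_def)
  moreover have "\<forall>i\<ge>n. fst (mutate m k s) i = fst s0 i"
    using ih(3) mutation(2) by (simp add: mutate_def)
  ultimately show ?case by blast
qed

text \<open>The polygon models only equate sets of polynomials. Through this lemma these equations
  become identities between elements of the field.\<close>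

lemma exchange_polys_presentation:
  fixes \<iota> :: "'k::field_char_0 \<Rightarrow> 'f::field"
  assumes emb: "field_embedding \<iota>" and s0: "is_seed \<iota> n m s0"
    and p: "p \<in> (exchange_polys n m s0 :: ('f, 'k) mpoly set)"
  shows "presentation \<iota> p = 0"
proof -
  from p obtain s k where s: "s \<in> mutation_class n m s0" "k < n"
    and pe: "p = Var (fst s k) * Var (mutated_var m k s)
        - (\<Prod>i<m. Var (fst s i) ^ nat (snd s i k)) - (\<Prod>i<m. Var (fst s i) ^ nat (- snd s i k))"
    by (auto simp: exchange_polys_def)
  have "fst s k \<noteq> 0"
    using mutation_class_invariants[OF emb s0 s(1)] algebraically_independent_nonzero[OF emb, of m "fst s" k] s(2) s0
    by (auto simp: is_seed_def)
  then show ?thesis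
    by (simp add: pe presentation_def eval_mpoly_diff eval_mpoly_mult eval_mpoly_prod eval_mpoly_power
        eval_mpoly_Var emb mutated_var_def)
qed

definition laurent :: "'f set \<Rightarrow> ('f::field \<Rightarrow>\<^sub>0 int) \<Rightarrow> 'f" where
  "laurent Y e = (\<Prod>y\<in>Y. y powi lookup e y)"

text \<open>Adding a common bound \<open>B\<close> to all exponents turns the Laurent monomials into
  ordinary ones without identifying different exponents.\<close>

lemma laurent_independent:
  assumes emb: "field_embedding \<iota>" and ind: "algebraically_independent \<iota> m x"
    and E: "finite E" "\<And>e. e \<in> E \<Longrightarrow> keys e \<subseteq> x ` {..<m}"
    and sum0: "(\<Sum>e\<in>E. \<iota> (c e) * laurent (x ` {..<m}) e) = 0" and e: "e \<in> E"
  shows "c e = 0"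
proof -
  let ?Y = "x ` {..<m}"
  define B where "B = (\<Sum>e\<in>E. \<Sum>i<m. nat \<bar>lookup e (x i)\<bar>)"
  have B: "0 \<le> lookup e (x i) + int B" if "e \<in> E" "i < m" for e i
  proof -
    have "nat \<bar>lookup e (x i)\<bar> \<le> (\<Sum>i<m. nat \<bar>lookup e (x i)\<bar>)"
      by (rule member_le_sum) (use that in auto)
    also have "\<dots> \<le> B" unfolding B_def by (rule member_le_sum) (use that E in auto)
    finally show ?thesis by linarith
  qed
  define M where "M e = (\<Sum>i<m. single i (nat (lookup e (x i) + int B)))" for e
  have lookM: "lookup (M e) i = (if i < m then nat (lookup e (x i) + int B) else 0)" for e i
    by (simp add: M_def lookup_sum lookup_single when_def)
  have keysM: "keys (M e) \<subseteq> {..<m}" for e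
    by (auto simp: in_keys_iff lookM split: if_splits)
  have injM: "inj_on M E"
  proof (rule inj_onI)
    fix e e' assume ee: "e \<in> E" "e' \<in> E" "M e = M e'"
    show "e = e'"
    proof (rule poly_mapping_eqI)
      fix y
      show "lookup e y = lookup e' y"
      proof (cases "y \<in> ?Y")
        case True
        then obtain i where i: "i < m" "y = x i" by auto
        have "lookup (M e) i = lookup (M e') i" using ee by simp
        then show ?thesis using B[OF ee(1) i(1)] B[OF ee(2) i(1)] i by (simp add: lookM)
      next
        case False
        then show ?thesis using E(2)[OF ee(1)] E(2)[OF ee(2)] by (metis in_keys_iff subsetD)
      qed
    qed
  qed
  define P where "P = (\<Sum>e\<in>E. single (M e) (c e))"
  have inj: "inj_on x {..<m}" using algebraically_independent_inj[OF emb ind] .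
  have mon: "(\<Prod>v\<in>keys (M e). x v ^ lookup (M e) v) =
      laurent ?Y e * (\<Prod>i<m. x i ^ B)" if "e \<in> E" for e
  proof -
    have "(\<Prod>v\<in>keys (M e). x v ^ lookup (M e) v) =
        (\<Prod>v<m. x v ^ lookup (M e) v)"
      using keysM by (intro prod.mono_neutral_left) (auto simp: in_keys_iff)
    also have "\<dots> = (\<Prod>i<m. x i powi lookup e (x i) * x i ^ B)"
    proof (intro prod.cong refl)
      fix i assume i: "i \<in> {..<m}"
      have "x i ^ lookup (M e) i = x i powi (lookup e (x i) + int B)"
        using B[OF that, of i] i by (simp add: lookM power_int_def)
      also have "\<dots> = x i powi lookup e (x i) * x i ^ B"
        using algebraically_independent_nonzero[OF emb ind, of i] i by (simp add: power_int_add)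
      finally show "x i ^ lookup (M e) i = x i powi lookup e (x i) * x i ^ B" .
    qed
    finally show ?thesis by (simp add: laurent_def prod.reindex[OF inj] prod.distrib)
  qed
  have "eval_mpoly \<iota> x P = (\<Sum>e\<in>E. \<iota> (c e) * laurent ?Y e) * (\<Prod>i<m. x i ^ B)"
    by (simp add: P_def eval_mpoly_sum eval_mpoly_single emb mon sum_distrib_right mult.assoc)
  then have "eval_mpoly \<iota> x P = 0" using sum0 by simp
  moreover have "P \<in> poly_ring {..<m}"
    unfolding P_def using keysM by (intro poly_ring_sum poly_ring_single) auto
  ultimately have "P = 0" using ind by (auto simp: algebraically_independent_def)
  have "lookup P (M e) = (\<Sum>e'\<in>E. if e' = e then c e else 0)"
    unfolding P_def lookup_sum using e injM
    by (intro sum.cong) (auto simp: lookup_single when_def inj_on_def)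
  then show ?thesis using \<open>P = 0\<close> E e by simp
qed

section \<open>Degenerations to monomial ideals\<close>

lemma ideal_gen_base: "g \<in> G \<Longrightarrow> c \<in> poly_ring S \<Longrightarrow> c * g \<in> ideal_gen S G"
  unfolding ideal_gen_def by (rule CollectI, rule exI[of _ "{g}"], rule exI[of _ "\<lambda>_. c"]) auto

lemma ideal_gen_zero: "0 \<in> ideal_gen S G"
  unfolding ideal_gen_def by (rule CollectI, rule exI[of _ "{}"]) auto

lemma ideal_gen_add:
  assumes "p \<in> ideal_gen S G" "q \<in> ideal_gen S G" shows "p + q \<in> ideal_gen S G"
proof -
  obtain H c where p: "p = (\<Sum>g\<in>H. c g * g)" "finite H" "H \<subseteq> G" "\<forall>g\<in>H. c g \<in> poly_ring S"
    using assms(1) by (auto simp: ideal_gen_def)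
  obtain H' c' where q: "q = (\<Sum>g\<in>H'. c' g * g)" "finite H'" "H' \<subseteq> G" "\<forall>g\<in>H'. c' g \<in> poly_ring S"
    using assms(2) by (auto simp: ideal_gen_def)
  let ?c = "\<lambda>g. if g \<in> H then c g else 0" and ?c' = "\<lambda>g. if g \<in> H' then c' g else 0"
  have "p = (\<Sum>g\<in>H \<union> H'. ?c g * g)" "q = (\<Sum>g\<in>H \<union> H'. ?c' g * g)"
    unfolding p(1) q(1) using p(2) q(2) by (intro sum.mono_neutral_cong_left; auto)+
  then have "p + q = (\<Sum>g\<in>H \<union> H'. (?c g + ?c' g) * g)"
    by (simp only: sum.distrib distrib_right)
  moreover have "\<forall>g\<in>H \<union> H'. ?c g + ?c' g \<in> poly_ring S"
    using p q by (auto intro: poly_ring_add)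
  ultimately show ?thesis
    using p q unfolding ideal_gen_def
    by (intro CollectI exI[of _ "H \<union> H'"] exI[of _ "\<lambda>g. ?c g + ?c' g"]) auto
qed

lemma ideal_gen_sum: "(\<And>i. i \<in> A \<Longrightarrow> p i \<in> ideal_gen S G) \<Longrightarrow> (\<Sum>i\<in>A. p i) \<in> ideal_gen S G"
  by (induction A rule: infinite_finite_induct) (auto intro: ideal_gen_add ideal_gen_zero)

lemma ideal_gen_mult:
  assumes "r \<in> poly_ring S" "p \<in> ideal_gen S G" shows "r * p \<in> ideal_gen S G"
proof -
  obtain H c where p: "p = (\<Sum>g\<in>H. c g * g)" "finite H" "H \<subseteq> G" "\<forall>g\<in>H. c g \<in> poly_ring S"
    using assms(2) by (auto simp: ideal_gen_def)
  have "r * p = (\<Sum>g\<in>H. (r * c g) * g)" by (simp add: p sum_distrib_left mult.assoc)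
  also have "\<dots> \<in> ideal_gen S G"
    using p assms(1) by (intro ideal_gen_sum ideal_gen_base poly_ring_mult) auto
  finally show ?thesis .
qed

lemma ideal_gen_subset:
  assumes "G \<subseteq> ideal_gen S G'" shows "ideal_gen S G \<subseteq> ideal_gen S G'"
proof
  fix p assume "p \<in> ideal_gen S G"
  then obtain H c where p: "p = (\<Sum>g\<in>H. c g * g)" "H \<subseteq> G" "\<forall>g\<in>H. c g \<in> poly_ring S"
    by (auto simp: ideal_gen_def)
  then show "p \<in> ideal_gen S G'"
    using assms unfolding p(1) by (intro ideal_gen_sum ideal_gen_mult) auto
qed

section \<open>Weights, initial forms and monomial ideals of incompatible pairs\<close>

lemma weight_superset:
  assumes "finite A" "keys a \<subseteq> A"
  shows "weight \<omega> a = (\<Sum>v\<in>A. lookup \<omega> v * real (lookup a v))"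
  unfolding weight_def using assms by (intro sum.mono_neutral_left) (auto simp: in_keys_iff)

lemma weight_add [simp]: "weight \<omega> (a + b) = weight \<omega> a + weight \<omega> b"
  using weight_superset[of "keys a \<union> keys b" a \<omega>]
    weight_superset[of "keys a \<union> keys b" b \<omega>]
    weight_superset[of "keys a \<union> keys b" "a + b" \<omega>] Poly_Mapping.keys_add[of a b]
  by (simp add: lookup_add distrib_left sum.distrib)

lemma weight_single [simp]: "weight \<omega> (single v k) = real k * lookup \<omega> v"
  using weight_superset[of "{v}" "single v k" \<omega>] by simp

lemma lookup_initial_form:
  "lookup (initial_form \<omega> f) M =
    (if M \<in> keys f \<and> (\<forall>m'\<in>keys f. weight \<omega> m' \<le> weight \<omega> M)
     then lookup f M else 0)"
  unfolding initial_form_def lookup_sum lookup_single when_def by (subst sum.delta) auto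

lemma keys_initial_form:
  "keys (initial_form \<omega> f) =
    {M \<in> keys f. \<forall>m'\<in>keys f. weight \<omega> m' \<le> weight \<omega> M}"
  by (auto simp: in_keys_iff lookup_initial_form split: if_splits)

definition standard :: "('v \<Rightarrow> 'v \<Rightarrow> bool) \<Rightarrow> ('v \<Rightarrow>\<^sub>0 nat) \<Rightarrow> bool" where
  "standard inc a \<longleftrightarrow> (\<forall>v\<in>keys a. \<forall>w\<in>keys a. \<not> inc v w)"

abbreviation pair_monomial :: "'v \<Rightarrow> 'v \<Rightarrow> 'v \<Rightarrow>\<^sub>0 nat" where
  "pair_monomial v w \<equiv> single v 1 + single w 1"

lemma Var_times_Var: "Var v * Var w = (single (pair_monomial v w) 1 :: ('v, 'k::comm_ring_1) mpoly)"
  by (simp add: Var_def mult_single)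

text \<open>Irreflexivity makes the two variables distinct, so both can be divided out even if each
  occurs only once.\<close>

lemma nonstandard_factor:
  assumes "\<not> standard inc a" "\<And>v. \<not> inc v v"
  obtains v w b where "inc v w" "a = b + pair_monomial v w"
proof -
  obtain v w where vw: "v \<in> keys a" "w \<in> keys a" "inc v w"
    using assms(1) by (auto simp: standard_def)
  then have "v \<noteq> w" using assms(2) by auto
  define b where "b = a - pair_monomial v w"
  have "a = b + pair_monomial v w"
  proof (rule poly_mapping_eqI)
    fix u
    have "lookup a v \<noteq> 0" "lookup a w \<noteq> 0" using vw by (auto simp: in_keys_iff)
    then show "lookup a u = lookup (b + pair_monomial v w) u"
      using \<open>v \<noteq> w\<close> by (auto simp: b_def lookup_add minus_poly_mapping.rep_eq lookup_single when_def)
  qed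
  with vw(3) show thesis using that by blast
qed

lemma standard_mono: "standard inc a \<Longrightarrow> keys b \<subseteq> keys a \<Longrightarrow> standard inc b"
  by (auto simp: standard_def)

lemma keys_add_nat: "keys (a + b) = keys a \<union> keys (b :: 'v \<Rightarrow>\<^sub>0 nat)"
  by (auto simp: in_keys_iff lookup_add)

text \<open>The generators are monomials, so membership can be tested on one monomial at a
  time.\<close>

lemma pair_ideal_iff:
  fixes p :: "('v, 'k::comm_ring_1) mpoly"
  assumes irrefl: "\<And>v. \<not> inc v v" and S: "\<And>v w. inc v w \<Longrightarrow> v \<in> S \<and> w \<in> S"
  shows "p \<in> ideal_gen S {Var v * Var w | v w. inc v w} \<longleftrightarrow>
    p \<in> poly_ring S \<and> (\<forall>a\<in>keys p. \<not> standard inc a)"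
proof
  assume "p \<in> ideal_gen S {Var v * Var w | v w. inc v w}"
  then obtain H and c :: "('v, 'k) mpoly \<Rightarrow> ('v, 'k) mpoly" where
    p: "p = (\<Sum>g\<in>H. c g * g)" "H \<subseteq> {Var v * Var w | v w. inc v w}" "\<forall>g\<in>H. c g \<in> poly_ring S"
    by (auto simp: ideal_gen_def)
  have g: "g \<in> poly_ring S" if "g \<in> H" for g
    using that p(2) S by (auto intro!: poly_ring_mult poly_ring_Var)
  have "p \<in> poly_ring S" unfolding p(1) using p(3) g by (intro poly_ring_sum poly_ring_mult) auto
  moreover have "\<not> standard inc a" if a: "a \<in> keys p" for a
  proof -
    obtain g where gH: "g \<in> H" "a \<in> keys (c g * g)"
      using a keys_sum[of "\<lambda>g. c g * g" H] unfolding p(1) by blast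
    obtain v w where vw: "inc v w" "g = Var v * Var w" using gH p(2) by auto
    have "keys (c g * g) \<subseteq> {a + b | a b. a \<in> keys (c g) \<and> b \<in> keys g}"
      by (rule keys_mult)
    moreover have "keys g = {pair_monomial v w}" by (simp add: vw Var_times_Var)
    ultimately obtain b where "a = b + pair_monomial v w" using gH(2) by auto
    then have "v \<in> keys a" "w \<in> keys a" by (simp_all add: keys_add_nat)
    with vw(1) show ?thesis by (auto simp: standard_def)
  qed
  ultimately show "p \<in> poly_ring S \<and> (\<forall>a\<in>keys p. \<not> standard inc a)" by blast
next
  assume p: "p \<in> poly_ring S \<and> (\<forall>a\<in>keys p. \<not> standard inc a)"
  have "single a (lookup p a) \<in> ideal_gen S {Var v * Var w | v w. inc v w}"
    if a: "a \<in> keys p" for a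
  proof -
    obtain v w b where vw: "inc v w" "a = b + pair_monomial v w"
      using nonstandard_factor[of inc a] p a irrefl by blast
    have "keys a \<subseteq> S" using p a unfolding poly_ring_def by blast
    then have "keys b \<subseteq> S" unfolding vw(2) by (simp add: keys_add_nat)
    then have "single b (lookup p a) * (Var v * Var w)
        \<in> ideal_gen S {Var v * Var w | v w. inc v w}"
      using vw(1) by (intro ideal_gen_base poly_ring_single) auto
    then show ?thesis by (simp add: Var_times_Var mult_single vw(2))
  qed
  then show "p \<in> ideal_gen S {Var v * Var w | v w. inc v w}"
    by (subst mpoly_sum_terms[of p, symmetric]) (intro ideal_gen_sum)
qed

lemma presentation_simps:
  assumes "field_embedding \<iota>"
  shows "presentation \<iota> (p + q) = presentation \<iota> p + presentation \<iota> q"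
    "presentation \<iota> (p - q) = presentation \<iota> p - presentation \<iota> q"
    "presentation \<iota> (p * q) = presentation \<iota> p * presentation \<iota> q"
    "presentation \<iota> (p ^ k) = presentation \<iota> p ^ k"
    "presentation \<iota> (Var v) = v"
    "presentation \<iota> (\<Sum>i\<in>A. f i) = (\<Sum>i\<in>A. presentation \<iota> (f i))"
  unfolding presentation_def using assms
  by (simp_all add: eval_mpoly_add eval_mpoly_diff eval_mpoly_mult eval_mpoly_power eval_mpoly_Var eval_mpoly_sum)

lemma keys_sumE:
  assumes "c \<in> keys (sum f A)"
  obtains b where "b \<in> A" "c \<in> keys (f b)"
  using subsetD[OF keys_sum assms] by (elim UN_E) (rule that)

lemma in_keys_constant_times:
  fixes q :: "'m::comm_monoid_add \<Rightarrow>\<^sub>0 'k::comm_ring_1"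
  assumes "c \<in> keys (single 0 k * q)"
  shows "c \<in> keys q"
proof -
  obtain a b where "c = a + b" "a \<in> keys (single (0 :: 'm) k)" "b \<in> keys q"
    using subsetD[OF keys_mult assms] by blast
  then show ?thesis by (simp split: if_splits)
qed

lemma presentation_expand:
  assumes "field_embedding \<iota>"
  shows "(\<Sum>b\<in>keys r. presentation \<iota> (single 0 (lookup r b)) *
    presentation \<iota> (single b 1)) = presentation \<iota> r"
proof -
  have "presentation \<iota> r = presentation \<iota> (\<Sum>b\<in>keys r.
      single 0 (lookup r b) * single b 1)"
    by (simp add: mult_single mpoly_sum_terms)
  then show ?thesis by (simp only: presentation_simps[OF assms])
qed

text \<open>\<open>\<delta>\<close> is an auxiliary grading independent of \<open>\<omega>\<close>.
  As every variable has degree at least 1, only finitely many monomials have bounded degree,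
  although \<open>\<omega>\<close> itself may take negative values.\<close>

locale monomial_degeneration =
  fixes \<iota> :: "'k::field \<Rightarrow> 'f::field" and S :: "'f set" and inc :: "'f \<Rightarrow> 'f \<Rightarrow> bool"
    and \<delta> :: "'f \<Rightarrow>\<^sub>0 real"
  assumes emb: "field_embedding \<iota>" and finS: "finite S"
    and inc_S: "inc v w \<Longrightarrow> v \<in> S \<and> w \<in> S" and inc_irrefl: "\<not> inc v v"
    and standard_independent: "p \<in> poly_ring S \<Longrightarrow> \<forall>a\<in>keys p. standard inc a \<Longrightarrow>
      presentation \<iota> p = 0 \<Longrightarrow> p = 0"
    and \<delta>: "v \<in> S \<Longrightarrow> 1 \<le> lookup \<delta> v"
begin

definition kernel :: "('f, 'k) mpoly set" where
  "kernel = {p \<in> poly_ring S. presentation \<iota> p = 0}"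

definition pair_ideal :: "('f, 'k) mpoly set" where
  "pair_ideal = ideal_gen S {Var v * Var w | v w. inc v w}"

definition straightening :: "('f \<Rightarrow>\<^sub>0 real) \<Rightarrow> bool" where
  "straightening \<omega> \<longleftrightarrow> (\<forall>v w. inc v w \<longrightarrow> (\<exists>p\<in>poly_ring S. presentation \<iota> p = v * w \<and>
     (\<forall>a\<in>keys p. weight \<delta> a \<le> weight \<delta> (pair_monomial v w) \<and>
        weight \<omega> a < weight \<omega> (pair_monomial v w))))"

lemma straighteningE:
  assumes "straightening \<omega>" "inc v w"
  obtains p where "p \<in> poly_ring S" "presentation \<iota> p = v * w"
    "\<forall>b\<in>keys p. weight \<delta> b \<le> weight \<delta> (pair_monomial v w) \<and>
       weight \<omega> b < weight \<omega> (pair_monomial v w)"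
proof -
  have "\<exists>p\<in>poly_ring S. presentation \<iota> p = v * w \<and>
     (\<forall>a\<in>keys p. weight \<delta> a \<le> weight \<delta> (pair_monomial v w) \<and>
        weight \<omega> a < weight \<omega> (pair_monomial v w))"
    using assms unfolding straightening_def by simp
  then show thesis by (elim bexE conjE) (rule that)
qed

lemma finite_bounded_degree: "finite {a :: 'f \<Rightarrow>\<^sub>0 nat. keys a \<subseteq> S \<and> weight \<delta> a \<le> D}" (is "finite ?A")
proof -
  have "real (lookup a v) \<le> D" if a: "a \<in> ?A" and v: "v \<in> S" for a v
  proof -
    have "real (lookup a v) \<le> lookup \<delta> v * real (lookup a v)"
      using \<delta>[OF v] by (simp add: mult_le_cancel_right1)
    also have "\<dots> \<le> (\<Sum>v\<in>S. lookup \<delta> v * real (lookup a v))"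
    proof (rule member_le_sum[OF v _ finS])
      fix u assume "u \<in> S - {v}"
      then show "0 \<le> lookup \<delta> u * real (lookup a u)" using \<delta>[of u] by simp
    qed
    also have "\<dots> = weight \<delta> a" using a by (intro weight_superset[symmetric] finS) auto
    finally show ?thesis using a by auto
  qed
  then have "lookup a v \<le> nat \<lceil>D\<rceil>" if "a \<in> ?A" "v \<in> S" for a v
  proof -
    have "real (lookup a v) \<le> real (nat \<lceil>D\<rceil>)"
      using \<open>\<And>v a. a \<in> ?A \<Longrightarrow> v \<in> S \<Longrightarrow> real (lookup a v) \<le> D\<close>[OF that] real_nat_ceiling_ge[of D]
      by (rule order_trans)
    then show ?thesis by simp
  qed
  then have "(\<lambda>a. restrict (lookup a) S) ` ?A \<subseteq> (\<Pi>\<^sub>E v\<in>S. {..nat \<lceil>D\<rceil>})"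
    by (intro image_subsetI restrict_PiE_iff[THEN iffD2] ballI) simp
  moreover have "inj_on (\<lambda>a. restrict (lookup a) S) ?A"
  proof (rule inj_onI)
    fix a b assume a: "a \<in> ?A" and b: "b \<in> ?A"
      and eq: "restrict (lookup a) S = restrict (lookup b) S"
    show "a = b"
    proof (rule poly_mapping_eqI)
      fix v show "lookup a v = lookup b v"
      proof (cases "v \<in> S")
        case True then show ?thesis using fun_cong[OF eq, of v] by simp
      next
        case False
        then have "v \<notin> keys a" "v \<notin> keys b" using a b by auto
        then show ?thesis by (simp add: in_keys_iff)
      qed
    qed
  qed
  ultimately show ?thesis
    using finS by (meson finite_PiE finite_atMost finite_imageD finite_subset)
qed

text \<open>The straightening relations lower the \<open>\<omega>\<close>-weight without raising the \<open>\<delta>\<close>-degree, and there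
  are only finitely many monomials of bounded \<open>\<delta>\<close>-degree; hence rewriting terminates.\<close>

lemma normal_form:
  assumes str: "straightening \<omega>" and a: "keys a \<subseteq> S"
  shows "\<exists>q\<in>poly_ring S. (\<forall>b\<in>keys q. standard inc b) \<and>
    presentation \<iota> q = presentation \<iota> (single a 1) \<and>
    (if standard inc a then q = single a 1
     else \<forall>b\<in>keys q. weight \<delta> b \<le> weight \<delta> a \<and> weight \<omega> b < weight \<omega> a)"
  using a
\<comment> \<open>The measure counts the monomials that rewriting can still reach from
  \<open>a\<close>.\<close>
proof (induction "card {b. keys b \<subseteq> S \<and> weight \<delta> b \<le> weight \<delta> a \<and> weight \<omega> b < weight \<omega> a}"
    arbitrary: a rule: less_induct)
  case less
  show ?case
  proof (cases "standard inc a")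
    case True
    have "single a 1 \<in> poly_ring S" using less.prems by (rule poly_ring_single)
    with True show ?thesis by (intro bexI[of _ "single a 1"]) simp_all
  next
    case False
    obtain v w a' where vw: "inc v w" "a = a' + pair_monomial v w"
      using nonstandard_factor[OF False inc_irrefl] .
    obtain p where p: "p \<in> poly_ring S" "presentation \<iota> p = v * w"
      "\<forall>b\<in>keys p. weight \<delta> b \<le> weight \<delta> (pair_monomial v w) \<and>
         weight \<omega> b < weight \<omega> (pair_monomial v w)"
      by (rule straighteningE[OF str vw(1)])
    define r where "r = single a' 1 * p"
    have r_ring: "r \<in> poly_ring S"
    proof -
      have "keys a' \<subseteq> S" using less.prems by (simp add: vw(2) keys_add_nat)
      then show ?thesis unfolding r_def by (intro poly_ring_mult poly_ring_single p(1))
    qed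
    have r_keys: "weight \<delta> b \<le> weight \<delta> a \<and> weight \<omega> b < weight \<omega> a" if b: "b \<in> keys r" for b
    proof -
      have "b \<in> {x + y | x y. x \<in> keys (single a' (1::'k)) \<and> y \<in> keys p}"
        using subsetD[OF keys_mult] b unfolding r_def by blast
      then obtain k where k: "k \<in> keys p" "b = a' + k" by auto
      have "weight \<delta> k \<le> weight \<delta> (pair_monomial v w)" "weight \<omega> k < weight \<omega> (pair_monomial v w)"
        using p(3) k(1) by blast+
      then show ?thesis unfolding k(2) vw(2) by simp
    qed
    have "\<forall>b\<in>keys r. \<exists>q. q \<in> poly_ring S \<and> (\<forall>c\<in>keys q. standard inc c) \<and>
        presentation \<iota> q = presentation \<iota> (single b 1) \<and>
        (\<forall>c\<in>keys q. weight \<delta> c \<le> weight \<delta> b \<and> weight \<omega> c \<le> weight \<omega> b)"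
    proof
      fix b assume b: "b \<in> keys r"
      have bS: "keys b \<subseteq> S" using b r_ring by (auto simp: poly_ring_def)
      have "card {c. keys c \<subseteq> S \<and> weight \<delta> c \<le> weight \<delta> b \<and> weight \<omega> c < weight \<omega> b}
          < card {c. keys c \<subseteq> S \<and> weight \<delta> c \<le> weight \<delta> a \<and> weight \<omega> c < weight \<omega> a}"
      proof (rule psubset_card_mono)
        show "finite {c. keys c \<subseteq> S \<and> weight \<delta> c \<le> weight \<delta> a \<and> weight \<omega> c < weight \<omega> a}"
          by (rule finite_subset[OF _ finite_bounded_degree[of "weight \<delta> a"]]) auto
        \<comment> \<open>The inclusion is proper because \<open>b\<close> belongs to the set of
          \<open>a\<close>, but not to its own.\<close>
        have "b \<in> {c. keys c \<subseteq> S \<and> weight \<delta> c \<le> weight \<delta> a \<and> weight \<omega> c < weight \<omega> a}"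
          using r_keys[OF b] bS by auto
        then show "{c. keys c \<subseteq> S \<and> weight \<delta> c \<le> weight \<delta> b \<and> weight \<omega> c < weight \<omega> b}
            \<subset> {c. keys c \<subseteq> S \<and> weight \<delta> c \<le> weight \<delta> a \<and> weight \<omega> c < weight \<omega> a}"
          using r_keys[OF b] by force
      qed
      from less.hyps[OF this bS] obtain q where q: "q \<in> poly_ring S" "\<forall>c\<in>keys q. standard inc c"
        "presentation \<iota> q = presentation \<iota> (single b 1)"
        "if standard inc b then q = single b 1
         else \<forall>c\<in>keys q. weight \<delta> c \<le> weight \<delta> b \<and> weight \<omega> c < weight \<omega> b" by blast
      \<comment> \<open>A standard \<open>b\<close> is its own normal form, so only the weak
        inequality holds here; strictness comes from the step from \<open>a\<close> to
        \<open>b\<close>.\<close>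
      then have "\<forall>c\<in>keys q. weight \<delta> c \<le> weight \<delta> b \<and> weight \<omega> c \<le> weight \<omega> b"
        by (auto split: if_splits)
      with q show "\<exists>q. q \<in> poly_ring S \<and> (\<forall>c\<in>keys q. standard inc c) \<and>
        presentation \<iota> q = presentation \<iota> (single b 1) \<and>
        (\<forall>c\<in>keys q. weight \<delta> c \<le> weight \<delta> b \<and> weight \<omega> c \<le> weight \<omega> b)" by blast
    qed
    from bchoice[OF this] obtain Q where Q0: "\<forall>b\<in>keys r. Q b \<in> poly_ring S \<and>
        (\<forall>c\<in>keys (Q b). standard inc c) \<and>
        presentation \<iota> (Q b) = presentation \<iota> (single b 1) \<and>
        (\<forall>c\<in>keys (Q b). weight \<delta> c \<le> weight \<delta> b \<and> weight \<omega> c \<le> weight \<omega> b)" ..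
    have Q: "\<And>b. b \<in> keys r \<Longrightarrow> Q b \<in> poly_ring S"
      "\<And>b c. b \<in> keys r \<Longrightarrow> c \<in> keys (Q b) \<Longrightarrow> standard inc c"
      "\<And>b. b \<in> keys r \<Longrightarrow> presentation \<iota> (Q b) = presentation \<iota> (single b 1)"
      "\<And>b c. b \<in> keys r \<Longrightarrow> c \<in> keys (Q b) \<Longrightarrow>
        weight \<delta> c \<le> weight \<delta> b \<and> weight \<omega> c \<le> weight \<omega> b"
      using Q0 by blast+
    define q where "q = (\<Sum>b\<in>keys r. single 0 (lookup r b) * Q b)"
    have "q \<in> poly_ring S"
      unfolding q_def by (intro poly_ring_sum poly_ring_mult poly_ring_single Q(1)) auto
    moreover have q_keys: "\<exists>b\<in>keys r. c \<in> keys (Q b)" if "c \<in> keys q" for c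
    proof -
      obtain b where "b \<in> keys r"
        "c \<in> keys (single 0 (lookup r b) * Q b)"
        using \<open>c \<in> keys q\<close> unfolding q_def by (rule keys_sumE)
      then show ?thesis using in_keys_constant_times by blast
    qed
    moreover have "presentation \<iota> q = presentation \<iota> (single a 1)"
    proof -
      have "presentation \<iota> q = presentation \<iota> r"
        by (simp add: q_def presentation_simps emb Q(3) presentation_expand del: One_nat_def)
      also have "\<dots> = presentation \<iota> (single a' 1 * (Var v * Var w))"
        by (simp add: r_def presentation_simps emb p(2))
      also have "\<dots> = presentation \<iota> (single a 1)"
        by (simp add: Var_times_Var mult_single vw(2))
      finally show ?thesis .
    qed
    moreover have "\<forall>c\<in>keys q. weight \<delta> c \<le> weight \<delta> a \<and> weight \<omega> c < weight \<omega> a"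
    proof
      fix c assume "c \<in> keys q"
      then obtain b where b: "b \<in> keys r" "c \<in> keys (Q b)" using q_keys by blast
      show "weight \<delta> c \<le> weight \<delta> a \<and> weight \<omega> c < weight \<omega> a"
        using Q(4)[OF b] r_keys[OF b(1)] by linarith
    qed
    ultimately show ?thesis using False Q(2) by (intro bexI[of _ q]) auto
  qed
qed

text \<open>Suppose a standard monomial \<open>a\<close> has maximal weight in \<open>f\<close>.
  Replacing every monomial of \<open>f\<close> by its normal form keeps the coefficient of
  \<open>a\<close>, since the nonstandard ones only produce monomials of smaller weight. But the
  normal form of \<open>f\<close> is 0 by linear independence.\<close>

lemma initial_form_in_pair_ideal:
  assumes str: "straightening \<omega>" and f: "f \<in> kernel"
  shows "initial_form \<omega> f \<in> pair_ideal"
proof -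
  have f_ring: "f \<in> poly_ring S" and f0: "presentation \<iota> f = 0" using f by (auto simp: kernel_def)
  have "\<not> standard inc a" if a: "a \<in> keys (initial_form \<omega> f)" for a
  proof
    assume st: "standard inc a"
    have aK: "a \<in> keys f" and amax: "\<And>b. b \<in> keys f \<Longrightarrow> weight \<omega> b \<le> weight \<omega> a"
      using a by (auto simp: keys_initial_form)
    have "\<forall>b\<in>keys f. \<exists>q. q \<in> poly_ring S \<and> (\<forall>c\<in>keys q. standard inc c) \<and>
      presentation \<iota> q = presentation \<iota> (single b 1) \<and>
      (if standard inc b then q = single b 1
       else \<forall>c\<in>keys q. weight \<delta> c \<le> weight \<delta> b \<and> weight \<omega> c < weight \<omega> b)"
    proof
      fix b assume "b \<in> keys f"
      then have "keys b \<subseteq> S" using f_ring by (auto simp: poly_ring_def)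
      from normal_form[OF str this] show "\<exists>q. q \<in> poly_ring S \<and> (\<forall>c\<in>keys q. standard inc c) \<and>
        presentation \<iota> q = presentation \<iota> (single b 1) \<and>
        (if standard inc b then q = single b 1
         else \<forall>c\<in>keys q. weight \<delta> c \<le> weight \<delta> b \<and> weight \<omega> c < weight \<omega> b)"
        by blast
    qed
    from bchoice[OF this] obtain Q where Q0: "\<forall>b\<in>keys f. Q b \<in> poly_ring S \<and>
        (\<forall>c\<in>keys (Q b). standard inc c) \<and>
        presentation \<iota> (Q b) = presentation \<iota> (single b 1) \<and>
        (if standard inc b then Q b = single b 1
         else \<forall>c\<in>keys (Q b). weight \<delta> c \<le> weight \<delta> b \<and> weight \<omega> c < weight \<omega> b)" ..
    have Q: "\<And>b. b \<in> keys f \<Longrightarrow> Q b \<in> poly_ring S"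
      "\<And>b c. b \<in> keys f \<Longrightarrow> c \<in> keys (Q b) \<Longrightarrow> standard inc c"
      "\<And>b. b \<in> keys f \<Longrightarrow> presentation \<iota> (Q b) = presentation \<iota> (single b 1)"
      "\<And>b. b \<in> keys f \<Longrightarrow> standard inc b \<Longrightarrow> Q b = single b 1"
      "\<And>b c. b \<in> keys f \<Longrightarrow> \<not> standard inc b \<Longrightarrow> c \<in> keys (Q b) \<Longrightarrow>
         weight \<omega> c < weight \<omega> b"
      using Q0 by (metis (full_types))+
    define q where "q = (\<Sum>b\<in>keys f. single 0 (lookup f b) * Q b)"
    have "presentation \<iota> q = presentation \<iota> f"
      by (simp add: q_def presentation_simps emb Q(3) presentation_expand)
    moreover have "q \<in> poly_ring S"
      unfolding q_def by (intro poly_ring_sum poly_ring_mult poly_ring_single Q(1)) auto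
    moreover have "\<forall>c\<in>keys q. standard inc c"
    proof
      fix c assume "c \<in> keys q"
      then obtain b where b: "b \<in> keys f"
        "c \<in> keys (single 0 (lookup f b) * Q b)"
        unfolding q_def by (rule keys_sumE)
      then have "c \<in> keys (Q b)" using in_keys_constant_times by blast
      then show "standard inc c" using Q(2) b(1) by blast
    qed
    ultimately have "q = 0" using standard_independent f0 by simp
    have "lookup (single 0 (lookup f b) * Q b) a =
        (if b = a then lookup f a else 0)" if b: "b \<in> keys f" for b
    proof (cases "standard inc b")
      case True
      then show ?thesis using Q(4)[OF b] by (simp add: mult_single lookup_single when_def)
    next
      case False
      then have "b \<noteq> a" using st by auto
      moreover have "a \<notin> keys (Q b)" using Q(5)[OF b False, of a] amax[OF b] by auto
      then have "a \<notin> keys (single 0 (lookup f b) * Q b)"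
        using in_keys_constant_times by blast
      ultimately show ?thesis by (simp add: in_keys_iff)
    qed
    then have "lookup q a = lookup f a"
      using aK unfolding q_def lookup_sum by simp
    with \<open>q = 0\<close> aK show False by (simp add: in_keys_iff)
  qed
  moreover have "initial_form \<omega> f \<in> poly_ring S"
    using f_ring by (auto simp: poly_ring_def keys_initial_form)
  ultimately show ?thesis
    unfolding pair_ideal_def using inc_S inc_irrefl by (subst pair_ideal_iff) auto
qed

text \<open>For the inclusion of the pair ideal: the kernel element attached to
  \<open>v * w = p\<close> has the product of the two variables as its initial form, all monomials
  of \<open>p\<close> being lighter.\<close>

lemma initial_ideal_eq:
  assumes str: "straightening \<omega>"
  shows "initial_ideal S \<omega> kernel = pair_ideal"
proof
  show "initial_ideal S \<omega> kernel \<subseteq> pair_ideal"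
    unfolding initial_ideal_def pair_ideal_def
    by (rule ideal_gen_subset) (use initial_form_in_pair_ideal[OF str] in \<open>auto simp: pair_ideal_def\<close>)
  show "pair_ideal \<subseteq> initial_ideal S \<omega> kernel"
    unfolding initial_ideal_def pair_ideal_def
  proof (rule ideal_gen_subset, clarify)
    fix v w assume vw: "inc v w"
    obtain p where p: "p \<in> poly_ring S" "presentation \<iota> p = v * w"
      "\<forall>b\<in>keys p. weight \<delta> b \<le> weight \<delta> (pair_monomial v w) \<and>
         weight \<omega> b < weight \<omega> (pair_monomial v w)"
      by (rule straighteningE[OF str vw])
    let ?f = "Var v * Var w - p" and ?m = "pair_monomial v w"
    have "?f \<in> kernel"
      using p vw inc_S[OF vw] by (auto simp: kernel_def presentation_simps emb intro!: poly_ring_diff poly_ring_mult poly_ring_Var)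
    moreover have "initial_form \<omega> ?f = Var v * Var w"
    proof (rule poly_mapping_eqI)
      fix a
      have m: "lookup p ?m = 0" using bspec[OF p(3), of ?m] by (auto simp: in_keys_iff)
      have f: "lookup ?f b = (if b = ?m then 1 else - lookup p b)" for b
        using m by (simp add: Var_times_Var lookup_minus lookup_single when_def)
      have keys: "keys ?f = insert ?m (keys p)"
        by (auto simp: in_keys_iff f split: if_splits)
      show "lookup (initial_form \<omega> ?f) a = lookup (Var v * Var w) a"
      proof (cases "a = ?m")
        case True
        have "\<forall>m'\<in>insert ?m (keys p). weight \<omega> m' \<le> weight \<omega> ?m"
          using p(3) by (auto simp: less_imp_le simp del: weight_add)
        then show ?thesis unfolding lookup_initial_form keys f True by (simp add: Var_times_Var)
      next
        case False
        have "a \<notin> keys (initial_form \<omega> ?f)"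
          unfolding keys_initial_form keys using False p(3) by (auto simp: not_le[symmetric] simp del: weight_add)
        then show ?thesis using False by (simp add: in_keys_iff Var_times_Var lookup_single when_def)
      qed
    qed
    ultimately have "1 * (Var v * Var w) \<in> ideal_gen S (initial_form \<omega> ` kernel)"
      by (intro ideal_gen_base) (auto simp: image_iff intro!: bexI[of _ ?f])
    then show "Var v * Var w \<in> ideal_gen S (initial_form \<omega> ` kernel)" by simp
  qed
qed

text \<open>The initial form of \<open>f\<close> lies in an ideal whose elements contain no standard
  monomials, and \<open>m\<close> is the only possibly nonstandard monomial of \<open>f\<close>. So
  \<open>m\<close> alone attains the maximal weight.\<close>

lemma initial_ideal_eqD:
  assumes eq: "initial_ideal S \<omega> kernel = pair_ideal" and f: "f \<in> kernel"
    and st: "\<And>b. b \<in> keys f \<Longrightarrow> b \<noteq> m \<Longrightarrow> standard inc b"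
    and a: "a \<in> keys f" "standard inc a"
  shows "weight \<omega> a < weight \<omega> m"
proof -
  have "1 * initial_form \<omega> f \<in> initial_ideal S \<omega> kernel"
    unfolding initial_ideal_def using f by (intro ideal_gen_base) auto
  then have ns: "\<not> standard inc b" if "b \<in> keys (initial_form \<omega> f)" for b
    using that eq pair_ideal_iff[of inc S "initial_form \<omega> f"] inc_S inc_irrefl by (auto simp: pair_ideal_def)
  have "finite (weight \<omega> ` keys f)" "weight \<omega> ` keys f \<noteq> {}" using a by auto
  from Max_in[OF this] obtain b where b: "b \<in> keys f" "weight \<omega> b = Max (weight \<omega> ` keys f)"
    by auto
  then have max: "weight \<omega> c \<le> weight \<omega> b" if "c \<in> keys f" for c
    using that by simp
  then have "b \<in> keys (initial_form \<omega> f)" using b by (auto simp: keys_initial_form)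
  with ns st b have "b = m" by blast
  have "weight \<omega> a \<noteq> weight \<omega> m"
  proof
    assume "weight \<omega> a = weight \<omega> m"
    then have "a \<in> keys (initial_form \<omega> f)" using max a \<open>b = m\<close> by (auto simp: keys_initial_form)
    with ns a show False by blast
  qed
  then show ?thesis using max[OF a(1)] \<open>b = m\<close> by simp
qed

end

section \<open>Simplicial cones and their rays\<close>

lemma lookup_scaleR:
  "lookup (r *\<^sub>R (x :: 'a \<Rightarrow>\<^sub>0 real)) v = r * lookup x v"
proof -
  have "finite {i. r *\<^sub>R lookup x i \<noteq> 0}"
    by (rule finite_subset[OF _ finite_keys[of x]]) (auto simp: in_keys_iff)
  then show ?thesis by (simp add: scaleR_poly_mapping_def)
qed

text \<open>The norm of a finitely supported function is the sum of the absolute values of its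
  coordinates, so it dominates each of them.\<close>

lemma bounded_linear_lookup: "bounded_linear (\<lambda>x :: 'a \<Rightarrow>\<^sub>0 real. lookup x v)"
proof (rule bounded_linear_intro[where K = 1])
  fix x :: "'a \<Rightarrow>\<^sub>0 real"
  have "norm (lookup x v) \<le> (\<Sum>n\<in>keys x. norm (lookup x n))"
  proof (cases "v \<in> keys x")
    case True
    then show ?thesis by (intro member_le_sum) auto
  next
    case False
    then show ?thesis by (simp add: in_keys_iff sum_nonneg)
  qed
  then show "norm (lookup x v) \<le> norm x * 1"
    by (simp add: norm_poly_mapping_def dist_poly_mapping_def)
qed (simp_all add: lookup_add lookup_scaleR)

lemma subspace_weight_space: "subspace (weight_space S)"
  unfolding subspace_def weight_space_def
proof (safe)
  fix x y :: "'a \<Rightarrow>\<^sub>0 real" and v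
  assume "keys x \<subseteq> S" "keys y \<subseteq> S" "v \<in> keys (x + y)"
  then show "v \<in> S" using Poly_Mapping.keys_add[of x y] by blast
next
  fix c and x :: "'a \<Rightarrow>\<^sub>0 real" and v
  assume "keys x \<subseteq> S" "v \<in> keys (c *\<^sub>R x)"
  then show "v \<in> S" by (auto simp: in_keys_iff lookup_scaleR)
qed simp

lemma closed_weight_space: "closed (weight_space S)"
proof -
  have "weight_space S = (\<Inter>v\<in>-S. {\<omega>. lookup \<omega> v = 0})"
    by (auto simp: weight_space_def in_keys_iff)
  moreover have "closed {\<omega> :: 'a \<Rightarrow>\<^sub>0 real. lookup \<omega> v = 0}" for v
    by (intro closed_Collect_eq linear_continuous_on bounded_linear_lookup continuous_on_const)
  ultimately show ?thesis by auto
qed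

text \<open>Given one strictly positive point \<open>w0\<close>, every point \<open>w\<close> of the
  closed cone is the limit of the strictly positive points \<open>w + w0 / (n + 1)\<close>.\<close>

lemma closure_strict_cone:
  fixes W :: "'v::real_normed_vector set" and H :: "('v \<Rightarrow> real) set"
  assumes W: "subspace W" "closed W" and H: "\<And>h. h \<in> H \<Longrightarrow> bounded_linear h"
    and w0: "w0 \<in> W" "\<And>h. h \<in> H \<Longrightarrow> 0 < h w0"
  shows "closure {w \<in> W. \<forall>h\<in>H. 0 < h w} = {w \<in> W. \<forall>h\<in>H. 0 \<le> h w}"
proof
  have "{w \<in> W. \<forall>h\<in>H. 0 \<le> h w} = W \<inter> (\<Inter>h\<in>H. {w. 0 \<le> h w})" by auto
  moreover have "closed {w. 0 \<le> h w}" if "h \<in> H" for h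
    using closed_Collect_le[OF continuous_on_const linear_continuous_on[OF H[OF that]]] .
  ultimately have "closed {w \<in> W. \<forall>h\<in>H. 0 \<le> h w}"
    using W(2) by (simp add: closed_Int closed_INT)
  then show "closure {w \<in> W. \<forall>h\<in>H. 0 < h w} \<subseteq> {w \<in> W. \<forall>h\<in>H. 0 \<le> h w}"
    by (intro closure_minimal) (auto intro: less_imp_le)
next
  show "{w \<in> W. \<forall>h\<in>H. 0 \<le> h w} \<subseteq> closure {w \<in> W. \<forall>h\<in>H. 0 < h w}"
  proof
    fix w assume w: "w \<in> {w \<in> W. \<forall>h\<in>H. 0 \<le> h w}"
    define u where "u n = w + inverse (real (Suc n)) *\<^sub>R w0" for n
    have "u n \<in> {w \<in> W. \<forall>h\<in>H. 0 < h w}" for n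
    proof -
      have "u n \<in> W" using w w0(1) W(1) by (auto simp: u_def subspace_add subspace_scale)
      moreover have "0 < h (u n)" if h: "h \<in> H" for h
      proof -
        interpret bounded_linear h by (rule H[OF h])
        have "h (u n) = h w + inverse (real (Suc n)) * h w0" by (simp add: u_def add scaleR)
        then show ?thesis using w w0(2)[OF h] h by (simp add: add_nonneg_pos)
      qed
      ultimately show ?thesis by blast
    qed
    moreover have "u \<longlonglongrightarrow> w + 0 *\<^sub>R w0"
      unfolding u_def by (intro tendsto_intros LIMSEQ_inverse_real_of_nat)
    ultimately show "w \<in> closure {w \<in> W. \<forall>h\<in>H. 0 < h w}"
      unfolding closure_sequential by (intro exI[of _ u]) simp
  qed
qed

section \<open>Rays modulo the lineality space\<close>

lemma quot_class_eq_iff: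
  assumes "subspace L" shows "quot_class L y = quot_class L z \<longleftrightarrow> y - z \<in> L"
proof
  assume "quot_class L y = quot_class L z"
  moreover have "y + 0 \<in> quot_class L y" unfolding quot_class_def using subspace_0[OF assms] by (rule imageI)
  ultimately show "y - z \<in> L" by (auto simp: quot_class_def)
next
  have sub: "quot_class L y \<subseteq> quot_class L z" if "y - z \<in> L" for y z
  proof
    fix a assume "a \<in> quot_class L y"
    then obtain b where "b \<in> L" "a = y + b" by (auto simp: quot_class_def)
    then have "a = z + ((y - z) + b)" "(y - z) + b \<in> L" using that assms by (auto simp: subspace_add)
    then show "a \<in> quot_class L z" unfolding quot_class_def by blast
  qed
  assume "y - z \<in> L"
  moreover then have "z - y \<in> L" using subspace_neg[OF assms] by fastforce
  ultimately show "quot_class L y = quot_class L z" using sub by blast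
qed

lemma generated_ray_eqI:
  assumes "subspace L" "y - z \<in> L" shows "generated_ray L y = generated_ray L z"
proof -
  have "quot_class L (c *\<^sub>R y) = quot_class L (c *\<^sub>R z)" for c
    using quot_class_eq_iff[OF assms(1)] subspace_scale[OF assms, of c] by (simp add: scaleR_diff_right)
  then show ?thesis by (simp add: generated_ray_def)
qed

text \<open>Modulo its lineality space the cone is an orthant with coordinates \<open>H\<close>, and \<open>G\<close> consists of
  positive multiples of the coordinate vectors.\<close>

lemma rays_of_simplicial_cone:
  fixes W :: "'v::real_vector set" and H :: "('v \<Rightarrow> real) set"
  assumes W: "subspace W" and H: "\<And>h. h \<in> H \<Longrightarrow> linear h" and G: "G \<subseteq> W"
    and dual1: "\<And>g. g \<in> G \<Longrightarrow> \<exists>h\<in>H. 0 < h g \<and> (\<forall>h'\<in>H. h' \<noteq> h \<longrightarrow> h' g = 0)"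
    and dual2: "\<And>h. h \<in> H \<Longrightarrow> \<exists>g\<in>G. 0 < h g \<and> (\<forall>h'\<in>H. h' \<noteq> h \<longrightarrow> h' g = 0)"
    and C: "C = {w \<in> W. \<forall>h\<in>H. 0 \<le> h w}"
  shows "generated_ray (lineality_space C) ` G = rays_mod_lineality C"
proof -
  let ?L = "lineality_space C"
  have lin: "h (a + b) = h a + h b" "h (a - b) = h a - h b" "h (c *\<^sub>R a) = c * h a" "h (- a) = - h a" "h 0 = 0"
    if "h \<in> H" for h a b c
    using H[OF that] by (auto simp: linear_add linear_diff linear_scale linear_neg linear_0)
  have L: "?L = {w \<in> W. \<forall>h\<in>H. h w = 0}"
    using W by (force simp: lineality_space_def C lin subspace_neg intro: antisym)
  have subL: "subspace ?L"
    using W unfolding L subspace_def by (auto simp: lin)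
  have sc: "a *\<^sub>R w \<in> W" "a *\<^sub>R w + b *\<^sub>R u \<in> W" "u - w \<in> W" "u + w \<in> W" if "w \<in> W" "u \<in> W" for a b w u
    using that W by (auto simp: subspace_scale subspace_add subspace_diff)
  have "generated_ray ?L g \<in> rays_mod_lineality C" if g: "g \<in> G" for g
  proof -
    obtain h where h: "h \<in> H" "0 < h g" "\<And>h'. h' \<in> H \<Longrightarrow> h' \<noteq> h \<Longrightarrow> h' g = 0"
      using dual1[OF g] by blast
    have gW: "g \<in> W" using g G by auto
    have nn: "0 \<le> h' g" if "h' \<in> H" for h' using h(2) h(3)[OF that] by (cases "h' = h") auto
    have "g \<in> C" using gW nn by (simp add: C)
    moreover have "g \<notin> ?L" using h(1,2) by (auto simp: L intro!: bexI[of _ h])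
    moreover have face: "quot_class ?L y \<in> generated_ray ?L g"
      if y: "y \<in> C" and z: "z \<in> C" and yz: "quot_class ?L (y + z) \<in> generated_ray ?L g" for y z
    proof -
      obtain c where c: "0 \<le> c" "y + z - c *\<^sub>R g \<in> ?L"
        using yz quot_class_eq_iff[OF subL] by (auto simp: generated_ray_def)
      \<comment> \<open>The only coordinate in which \<open>g\<close> is nonzero is
        \<open>h\<close>. In every other one \<open>y\<close> and \<open>z\<close> are nonnegative
        with sum 0, so \<open>y\<close> agrees with a multiple of \<open>g\<close> modulo the
        lineality space.\<close>
      define b where "b = h y / h g"
      have "h' (y - b *\<^sub>R g) = 0" if h': "h' \<in> H" for h'
      proof (cases "h' = h")
        case True then show ?thesis using h(1,2) by (simp add: lin b_def)
      next
        case False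
        then have "h' g = 0" using h(3) h' by blast
        moreover have "h' y + h' z - c * h' g = 0" using c(2) h' by (auto simp: L lin)
        moreover have "0 \<le> h' y" "0 \<le> h' z" using y z h' by (auto simp: C)
        ultimately show ?thesis using h' by (simp add: lin)
      qed
      moreover have "y - b *\<^sub>R g \<in> W" using y gW sc W by (auto simp: C subspace_diff subspace_scale)
      ultimately have "y - b *\<^sub>R g \<in> ?L" by (auto simp: L)
      then have "quot_class ?L y = quot_class ?L (b *\<^sub>R g)" by (simp add: quot_class_eq_iff[OF subL])
      moreover have "0 \<le> b" using y h by (auto simp: b_def C)
      ultimately show ?thesis by (auto simp: generated_ray_def)
    qed
    moreover have "quot_class ?L z \<in> generated_ray ?L g"
      if "y \<in> C" "z \<in> C" "quot_class ?L (y + z) \<in> generated_ray ?L g" for y z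
      using face[of z y] that by (simp add: add.commute)
    ultimately show ?thesis unfolding rays_mod_lineality_def Let_def by blast
  qed
  moreover have "R \<in> generated_ray ?L ` G" if R: "R \<in> rays_mod_lineality C" for R
  proof -
    obtain w where w: "w \<in> C" "w \<notin> ?L" "R = generated_ray ?L w"
      and face: "\<And>y z. y \<in> C \<Longrightarrow> z \<in> C \<Longrightarrow> quot_class ?L (y + z) \<in> R \<Longrightarrow> quot_class ?L y \<in> R"
      using R unfolding rays_mod_lineality_def Let_def by blast
    have wW: "w \<in> W" using w by (simp add: C)
    obtain h where h: "h \<in> H" "h w \<noteq> 0" using w(2) wW by (auto simp: L)
    then have hw: "0 < h w" using w(1) by (force simp: C)
    obtain g where g: "g \<in> G" "0 < h g" "\<And>h'. h' \<in> H \<Longrightarrow> h' \<noteq> h \<Longrightarrow> h' g = 0"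
      using dual2[OF h(1)] by blast
    have gW: "g \<in> W" using g G by auto
    \<comment> \<open>\<open>c *\<^sub>R g\<close> is the part of \<open>w\<close> belonging to one
      of its nonzero coordinates. As \<open>w\<close> spans a ray, this part has to be proportional
      to \<open>w\<close> modulo the lineality space.\<close>
    define c where "c = h w / h g"
    have c: "0 < c" "c * h g = h w" using hw g(2) by (auto simp: c_def)
    have nn: "0 \<le> h' g" if "h' \<in> H" for h' using g(2) g(3)[OF that] by (cases "h' = h") auto
    have "c *\<^sub>R g \<in> C" using c nn gW sc by (auto simp: C lin)
    moreover have "w - c *\<^sub>R g \<in> C"
    proof -
      have "0 \<le> h' (w - c *\<^sub>R g)" if h': "h' \<in> H" for h'
        using c w(1) g(3)[OF h'] h' by (cases "h' = h") (auto simp: lin C)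
      moreover have "w - c *\<^sub>R g \<in> W" using wW gW W by (simp add: subspace_diff subspace_scale)
      ultimately show ?thesis by (simp add: C)
    qed
    moreover have "quot_class ?L (c *\<^sub>R g + (w - c *\<^sub>R g)) \<in> R"
      unfolding w(3) generated_ray_def by (auto intro!: exI[of _ 1])
    ultimately have "quot_class ?L (c *\<^sub>R g) \<in> R" by (rule face)
    then obtain b where b: "0 \<le> b" "c *\<^sub>R g - b *\<^sub>R w \<in> ?L"
      using quot_class_eq_iff[OF subL] by (auto simp: w(3) generated_ray_def)
    have "c * h g - b * h w = 0" using b(2) h(1) by (auto simp: L lin)
    then have "b = 1" using c(2) hw by simp
    with b(2) have eq: "c *\<^sub>R g - w \<in> ?L" by simp
    have "generated_ray ?L g = generated_ray ?L (c *\<^sub>R g)"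
    proof
      show "generated_ray ?L (c *\<^sub>R g) \<subseteq> generated_ray ?L g"
      proof
        fix r assume "r \<in> generated_ray ?L (c *\<^sub>R g)"
        then obtain a where "0 \<le> a" "r = quot_class ?L (a *\<^sub>R c *\<^sub>R g)" by (auto simp: generated_ray_def)
        then show "r \<in> generated_ray ?L g"
          using c(1) unfolding generated_ray_def by (intro CollectI exI[of _ "a * c"]) auto
      qed
      show "generated_ray ?L g \<subseteq> generated_ray ?L (c *\<^sub>R g)"
      proof
        fix r assume "r \<in> generated_ray ?L g"
        then obtain a where "0 \<le> a" "r = quot_class ?L (a *\<^sub>R g)" by (auto simp: generated_ray_def)
        then show "r \<in> generated_ray ?L (c *\<^sub>R g)"
          using c(1) unfolding generated_ray_def by (intro CollectI exI[of _ "a / c"]) auto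
      qed
    qed
    then show ?thesis using generated_ray_eqI[OF subL eq] w(3) g(1) by auto
  qed
  ultimately show ?thesis by blast
qed

section \<open>Segments and triangulations of a polygon\<close>

text \<open>Endpoints are read modulo \<open>N\<close>, so that a cyclically ordered list of
  vertices can be given by increasing numbers \<open>i < j < k < l < i + N\<close>.\<close>

definition seg :: "nat \<Rightarrow> nat \<Rightarrow> nat \<Rightarrow> nat set" where
  "seg N i j = {i mod N, j mod N}"

definition rot :: "nat \<Rightarrow> nat \<Rightarrow> nat set \<Rightarrow> nat set" where
  "rot N s l = (\<lambda>i. (i + s) mod N) ` l"

lemma seg_commute: "seg N i j = seg N j i"
  by (auto simp: seg_def)

lemma seg_mod [simp]: "seg N (i mod N) j = seg N i j" "seg N i (j mod N) = seg N i j"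
  by (simp_all add: seg_def)

lemma seg_add_N [simp]: "seg N (i + N) j = seg N i j" "seg N i (j + N) = seg N i j"
  by (simp_all add: seg_def)

lemma rot_seg: "rot N s (seg N i j) = seg N (i + s) (j + s)"
  by (simp add: rot_def seg_def mod_add_left_eq)

lemma offset_add:
  assumes "t < N" shows "ccw_offset N (a mod N) ((a + t) mod N) = t"
proof -
  define r where "r = a mod N"
  have r: "r < N" using assms by (simp add: r_def)
  have "(a + t) mod N = (r + t) mod N" by (simp add: r_def mod_add_left_eq)
  also have "\<dots> = (if r + t < N then r + t else r + t - N)"
    using r assms by (simp add: mod_if)
  finally show ?thesis using r assms by (auto simp: ccw_offset_def r_def[symmetric])
qed

lemma add_mod_cancel: "s < N \<Longrightarrow> t < N \<Longrightarrow> (a + s) mod N = (a + t) mod N \<Longrightarrow> s = (t::nat)"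
  by (metis offset_add)

lemma offset_sub:
  assumes "0 < t" "t < N" shows "ccw_offset N ((a + t) mod N) (a mod N) = N - t"
  using offset_add[of "N - t" N "a + t"] assms by simp

lemma offset_exists:
  assumes "i < N" "j < N" shows "j = (i + ccw_offset N i j) mod N" "ccw_offset N i j < N"
  using assms by (auto simp: ccw_offset_def mod_simps)

lemma ccw_map:
  assumes "0 < N" "sorted_wrt (<) (0 # ts)" "\<forall>t\<in>set ts. t < N"
  shows "ccw N (map (\<lambda>t. (a + t) mod N) (0 # ts))"
proof -
  have "map (ccw_offset N (a mod N)) (map (\<lambda>t. (a + t) mod N) (0 # ts)) = 0 # ts"
    using assms(1,3) offset_add[of _ N a] offset_add[of 0 N a] by (auto intro: map_idI)
  then show ?thesis using assms by (simp add: ccw_def del: sorted_wrt.simps list.map) auto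
qed

lemma ccw4I: "i < j \<Longrightarrow> j < k \<Longrightarrow> k < l \<Longrightarrow> l < i + N \<Longrightarrow> ccw N [i mod N, j mod N, k mod N, l mod N]"
proof -
  assume *: "i < j" "j < k" "k < l" "l < i + N"
  have "ccw N (map (\<lambda>t. (i + t) mod N) (0 # [j - i, k - i, l - i]))"
    by (rule ccw_map) (use * in auto)
  then show ?thesis using * by simp
qed

lemma ccw5I: "i < j \<Longrightarrow> j < k \<Longrightarrow> k < l \<Longrightarrow> l < m \<Longrightarrow> m < i + N \<Longrightarrow>
    ccw N [i mod N, j mod N, k mod N, l mod N, m mod N]"
proof -
  assume *: "i < j" "j < k" "k < l" "l < m" "m < i + N"
  have "ccw N (map (\<lambda>t. (i + t) mod N) (0 # [j - i, k - i, l - i, m - i]))"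
    by (rule ccw_map) (use * in auto)
  then show ?thesis using * by simp
qed

lemma ccw4E:
  assumes "ccw N [a, b, c, d]"
  obtains j k l where "a < j" "j < k" "k < l" "l < a + N" "a = a mod N" "b = j mod N" "c = k mod N" "d = l mod N"
proof -
  have lt: "a < N" "b < N" "c < N" "d < N" using assms by (auto simp: ccw_def)
  have "ccw_offset N a a < ccw_offset N a b" "ccw_offset N a b < ccw_offset N a c"
    "ccw_offset N a c < ccw_offset N a d" using assms by (auto simp: ccw_def)
  with lt offset_exists[of a N] show thesis
    by (intro that[of "a + ccw_offset N a b" "a + ccw_offset N a c" "a + ccw_offset N a d"]) auto
qed

lemma crossingI: "i < j \<Longrightarrow> j < k \<Longrightarrow> k < l \<Longrightarrow> l < i + N \<Longrightarrow> crossing N (seg N i k) (seg N j l)"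
  using ccw4I[of i j k l N] unfolding crossing_def seg_def by blast

lemma crossingE:
  assumes "crossing N l k"
  obtains a b c d where "a < b" "b < c" "c < d" "d < a + N" "l = seg N a c" "k = seg N b d"
proof -
  obtain a b c d where ccw: "ccw N [a, b, c, d]" "l = {a, c}" "k = {b, d}"
    using assms by (auto simp: crossing_def)
  from ccw(1) obtain j m p where "a < j" "j < m" "m < p" "p < a + N" "a = a mod N"
      "b = j mod N" "c = m mod N" "d = p mod N" by (rule ccw4E)
  then show thesis using ccw by (intro that[of a j m p]) (auto simp: seg_def)
qed

lemma crossing_sym: "crossing N l k \<Longrightarrow> crossing N k l"
proof (erule crossingE)
  fix a b c d assume *: "a < b" "b < c" "c < d" "d < a + N" "l = seg N a c" "k = seg N b d"
  then have "crossing N (seg N b d) (seg N c (a + N))" by (intro crossingI) auto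
  then show "crossing N k l" using * by (simp add: seg_commute)
qed

lemma crossing_rot: "crossing N l k \<Longrightarrow> crossing N (rot N s l) (rot N s k)"
proof (erule crossingE)
  fix a b c d assume *: "a < b" "b < c" "c < d" "d < a + N" "l = seg N a c" "k = seg N b d"
  then show "crossing N (rot N s l) (rot N s k)"
    using crossingI[of "a + s" "b + s" "c + s" "d + s" N] by (simp add: rot_seg)
qed

text \<open>Measuring all vertices from \<open>a\<close> reduces crossing to a comparison of
  numbers; the later noncrossing statements are checked in this form.\<close>

lemma crossing_seg_iff:
  assumes t: "0 < t" "t < N" and pq: "p < N" "q < N"
  shows "crossing N (seg N a (a + t)) (seg N (a + p) (a + q)) \<longleftrightarrow>
    0 < p \<and> p < t \<and> t < q \<or> 0 < q \<and> q < t \<and> t < p"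
proof
  assume "0 < p \<and> p < t \<and> t < q \<or> 0 < q \<and> q < t \<and> t < p"
  then show "crossing N (seg N a (a + t)) (seg N (a + p) (a + q))"
    using crossingI[of a "a + p" "a + t" "a + q" N] crossingI[of a "a + q" "a + t" "a + p" N] pq
    by (auto simp: seg_commute)
next
  assume cr: "crossing N (seg N a (a + t)) (seg N (a + p) (a + q))"
  \<comment> \<open>If the witness of crossing runs through the first segment in the opposite
    direction, it is restarted at the other endpoint and continued past \<open>N\<close>.\<close>
  have "\<exists>b c d e. b < c \<and> c < d \<and> d < e \<and> e < b + N \<and> b mod N = a mod N \<and>
     d mod N = (a + t) mod N \<and> seg N (a + p) (a + q) = seg N c e"
  proof -
    from cr obtain b c d e where *: "b < c" "c < d" "d < e" "e < b + N"
      "seg N a (a + t) = seg N b d" "seg N (a + p) (a + q) = seg N c e" by (rule crossingE)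
    consider "b mod N = a mod N" "d mod N = (a + t) mod N" | "d mod N = a mod N" "b mod N = (a + t) mod N"
      using *(5) unfolding seg_def doubleton_eq_iff by metis
    then show ?thesis
    proof cases
      case 1 then show ?thesis using * by blast
    next
      case 2
      have "seg N (a + p) (a + q) = seg N e (c + N)" using *(6) by (simp add: seg_commute)
      then show ?thesis using *(1-4) 2
        by (intro exI[of _ d] exI[of _ e] exI[of _ "b + N"] exI[of _ "c + N"]) simp
    qed
  qed
  then obtain b c d e where *: "b < c" "c < d" "d < e" "e < b + N" "b mod N = a mod N"
     "d mod N = (a + t) mod N" "seg N (a + p) (a + q) = seg N c e" by blast
  have sh: "z mod N = (a + (z - b)) mod N" if "b \<le> z" for z
  proof -
    have "(a + (z - b)) mod N = (b + (z - b)) mod N"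
      by (rule mod_add_cong) (simp_all add: *(5))
    then show ?thesis using that by simp
  qed
  have lt: "c - b < N" "d - b < N" "e - b < N" and le: "b \<le> c" "b \<le> d" "b \<le> e"
    using *(1-4) by linarith+
  have "d - b = t"
    by (rule add_mod_cancel[OF lt(2) t(2), of a]) (simp only: sh[OF le(2), symmetric] *(6))
  moreover have "p = c - b \<and> q = e - b \<or> p = e - b \<and> q = c - b"
  proof -
    consider "(a + p) mod N = c mod N" "(a + q) mod N = e mod N" | "(a + p) mod N = e mod N" "(a + q) mod N = c mod N"
      using *(7) unfolding seg_def doubleton_eq_iff by metis
    then show ?thesis
    proof cases
      case 1
      have "p = c - b" by (rule add_mod_cancel[OF pq(1) lt(1), of a]) (simp only: sh[OF le(1), symmetric] 1(1))
      moreover have "q = e - b" by (rule add_mod_cancel[OF pq(2) lt(3), of a]) (simp only: sh[OF le(3), symmetric] 1(2))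
      ultimately show ?thesis by blast
    next
      case 2
      have "p = e - b" by (rule add_mod_cancel[OF pq(1) lt(3), of a]) (simp only: sh[OF le(3), symmetric] 2(1))
      moreover have "q = c - b" by (rule add_mod_cancel[OF pq(2) lt(1), of a]) (simp only: sh[OF le(1), symmetric] 2(2))
      ultimately show ?thesis by blast
    qed
  qed
  ultimately show "0 < p \<and> p < t \<and> t < q \<or> 0 < q \<and> q < t \<and> t < p"
    using *(1-4) by linarith
qed

lemma seg_length_add: "0 < t \<Longrightarrow> t < N \<Longrightarrow> seg_length N (a mod N) ((a + t) mod N) = min t (N - t)"
  by (simp add: seg_length_def offset_add offset_sub)

lemma seg_length_same: "i < N \<Longrightarrow> seg_length N i i = 0"
  by (simp add: seg_length_def ccw_offset_def)

lemma diagonalsI: "2 \<le> t \<Longrightarrow> t + 2 \<le> N \<Longrightarrow> seg N a (a + t) \<in> diagonals N"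
  using seg_length_add[of t N a] unfolding diagonals_def seg_def
  by (intro CollectI exI[of _ "a mod N"] exI[of _ "(a + t) mod N"]) auto

lemma diagonalsE:
  assumes "l \<in> diagonals N"
  obtains i j where "i < j" "j < N" "l = seg N i j" "i + 2 \<le> j" "j + 2 \<le> i + N"
proof -
  obtain a b where ab: "l = {a, b}" "a < N" "b < N" "2 \<le> seg_length N a b"
    using assms by (auto simp: diagonals_def)
  define i where "i = min a b" define j where "j = max a b"
  have "a \<noteq> b" using ab seg_length_same by fastforce
  then have ij: "i < j" "j < N" "l = {i, j}" using ab by (auto simp: i_def j_def)
  have "seg_length N i j = seg_length N a b" by (auto simp: i_def j_def seg_length_def min_def max_def)
  then have "2 \<le> min (j - i) (N - (j - i))" using seg_length_add[of "j - i" N i] ij ab(4) by simp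
  then show thesis using ij by (intro that[of i j]) (auto simp: seg_def)
qed

lemma edgesI: "2 < N \<Longrightarrow> seg N a (Suc a) \<in> edges N"
  using seg_length_add[of 1 N a] unfolding edges_def seg_def
  by (intro CollectI exI[of _ "a mod N"] exI[of _ "Suc a mod N"]) auto

lemma edgesE:
  assumes "l \<in> edges N"
  obtains i j where "i < j" "j < N" "l = seg N i j" "j = Suc i \<or> j + 1 = i + N"
proof -
  obtain a b where ab: "l = {a, b}" "a < N" "b < N" "seg_length N a b = 1"
    using assms by (auto simp: edges_def)
  define i where "i = min a b" define j where "j = max a b"
  have "a \<noteq> b" using ab seg_length_same by fastforce
  then have ij: "i < j" "j < N" "l = {i, j}" using ab by (auto simp: i_def j_def)
  have "seg_length N i j = seg_length N a b" by (auto simp: i_def j_def seg_length_def min_def max_def)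
  then have "1 = min (j - i) (N - (j - i))" using seg_length_add[of "j - i" N i] ij ab(4) by simp
  then show thesis using ij by (intro that[of i j]) (auto simp: seg_def min_def split: if_splits)
qed

lemma segments_eq: "2 < N \<Longrightarrow> diagonals N \<union> edges N = {seg N i j | i j. i < j \<and> j < N}"
proof (intro equalityI subsetI)
  fix l assume "2 < N" "l \<in> {seg N i j | i j. i < j \<and> j < N}"
  then obtain i j where l: "i < j" "j < N" "l = seg N i j" by blast
  consider "j = Suc i" | "i = 0" "j = N - 1" | "i + 2 \<le> j" "j + 2 \<le> i + N" using l by linarith
  then show "l \<in> diagonals N \<union> edges N"
  proof cases
    case 1 then show ?thesis using edgesI[of N i] \<open>2 < N\<close> l by simp
  next
    case 2
    then have "l = seg N (N - 1) (Suc (N - 1))" using l by (simp add: seg_def insert_commute)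
    then show ?thesis using edgesI[of N "N - 1"] \<open>2 < N\<close> by simp
  next
    case 3 then show ?thesis using diagonalsI[of "j - i" N i] l by simp
  qed
qed (auto elim!: diagonalsE edgesE)

lemma crossing_diagonals:
  assumes "crossing N l k" shows "l \<in> diagonals N" "k \<in> diagonals N"
proof -
  have *: "l \<in> diagonals N" if "crossing N l k" for l k
    using that
  proof (rule crossingE)
    fix a b c d assume "a < b" "b < c" "c < d" "d < a + N" "l = seg N a c"
    then show ?thesis using diagonalsI[of "c - a" N a] by simp
  qed
  show "l \<in> diagonals N" "k \<in> diagonals N" using *[OF assms] *[OF crossing_sym[OF assms]] .
qed

lemma not_crossing_self: "\<not> crossing N l l"
proof
  assume "crossing N l l"
  then obtain a b c d where *: "a < b" "b < c" "c < d" "d < a + N" "l = seg N a c" "l = seg N b d"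
    by (rule crossingE)
  then have "b mod N = a mod N \<or> b mod N = c mod N" by (auto simp: seg_def doubleton_eq_iff)
  then have "(a + (b - a)) mod N = (a + 0) mod N \<or> (a + (b - a)) mod N = (a + (c - a)) mod N"
    using * by simp
  moreover have lt: "b - a < N" "c - a < N" "0 < N" using *(1-4) by linarith+
  ultimately show False
  proof (elim disjE)
    assume "(a + (b - a)) mod N = (a + 0) mod N"
    then have "b - a = 0" by (rule add_mod_cancel[OF lt(1,3)])
    then show False using * by linarith
  next
    assume "(a + (b - a)) mod N = (a + (c - a)) mod N"
    then have "b - a = c - a" by (rule add_mod_cancel[OF lt(1,2)])
    then show False using * by linarith
  qed
qed

lemma finite_diagonals: "finite (diagonals N)"
  by (rule finite_subset[of _ "Pow {..<N}"]) (auto simp: diagonals_def)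

text \<open>A symmetry \<open>\<sigma>\<close> of the polygon none of whose orbits of diagonals is crossing: the identity,
  or the antipodal map.\<close>

lemma extend_to_symmetric_triangulation:
  assumes \<sigma>: "\<And>l. l \<in> diagonals N \<Longrightarrow> \<sigma> l \<in> diagonals N \<and> \<sigma> (\<sigma> l) = l \<and> \<not> crossing N l (\<sigma> l)"
    and cr: "\<And>l k. crossing N l k \<Longrightarrow> crossing N (\<sigma> l) (\<sigma> k)"
    and K: "K \<subseteq> diagonals N" "\<sigma> ` K = K" "\<forall>l\<in>K. \<forall>k\<in>K. \<not> crossing N l k"
  shows "\<exists>T\<in>triangulations N. \<sigma> ` T = T \<and> K \<subseteq> T"
proof -
  let ?F = "{T. T \<subseteq> diagonals N \<and> \<sigma> ` T = T \<and> (\<forall>l\<in>T. \<forall>k\<in>T. \<not> crossing N l k)}"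
  have "finite ?F"
    by (rule finite_subset[of _ "Pow (diagonals N)"]) (auto simp: finite_diagonals)
  moreover have "K \<in> ?F" using K by blast
  ultimately have "\<exists>T\<in>?F. K \<subseteq> T \<and> (\<forall>U\<in>?F. T \<subseteq> U \<longrightarrow> T = U)"
    by (rule finite_has_maximal2)
  then obtain T where T: "T \<in> ?F" "K \<subseteq> T" "\<forall>U\<in>?F. T \<subseteq> U \<longrightarrow> T = U" by (elim bexE conjE) (rule that)
  \<comment> \<open>\<open>T\<close> is chosen maximal among invariant collections only. It is
    maximal among all noncrossing ones, because a diagonal crossing nothing in \<open>T\<close>
    could be added together with its image, which it does not cross.\<close>
  have "\<exists>k\<in>T. crossing N l k" if l: "l \<in> diagonals N - T" for l
  proof (rule ccontr)
    assume no: "\<not> (\<exists>k\<in>T. crossing N l k)"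
    have l\<sigma>: "\<sigma> l \<in> diagonals N" "\<sigma> (\<sigma> l) = l" "\<not> crossing N l (\<sigma> l)" using \<sigma> l by auto
    have no2: "\<not> crossing N (\<sigma> l) k" if k: "k \<in> T" for k
    proof
      assume "crossing N (\<sigma> l) k"
      then have "crossing N l (\<sigma> k)" using cr[of "\<sigma> l" k] l\<sigma> by simp
      moreover have "\<sigma> k \<in> T" using k T(1) by blast
      ultimately show False using no by blast
    qed
    have "\<not> crossing N a b" if "a \<in> T \<union> {l, \<sigma> l}" "b \<in> T \<union> {l, \<sigma> l}" for a b
      using that
    proof (elim UnE insertE emptyE)
      assume "a \<in> T" "b \<in> T"
      then show ?thesis using T(1) by blast
    qed (use no no2 l\<sigma> not_crossing_self[of N] crossing_sym[of N] in blast)+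
    moreover have "\<sigma> ` (T \<union> {l, \<sigma> l}) = T \<union> {l, \<sigma> l}"
      using T(1) l\<sigma>(2) by (simp add: image_Un insert_commute)
    moreover have "T \<union> {l, \<sigma> l} \<subseteq> diagonals N" using T(1) l l\<sigma>(1) by blast
    ultimately have "T \<union> {l, \<sigma> l} \<in> ?F" by (intro CollectI conjI ballI)
    from bspec[OF T(3) this] have "T = T \<union> {l, \<sigma> l}" by blast
    then show False using l by blast
  qed
  then show ?thesis using T(1,2) by (auto simp: triangulations_def)
qed

lemma rot_N: "l \<subseteq> {..<N} \<Longrightarrow> rot N N l = l"
  by (force simp: rot_def)

lemma diagonals_subset: "l \<in> diagonals N \<Longrightarrow> l \<subseteq> {..<N}"
  by (auto simp: diagonals_def)

lemma rot_diagonal: "l \<in> diagonals N \<Longrightarrow> rot N s l \<in> diagonals N"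
proof (erule diagonalsE)
  fix i j assume "i < j" "j < N" "l = seg N i j" "i + 2 \<le> j" "j + 2 \<le> i + N"
  then show "rot N s l \<in> diagonals N"
    using diagonalsI[of "j - i" N "i + s"] by (simp add: rot_seg add_ac)
qed

lemma rot_involution:
  assumes "l \<in> diagonals (2 * h)" shows "rot (2 * h) h (rot (2 * h) h l) = l"
  using assms
proof (rule diagonalsE)
  fix i j assume "l = seg (2 * h) i j"
  then show ?thesis using seg_add_N[of "2 * h" i "j + 2 * h"] seg_add_N(2)[of "2 * h" i j]
    by (simp add: rot_seg add.assoc flip: mult_2)
qed

text \<open>Measured from one endpoint, the segment ends at \<open>t\<close> and its antipode joins
  \<open>h\<close> to \<open>t + h\<close>. Both ends of the antipode lie beyond \<open>t\<close> if
  \<open>t < h\<close>, and neither does otherwise.\<close>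

lemma not_crossing_antipodal:
  assumes "l \<in> diagonals (2 * h)" shows "\<not> crossing (2 * h) l (rot (2 * h) h l)"
  using assms
proof (rule diagonalsE)
  fix i j assume *: "i < j" "j < 2 * h" "l = seg (2 * h) i j"
  define t where "t = j - i"
  have t: "0 < t" "t < 2 * h" "j = i + t" using * by (auto simp: t_def)
  have l: "l = seg (2 * h) i (i + t)" "rot (2 * h) h l = seg (2 * h) (i + h) (i + (t + h))"
    using * t by (simp_all add: rot_seg add_ac)
  show ?thesis
  proof (cases "t < h")
    case True
    then show ?thesis
      unfolding l(2) unfolding l(1) using crossing_seg_iff[of t "2 * h" h "t + h" i] t(1,2) by auto
  next
    case False
    have "i + (t + h) = i + (t - h) + 2 * h" using False by simp
    then have "rot (2 * h) h l = seg (2 * h) (i + h) (i + (t - h))"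
      unfolding l(2) by (simp only: seg_add_N)
    then show ?thesis unfolding l(1) using crossing_seg_iff[of t "2 * h" h "t - h" i] t False by auto
  qed
qed

text \<open>Maximality: a diagonal \<open>[i, j]\<close> with \<open>0 < i < j\<close> is crossed by
  the spoke from 0 to \<open>i + 1\<close>.\<close>

lemma fan_triangulation:
  assumes "4 \<le> N"
  shows "(\<lambda>j. seg N 0 j) ` {2..N - 2} \<in> triangulations N" (is "?T \<in> _")
proof -
  have "?T \<subseteq> diagonals N"
    using diagonalsI[of _ N 0] by auto
  moreover have "\<not> crossing N l k" if "l \<in> ?T" "k \<in> ?T" for l k
    using that assms crossing_seg_iff[of _ N 0 _ 0] by fastforce
  moreover have "\<exists>k\<in>?T. crossing N l k" if l: "l \<in> diagonals N - ?T" for l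
  proof -
    obtain i j where *: "i < j" "j < N" "l = seg N i j" "i + 2 \<le> j" "j + 2 \<le> i + N"
      using l by (auto elim!: diagonalsE)
    then have "i \<noteq> 0" using l by (auto simp: image_iff)
    then have "crossing N (seg N 0 (Suc i)) l" using crossingI[of 0 i "Suc i" j N] * by simp
    moreover have "seg N 0 (Suc i) \<in> ?T" using * \<open>i \<noteq> 0\<close> by auto
    ultimately show ?thesis using crossing_sym by blast
  qed
  ultimately show ?thesis by (auto simp: triangulations_def)
qed

text \<open>The fans at 0 and at its antipode \<open>h\<close> meet in the diameter joining these
  vertices. Modulo the antipodal map only the spokes \<open>[0, 2], ..., [0, h]\<close> remain; they
  form the cluster on which the Laurent expansions in types B and C are based.\<close>

lemma symmetric_fan_triangulation:
  assumes "2 \<le> h"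
  defines "N \<equiv> 2 * h"
  shows "(\<lambda>j. seg N 0 j) ` {2..h} \<union> (\<lambda>j. seg N h (j + h)) ` {2..h} \<in> symmetric_triangulations N"
    (is "?T \<in> _")
proof -
  have N: "4 \<le> N" "h < N" "N = 2 * h" using assms by (auto simp: N_def)
  have "?T \<subseteq> diagonals N"
    using diagonalsI[of _ N 0] diagonalsI[of _ N h] assms by (auto simp: add.commute)
  moreover have "\<not> crossing N l k" if lk: "l \<in> ?T" "k \<in> ?T" for l k
  proof -
    have 1: "\<not> crossing N (seg N 0 i) (seg N 0 j)" if "i \<in> {2..h}" "j \<in> {2..h}" for i j
      using that crossing_seg_iff[of i N 0 j 0] N by auto
    have 2: "\<not> crossing N (seg N h (i + h)) (seg N h (j + h))" if "i \<in> {2..h}" "j \<in> {2..h}" for i j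
      using that crossing_seg_iff[of i N 0 j h] N by (auto simp: add.commute)
    have 3: "\<not> crossing N (seg N 0 i) (seg N h (j + h))" if "i \<in> {2..h}" "j \<in> {2..h}" for i j
    proof (cases "j = h")
      case True
      then have "seg N h (j + h) = seg N h 0" using N by (simp add: seg_def flip: mult_2)
      then show ?thesis using that crossing_seg_iff[of i N h 0 0] N by auto
    next
      case False
      then show ?thesis using that crossing_seg_iff[of i N h "j + h" 0] N by auto
    qed
    show ?thesis using lk 1 2 3 crossing_sym[of N] by blast
  qed
  moreover have "\<exists>k\<in>?T. crossing N l k" if l: "l \<in> diagonals N - ?T" for l
  proof -
    obtain i j where *: "i < j" "j < N" "l = seg N i j" "i + 2 \<le> j" "j + 2 \<le> i + N"
      using l by (auto elim!: diagonalsE)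
    have T1: "seg N 0 t \<in> ?T" if "2 \<le> t" "t \<le> h" for t using that by auto
    have T2: "seg N h t \<in> ?T" if "h + 2 \<le> t" "t \<le> N" for t
      using that N by (intro UnI2 image_eqI[of _ _ "t - h"]) auto
    \<comment> \<open>In the first four cases the diameter or a spoke next to an endpoint of
      \<open>l\<close> crosses \<open>l\<close>; in the last two \<open>l\<close> is a spoke
      itself.\<close>
    consider "0 < i" "j \<le> h" | "0 < i" "i < h" "h < j" | "i = 0" "h < j" | "h < i"
      | "i = 0" "j \<le> h" | "i = h" "0 < i" using assms by linarith
    then have "\<exists>k\<in>?T. crossing N k l"
    proof cases
      case 1
      then show ?thesis using crossingI[of 0 i "Suc i" j N] * T1[of "Suc i"] by auto
    next
      case 2
      then show ?thesis using crossingI[of 0 i h j N] * T1[of h] assms by auto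
    next
      case 3
      then have "crossing N (seg N h (Suc j)) (seg N j N)"
        using crossingI[of h j "Suc j" N N] * N by auto
      moreover have "seg N j N = l" using 3 * by (simp add: seg_def insert_commute)
      ultimately show ?thesis using T2[of "Suc j"] 3 * by auto
    next
      case 4
      then show ?thesis using crossingI[of h i "Suc i" j N] * T2[of "Suc i"] N by auto
    next
      case 5
      then show ?thesis using l * T1[of j] by auto
    next
      case 6
      then show ?thesis using l * T2[of j] by auto
    qed
    then show ?thesis using crossing_sym by blast
  qed
  ultimately have "?T \<in> triangulations N" by (auto simp: triangulations_def)
  moreover have "(\<lambda>l. antipode N ` l) ` ?T = ?T"
  proof -
    have ant: "antipode N ` seg N i j = seg N (i + h) (j + h)" for i j
      using rot_seg[of N h i j] by (simp add: rot_def antipode_def N_def)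
    have "seg N (h + h) (j + h + h) = seg N 0 j" for j
      by (simp add: seg_def N_def add.assoc flip: mult_2)
    then show ?thesis by (auto simp: image_Un image_image ant)
  qed
  ultimately show ?thesis by (simp add: symmetric_triangulations_def)
qed

section \<open>The cone of a polygon\<close>

text \<open>\<open>P\<close> is the order of the rotation that identifies segments with the same variable: \<open>P = N\<close> in
  type A, \<open>N = 2 * P\<close> in types B and C. The \<open>e\<close>-th power of the variable of a diameter is the
  element that satisfies the Ptolemy-like relations, so \<open>e = 2\<close> in type B and \<open>e = 1\<close> otherwise.\<close>

locale polygon_frame =
  fixes N P e :: nat and x :: "nat set \<Rightarrow> 'f::field"
  assumes N: "4 \<le> N" and P: "P = N \<or> N = 2 * P" and e: "0 < e"
    and x_eq: "a mod N \<noteq> b mod N \<Longrightarrow> c mod N \<noteq> d mod N \<Longrightarrow>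
      x (seg N a b) = x (seg N c d) \<longleftrightarrow> seg N c d = seg N a b \<or> seg N c d = seg N (a + P) (b + P)"
begin

definition X :: "nat \<Rightarrow> nat \<Rightarrow> 'f" where
  "X a b = x (seg N a b)"

definition vars :: "'f set" where
  "vars = {X i j | i j. i < j \<and> j < N}"

text \<open>For \<open>P = N\<close> the condition says that the endpoints agree, so no genuine
  segment receives the exponent \<open>e\<close>.\<close>

definition mult :: "nat \<Rightarrow> nat \<Rightarrow> nat" where
  "mult a b = (if (a + P) mod N = b mod N then e else 1)"

definition W :: "('f \<Rightarrow>\<^sub>0 real) \<Rightarrow> nat \<Rightarrow> nat \<Rightarrow> real" where
  "W \<omega> a b = real (mult a b) * lookup \<omega> (X a b)"

text \<open>A mixed second difference of \<open>W\<close>. It compares the crossing pair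
  \<open>[a, b]\<close>, \<open>[a + 1, b + 1]\<close> with one pair of opposite sides; the
  inequality for the other pair is a consequence of all walls, see
  \<open>four_point2\<close>.\<close>

definition wall :: "nat \<Rightarrow> nat \<Rightarrow> ('f \<Rightarrow>\<^sub>0 real) \<Rightarrow> real" where
  "wall a b \<omega> = W \<omega> a b + W \<omega> (Suc a) (Suc b) - W \<omega> a (Suc b) - W \<omega> (Suc a) b"

text \<open>By the symmetry of \<open>wall\<close>, gaps up to half of the polygon suffice.\<close>

definition walls :: "(('f \<Rightarrow>\<^sub>0 real) \<Rightarrow> real) set" where
  "walls = {wall a (a + g) | a g. 2 \<le> g \<and> g \<le> N div 2}"

lemma P2: "(a + P + P) mod N = a mod N"
  using P by (auto simp: add.assoc simp flip: mult_2)

lemma X_commute: "X a b = X b a"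
  by (simp add: X_def seg_commute)

lemma X_cong: "a mod N = a' mod N \<Longrightarrow> b mod N = b' mod N \<Longrightarrow> X a b = X a' b'"
  by (simp add: X_def seg_def)

lemma X_shift: "a mod N \<noteq> b mod N \<Longrightarrow> X (a + P) (b + P) = X a b"
proof -
  assume ab: "a mod N \<noteq> b mod N"
  have "(a + P) mod N \<noteq> (b + P) mod N"
  proof
    assume "(a + P) mod N = (b + P) mod N"
    then have "(a + P + P) mod N = (b + P + P) mod N" by (metis mod_add_left_eq)
    with ab show False by (simp add: P2)
  qed
  with ab show ?thesis using x_eq[of a b "a + P" "b + P"] by (simp add: X_def)
qed

lemma mult_cong: "a mod N = a' mod N \<Longrightarrow> b mod N = b' mod N \<Longrightarrow> mult a b = mult a' b'"
  unfolding mult_def by (metis mod_add_left_eq)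

lemma mult_commute: "mult a b = mult b a"
proof -
  have "(a + P) mod N = b mod N \<Longrightarrow> (b + P) mod N = a mod N" for a b
    by (metis P2 mod_add_left_eq)
  then show ?thesis unfolding mult_def by metis
qed

lemma mult_shift: "mult (a + P) (b + P) = mult a b"
proof -
  have "(a + P + P) mod N = (b + P) mod N \<longleftrightarrow> (a + P) mod N = b mod N"
    by (metis P2 mod_add_left_eq)
  then show ?thesis by (simp add: mult_def)
qed

lemma mult_pos: "0 < mult a b"
  using e by (simp add: mult_def)

lemma W_commute: "W \<omega> a b = W \<omega> b a"
  by (simp add: W_def X_commute[of a b] mult_commute[of a b])

lemma W_cong: "a mod N = a' mod N \<Longrightarrow> b mod N = b' mod N \<Longrightarrow> W \<omega> a b = W \<omega> a' b'"
  unfolding W_def using X_cong[of a a' b b'] mult_cong[of a a' b b'] by simp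

lemma W_add_N: "W \<omega> (a + N) b = W \<omega> a b" "W \<omega> a (b + N) = W \<omega> a b"
  by (auto intro: W_cong)

lemma W_shift: "a mod N \<noteq> b mod N \<Longrightarrow> W \<omega> (a + P) (b + P) = W \<omega> a b"
  by (simp add: W_def X_shift mult_shift)

lemma wall_commute: "wall a b = wall b a"
  by (rule ext) (simp add: wall_def W_commute[of _ b a] W_commute[of _ "Suc b"] W_commute[of _ b])

lemma wall_cong: "a mod N = a' mod N \<Longrightarrow> b mod N = b' mod N \<Longrightarrow> wall a b = wall a' b'"
proof (rule ext)
  fix \<omega> assume ab: "a mod N = a' mod N" "b mod N = b' mod N"
  then have "Suc a mod N = Suc a' mod N" "Suc b mod N = Suc b' mod N" by (metis mod_Suc_eq)+
  with ab show "wall a b \<omega> = wall a' b' \<omega>"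
    unfolding wall_def
    by (simp only: W_cong[of a a' b b'] W_cong[of "Suc a" "Suc a'" "Suc b" "Suc b'"]
      W_cong[of a a' "Suc b" "Suc b'"] W_cong[of "Suc a" "Suc a'" b b'])
qed

lemma add_mod_ne: "0 < t \<Longrightarrow> t < N \<Longrightarrow> a mod N \<noteq> (a + t) mod N"
  using add_mod_cancel[of 0 N t a] by auto

lemma wall_shift:
  assumes "2 \<le> g" "g + 2 \<le> N" shows "wall (a + P) (a + g + P) = wall a (a + g)"
proof (rule ext)
  fix \<omega>
  have "W \<omega> (a + P) (a + g + P) = W \<omega> a (a + g)"
    using add_mod_ne[of g a] assms by (intro W_shift) auto
  moreover have "W \<omega> (Suc a + P) (Suc (a + g) + P) = W \<omega> (Suc a) (Suc (a + g))"
    using add_mod_ne[of g "Suc a"] assms by (intro W_shift) auto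
  moreover have "W \<omega> (a + P) (Suc (a + g) + P) = W \<omega> a (Suc (a + g))"
    using add_mod_ne[of "Suc g" a] assms by (intro W_shift) auto
  moreover have "W \<omega> (Suc a + P) (a + g + P) = W \<omega> (Suc a) (a + g)"
    using add_mod_ne[of "g - 1" "Suc a"] assms by (intro W_shift) auto
  ultimately show "wall (a + P) (a + g + P) \<omega> = wall a (a + g) \<omega>"
    by (simp add: wall_def)
qed

lemma wall_in_walls:
  assumes "2 \<le> g" "g + 2 \<le> N" shows "wall a (a + g) \<in> walls"
proof (cases "g \<le> N div 2")
  case True then show ?thesis using assms by (auto simp: walls_def)
next
  case False
  have "wall a (a + g) = wall (a + g) (a + g + (N - g))"
    using assms by (subst wall_commute) (auto intro!: wall_cong)
  moreover have "2 \<le> N - g" "N - g \<le> N div 2" using False assms by auto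
  ultimately show ?thesis unfolding walls_def by blast
qed

lemma finite_vars: "finite vars"
proof -
  have "vars \<subseteq> (\<lambda>(i, j). X i j) ` ({..<N} \<times> {..<N})" by (auto simp: vars_def)
  then show ?thesis by (rule finite_subset) auto
qed

lemma X_vars: "a mod N \<noteq> b mod N \<Longrightarrow> X a b \<in> vars"
proof -
  assume ab: "a mod N \<noteq> b mod N"
  have lt: "a mod N < N" "b mod N < N" using N by auto
  have "X a b = X (a mod N) (b mod N)" by (simp add: X_def)
  with ab lt X_commute[of "a mod N" "b mod N"] show ?thesis
    unfolding vars_def by (cases "a mod N < b mod N") fastforce+
qed

section \<open>The Ptolemy inequalities as sums of walls\<close>

definition strict :: "('f \<Rightarrow>\<^sub>0 real) \<Rightarrow> bool" where
  "strict \<omega> \<longleftrightarrow> (\<forall>h\<in>walls. 0 < h \<omega>)"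

text \<open>The sum of \<open>wall a b\<close> over \<open>i \<le> a < j\<close> and
  \<open>k \<le> b < l\<close> telescopes to this inequality: \<open>row\<close> sums over
  \<open>b\<close>, the final induction over \<open>a\<close>.\<close>

lemma four_point1:
  assumes st: "strict \<omega>" and ord: "i < j" "j < k" "k < l" "l < i + N"
  shows "W \<omega> i l + W \<omega> j k < W \<omega> i k + W \<omega> j l"
proof -
  have wall: "W \<omega> i (Suc j) + W \<omega> (Suc i) j < W \<omega> i j + W \<omega> (Suc i) (Suc j)" if "i + 2 \<le> j" "j + 2 \<le> i + N" for i j
  proof -
    have "wall i j \<in> walls" using wall_in_walls[of "j - i" i] that by simp
    then have "0 < wall i j \<omega>" using st by (simp add: strict_def)
    then show ?thesis by (simp add: wall_def)
  qed
  have row: "W \<omega> i l + W \<omega> (Suc i) k < W \<omega> i k + W \<omega> (Suc i) l" if "Suc i < k" "Suc k \<le> l" "l < i + N" for i k l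
    using that(2,3)
  proof (induction l rule: dec_induct)
    case base then show ?case using wall[of i k] that(1) by simp
  next
    case (step l) then show ?case using wall[of i l] that(1) by simp
  qed
  have "Suc i \<le> j" using ord by simp
  then show ?thesis using ord(2)
  proof (induction j rule: dec_induct)
    case base then show ?case using row[of i k l] ord by simp
  next
    case (step j) then show ?case using row[of j k l] ord by simp
  qed
qed

text \<open>The other pair of opposite sides: the first vertex is moved to the end of the cyclic
  order as \<open>i + N\<close>.\<close>

lemma four_point2:
  assumes "strict \<omega>" "i < j" "j < k" "k < l" "l < i + N"
  shows "W \<omega> i j + W \<omega> k l < W \<omega> i k + W \<omega> j l"
  using four_point1[OF assms(1), of j k l "i + N"] assms
  by (simp add: W_add_N W_commute[of _ j i] W_commute[of _ k i])

text \<open>The polygon vector of \<open>[a + 1, a + g]\<close> is dual to the wall of the boundary edges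
  \<open>[a, a + 1]\<close> and \<open>[a + g, a + g + 1]\<close> of its minor arc.\<close>

definition on_arc :: "nat \<Rightarrow> nat \<Rightarrow> nat \<Rightarrow> real" where
  "on_arc a g c = of_bool (\<exists>t. 1 \<le> t \<and> t \<le> g \<and> c mod N = (a + t) mod N)"

definition arc_vector :: "nat \<Rightarrow> nat \<Rightarrow> 'f \<Rightarrow>\<^sub>0 real" where
  "arc_vector a g = polygon_vector N x (Suc a mod N) ((a + g) mod N)"

lemma on_arc_offset: "s < N \<Longrightarrow> g < N \<Longrightarrow> on_arc a g (a + s) = of_bool (1 \<le> s \<and> s \<le> g)"
proof -
  assume sg: "s < N" "g < N"
  have "(a + s) mod N = (a + t) mod N \<longleftrightarrow> s = t" if "t \<le> g" for t
    using add_mod_cancel[of s N t a] sg that by auto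
  then show ?thesis unfolding on_arc_def by (simp cong: conj_cong)
qed

lemma minor_arc_eq:
  assumes g: "2 \<le> g" "g \<le> N div 2"
  shows "minor_arc N (Suc a mod N) ((a + g) mod N) = {c. c < N \<and> on_arc a g c = 1}"
proof -
  have off: "ccw_offset N (Suc a mod N) ((a + g) mod N) = g - 1"
    using offset_add[of "g - 1" N "Suc a"] g by simp
  have off': "ccw_offset N ((a + g) mod N) (Suc a mod N) = N - (g - 1)"
    using offset_sub[of "g - 1" N "Suc a"] g by simp
  have "ccw_offset N (Suc a mod N) k \<le> g - 1 \<longleftrightarrow> on_arc a g k = 1" if k: "k < N" for k
  proof -
    let ?o = "ccw_offset N (Suc a mod N) k"
    have o: "k = ((a + 1) mod N + ?o) mod N" "?o < N" using offset_exists[of "Suc a mod N" N k] k by auto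
    then have k': "k = (a + (?o + 1)) mod N" by (simp add: mod_add_left_eq)
    show ?thesis
    proof
      assume "?o \<le> g - 1"
      then show "on_arc a g k = 1" using k' k g by (auto simp: on_arc_def intro!: exI[of _ "?o + 1"])
    next
      assume "on_arc a g k = 1"
      then obtain t where t: "1 \<le> t" "t \<le> g" "k mod N = (a + t) mod N" by (auto simp: on_arc_def split: if_splits)
      then have "(Suc a + (t - 1)) mod N = (Suc a + ?o) mod N" using k' k by simp
      then have "t - 1 = ?o" by (rule add_mod_cancel[rotated 2]) (use t g N o in auto)
      then show "?o \<le> g - 1" using t by simp
    qed
  qed
  then show ?thesis using g by (auto simp: minor_arc_def off off')
qed

text \<open>At a variable the polygon vector counts, with a minus sign, the segments of this
  variable that lie on the arc: one candidate in type A, an antipodal pair in types B and C. Each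
  indicator is a product over the two endpoints, which is what makes \<open>wall\<close>
  factor.\<close>

lemma lookup_arc_vector:
  assumes g: "2 \<le> g" "g \<le> N div 2" and cd: "c mod N \<noteq> d mod N"
  shows "W (arc_vector a g) c d = - (on_arc a g c * on_arc a g d +
    (if P = N then 0 else on_arc a g (c + P) * on_arc a g (d + P)))"
proof -
  let ?Seg = "segments_on_minor_arc N (Suc a mod N) ((a + g) mod N)"
  have on01: "on_arc a g c = 0 \<or> on_arc a g c = 1" for c by (auto simp: on_arc_def)
  have on_mod: "on_arc a g (c mod N) = on_arc a g c" for c by (simp add: on_arc_def)
  have seg_in: "seg N c d \<in> ?Seg \<longleftrightarrow> on_arc a g c = 1 \<and> on_arc a g d = 1" if "c mod N \<noteq> d mod N" for c d
  proof
    assume "seg N c d \<in> ?Seg"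
    then show "on_arc a g c = 1 \<and> on_arc a g d = 1"
      by (auto simp: segments_on_minor_arc_def minor_arc_eq[OF g] seg_def doubleton_eq_iff on_mod)
  next
    assume "on_arc a g c = 1 \<and> on_arc a g d = 1"
    then show "seg N c d \<in> ?Seg"
      using that N unfolding segments_on_minor_arc_def minor_arc_eq[OF g] seg_def
      by (intro CollectI exI[of _ "c mod N"] exI[of _ "d mod N"]) (simp add: on_mod)
  qed
  have Seg_form: "\<exists>p q. k = seg N p q \<and> p mod N \<noteq> q mod N" if "k \<in> ?Seg" for k
  proof -
    have "\<exists>p q. k = {p, q} \<and> p < N \<and> q < N \<and> p \<noteq> q"
      using that unfolding segments_on_minor_arc_def minor_arc_eq[OF g] by blast
    then obtain p q where "k = {p, q}" "p < N" "q < N" "p \<noteq> q" by blast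
    then show ?thesis by (intro exI[of _ p] exI[of _ q]) (simp add: seg_def)
  qed
  have fin: "finite ?Seg"
    by (rule finite_subset[of _ "Pow {..<N}"]) (auto simp: segments_on_minor_arc_def minor_arc_eq[OF g])
  let ?A = "{k \<in> ?Seg. x k = X c d}"
  have A: "?A = ?Seg \<inter> {seg N c d, seg N (c + P) (d + P)}"
  proof (intro equalityI subsetI)
    fix k assume k: "k \<in> ?A"
    then obtain p q where pq: "k = seg N p q" "p mod N \<noteq> q mod N" using Seg_form by blast
    then show "k \<in> ?Seg \<inter> {seg N c d, seg N (c + P) (d + P)}"
      using k x_eq[OF cd pq(2)] by (auto simp: X_def)
  next
    fix k assume "k \<in> ?Seg \<inter> {seg N c d, seg N (c + P) (d + P)}"
    then show "k \<in> ?A" using X_shift[OF cd] by (auto simp: X_def)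
  qed
  have look: "lookup (arc_vector a g) (X c d) = - real (card ?A)"
  proof -
    have "(\<Sum>k\<in>?Seg. lookup (single (x k) (1::real)) (X c d)) =
        (\<Sum>k\<in>?Seg. if x k = X c d then 1 else 0)"
      by (intro sum.cong) (auto simp: lookup_single when_def)
    also have "\<dots> = real (card ?A)" using fin by (simp add: sum.If_cases Int_def)
    finally show ?thesis by (simp add: arc_vector_def polygon_vector_def lookup_sum)
  qed
  have cd': "(c + P) mod N \<noteq> (d + P) mod N"
  proof
    assume "(c + P) mod N = (d + P) mod N"
    then have "(c + P + P) mod N = (d + P + P) mod N" by (metis mod_add_left_eq)
    with cd show False by (simp add: P2)
  qed
  have card_eq: "real (card ?A) = on_arc a g c * on_arc a g d +
      (if seg N c d = seg N (c + P) (d + P) then 0 else on_arc a g (c + P) * on_arc a g (d + P))"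
  proof -
    have ind: "on_arc a g c * on_arc a g d = of_bool (seg N c d \<in> ?Seg)" if "c mod N \<noteq> d mod N" for c d
      using seg_in[OF that] on01[of c] on01[of d] by auto
    have "real (card (?Seg \<inter> {l, k})) = of_bool (l \<in> ?Seg) + (if l = k then 0 else of_bool (k \<in> ?Seg))" for l k
      by (auto simp: Int_insert_right)
    then show ?thesis unfolding A ind[OF cd] ind[OF cd'] by simp
  qed
  show ?thesis
  proof (cases "P = N")
    case True
    then have "(c + P) mod N \<noteq> d mod N" and sg: "seg N c d = seg N (c + P) (d + P)" using cd by simp_all
    then have "mult c d = 1" by (simp add: mult_def)
    then show ?thesis using card_eq look unfolding if_P[OF True] if_P[OF sg] by (simp add: W_def)
  next
    case False
    then have NP: "N = 2 * P" using P by auto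
    show ?thesis
    proof (cases "(c + P) mod N = d mod N")
      case True
      \<comment> \<open>An arc of at most \<open>P\<close> vertices contains no antipodal pair. So a
        diameter never lies on it, and both sides are 0 whatever the factor
        \<open>mult\<close>.\<close>
      have no: "\<not> (on_arc a g c = 1 \<and> on_arc a g (c + P) = 1)" for c
      proof
        assume *: "on_arc a g c = 1 \<and> on_arc a g (c + P) = 1"
        then obtain t where t: "1 \<le> t" "t \<le> g" "c mod N = (a + t) mod N" by (auto simp: on_arc_def split: if_splits)
        then have cP: "(c + P) mod N = (a + (t + P)) mod N"
          by (metis add.assoc mod_add_left_eq)
        have "on_arc a g (a + (t + P)) = on_arc a g (c + P)" by (metis cP on_mod)
        moreover have "on_arc a g (a + (t + P)) = 0"
        proof (cases "t + P < N")
          case True then show ?thesis using on_arc_offset[of "t + P" g a] t g NP by auto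
        next
          case False
          then have "t = P" using t g NP by auto
          then have "(a + (t + P)) mod N = a mod N" using NP by (simp flip: mult_2)
          then have "on_arc a g (a + (t + P)) = on_arc a g (a + 0)" by (metis on_mod add_0_right)
          then show ?thesis using on_arc_offset[of 0 g a] g NP by simp
        qed
        ultimately show False using * by simp
      qed
      have d: "on_arc a g d = on_arc a g (c + P)" using True by (metis on_mod)
      have "on_arc a g (d + P) = on_arc a g c"
        using True P2[of c] by (metis mod_add_left_eq on_mod)
      then have "on_arc a g c * on_arc a g d = 0" "on_arc a g (c + P) * on_arc a g (d + P) = 0"
        using no[of c] on01[of c] on01[of "c + P"] d by auto
      then have "lookup (arc_vector a g) (X c d) = 0" unfolding look card_eq by auto
      then show ?thesis
        unfolding if_not_P[OF False] W_def
        by (simp only: \<open>on_arc a g c * on_arc a g d = 0\<close> \<open>on_arc a g (c + P) * on_arc a g (d + P) = 0\<close>)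
    next
      case F2: False
      have "seg N c d \<noteq> seg N (c + P) (d + P)"
      proof
        assume "seg N c d = seg N (c + P) (d + P)"
        then have "c mod N = (c + P) mod N" using F2 by (auto simp: seg_def doubleton_eq_iff)
        then show False using add_mod_ne[of P c] NP N by auto
      qed
      then show ?thesis using look card_eq False F2 by (simp add: W_def mult_def)
    qed
  qed
qed

text \<open>The mixed difference of a product of two functions, one for each endpoint, is the
  product of their differences.\<close>

definition jump :: "nat \<Rightarrow> nat \<Rightarrow> nat \<Rightarrow> real" where
  "jump a g c = on_arc a g c - on_arc a g (Suc c)"

lemma jump_eq:
  assumes g: "2 \<le> g" "g \<le> N div 2"
  shows "jump a g c = (if c mod N = a mod N then -1 else if c mod N = (a + g) mod N then 1 else 0)"
proof -
  obtain s where s: "s < N" "c mod N = (a + s) mod N"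
  proof (rule that)
    let ?s = "ccw_offset N (a mod N) (c mod N)"
    show "?s < N" "c mod N = (a + ?s) mod N"
      using offset_exists[of "a mod N" N "c mod N"] N by (auto simp: mod_add_left_eq)
  qed
  have "Suc c mod N = Suc (a + s) mod N" using s(2) by (metis mod_Suc_eq)
  then have "jump a g c = on_arc a g (a + s) - on_arc a g (a + Suc s)"
    using s(2) unfolding jump_def on_arc_def by simp
  also have "on_arc a g (a + s) = of_bool (1 \<le> s \<and> s \<le> g)"
    using on_arc_offset[of s g a] s g by auto
  also have "on_arc a g (a + Suc s) = of_bool (Suc s \<le> g)"
  proof (cases "Suc s < N")
    case True then show ?thesis using on_arc_offset[of "Suc s" g a] g by auto
  next
    case False
    then have "Suc s = N" using s by simp
    then have "on_arc a g (a + Suc s) = on_arc a g (a + 0)" by (simp add: on_arc_def)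
    then show ?thesis using on_arc_offset[of 0 g a] g \<open>Suc s = N\<close> N by auto
  qed
  finally have "jump a g c = of_bool (1 \<le> s \<and> s \<le> g) - of_bool (Suc s \<le> g)" .
  moreover have "c mod N = a mod N \<longleftrightarrow> s = 0"
    using s add_mod_cancel[of s N 0 a] N by auto
  moreover have "c mod N = (a + g) mod N \<longleftrightarrow> s = g"
    using s add_mod_cancel[of s N g a] g N by auto
  ultimately show ?thesis using g by auto
qed

lemma wall_arc_vector:
  assumes g: "2 \<le> g" "g \<le> N div 2" and k: "2 \<le> k" "k + 2 \<le> N"
  shows "wall c (c + k) (arc_vector a g) = - (jump a g c * jump a g (c + k) +
    (if P = N then 0 else jump a g (c + P) * jump a g (c + k + P)))"
proof -
  note L = lookup_arc_vector[OF g]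
  have "c mod N \<noteq> (c + k) mod N" "c mod N \<noteq> Suc (c + k) mod N"
    "Suc c mod N \<noteq> (c + k) mod N" "Suc c mod N \<noteq> Suc (c + k) mod N"
    using add_mod_ne[of k c] add_mod_ne[of "Suc k" c] add_mod_ne[of "k - 1" "Suc c"] add_mod_ne[of k "Suc c"] k
    by auto
  note L = L[OF this(1)] L[OF this(2)] L[OF this(3)] L[OF this(4)]
  show ?thesis unfolding wall_def L jump_def by (simp add: algebra_simps)
qed

text \<open>\<open>jump\<close> is nonzero only at \<open>a\<close> and \<open>a + g\<close>, with
  opposite signs. So a wall can be nonzero on the vector only if its two edges, or their antipodes,
  are the edges at these vertices, and then it is the same functional.\<close>

lemma wall_arc_vector_dual:
  assumes g: "2 \<le> g" "g \<le> N div 2"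
  shows "0 < wall a (a + g) (arc_vector a g)"
    and "h \<in> walls \<Longrightarrow> h \<noteq> wall a (a + g) \<Longrightarrow> h (arc_vector a g) = 0"
proof -
  have gN: "g + 2 \<le> N" using g N by auto
  have ne: "c mod N \<noteq> (c + k) mod N" if "2 \<le> k" "k + 2 \<le> N" for c k using add_mod_ne[of k c] that by auto
  have prod: "jump a g c * jump a g (c + k) \<le> 0" if "2 \<le> k" "k + 2 \<le> N" for c k
    using ne[OF that, of c] unfolding jump_eq[OF g] by auto
  have "jump a g a * jump a g (a + g) = -1"
    using ne[OF g(1) gN, of a] unfolding jump_eq[OF g] by auto
  \<comment> \<open>In types B and C the antipodal term is nonzero too if \<open>g = P\<close>; it
    has the same sign, so nothing cancels.\<close>
  moreover have "jump a g (a + P) * jump a g (a + g + P) \<le> 0"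
    using prod[OF g(1) gN, of "a + P"] by (simp add: add_ac)
  ultimately show "0 < wall a (a + g) (arc_vector a g)"
    unfolding wall_arc_vector[OF g g(1) gN] by auto
next
  assume h: "h \<in> walls" "h \<noteq> wall a (a + g)"
  then obtain c k where ck: "h = wall c (c + k)" "2 \<le> k" "k \<le> N div 2" by (auto simp: walls_def)
  have kN: "k + 2 \<le> N" using ck N by auto
  show "h (arc_vector a g) = 0"
  proof (rule ccontr)
    assume nz: "h (arc_vector a g) \<noteq> 0"
    have "\<exists>\<sigma>. (\<sigma> = 0 \<or> \<sigma> = P) \<and> jump a g (c + \<sigma>) * jump a g (c + k + \<sigma>) \<noteq> 0"
    proof (cases "jump a g c * jump a g (c + k) = 0")
      case True
      then have "jump a g (c + P) * jump a g (c + k + P) \<noteq> 0"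
        using nz unfolding ck(1) wall_arc_vector[OF g ck(2) kN] by (auto split: if_splits)
      then show ?thesis by blast
    next
      case False
      then show ?thesis by (intro exI[of _ 0]) simp
    qed
    then obtain \<sigma> where \<sigma>: "\<sigma> = 0 \<or> \<sigma> = P" and ne0: "jump a g (c + \<sigma>) * jump a g (c + k + \<sigma>) \<noteq> 0" by blast
    have hs: "h = wall (c + \<sigma>) (c + k + \<sigma>)"
      using \<sigma> wall_shift[OF ck(2) kN, of c] ck(1) by auto
    have neq: "(c + \<sigma>) mod N \<noteq> (c + k + \<sigma>) mod N"
      using add_mod_ne[of k "c + \<sigma>"] ck(2) kN by (simp add: add_ac)
    have "(c + \<sigma>) mod N = a mod N \<and> (c + k + \<sigma>) mod N = (a + g) mod N \<or>
        (c + k + \<sigma>) mod N = a mod N \<and> (c + \<sigma>) mod N = (a + g) mod N"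
      using ne0 neq unfolding jump_eq[OF g] by (auto split: if_splits)
    then have "h = wall a (a + g)"
    proof
      assume "(c + \<sigma>) mod N = a mod N \<and> (c + k + \<sigma>) mod N = (a + g) mod N"
      then show ?thesis unfolding hs by (intro wall_cong) auto
    next
      assume "(c + k + \<sigma>) mod N = a mod N \<and> (c + \<sigma>) mod N = (a + g) mod N"
      then show ?thesis unfolding hs by (subst wall_commute) (intro wall_cong, auto)
    qed
    with h(2) show False ..
  qed
qed

section \<open>Polygon vectors as generators of the rays\<close>

lemma polygon_vectors_eq: "polygon_vectors N x = {arc_vector a g | a g. 2 \<le> g \<and> g \<le> N div 2}"
proof (intro equalityI subsetI)
  fix v assume "v \<in> {arc_vector a g | a g. 2 \<le> g \<and> g \<le> N div 2}"
  then obtain a g where v: "v = arc_vector a g" "2 \<le> g" "g \<le> N div 2" by blast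
  have "seg_length N (Suc a mod N) ((a + g) mod N) = min (g - 1) (N - (g - 1))"
    using seg_length_add[of "g - 1" N "Suc a"] v by simp
  moreover have "Suc a mod N \<noteq> (a + g) mod N" using add_mod_ne[of "g - 1" "Suc a"] v by simp
  ultimately show "v \<in> polygon_vectors N x"
    using v N unfolding polygon_vectors_def arc_vector_def
    by (intro CollectI exI[of _ "Suc a mod N"] exI[of _ "(a + g) mod N"]) auto
next
  fix v assume "v \<in> polygon_vectors N x"
  then obtain i j where v: "v = polygon_vector N x i j" "i < N" "j < N" "i \<noteq> j" "seg_length N i j < N div 2"
    by (auto simp: polygon_vectors_def)
  have *: "polygon_vector N x i j \<in> {arc_vector a g | a g. 2 \<le> g \<and> g \<le> N div 2}"
    if "i < N" "j < N" "i \<noteq> j" "ccw_offset N i j < N div 2" for i j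
  proof -
    let ?o = "ccw_offset N i j"
    have o: "j = (i + ?o) mod N" using offset_exists that by blast
    then have "?o \<noteq> 0" using that by (metis add_0_right mod_less)
    \<comment> \<open>\<open>i + N - 1\<close> stands for the vertex before
      \<open>i\<close>.\<close>
    have "i + N - 1 + (?o + 1) = i + ?o + N" "Suc (i + N - 1) = i + N" using N by auto
    then have "Suc (i + N - 1) mod N = i" "(i + N - 1 + (?o + 1)) mod N = j"
      using that(1) o by (simp_all only: mod_add_self2 mod_less)
    then have "polygon_vector N x i j = arc_vector (i + N - 1) (?o + 1)" by (simp only: arc_vector_def)
    then show ?thesis using that \<open>?o \<noteq> 0\<close> by (intro CollectI exI[of _ "i + N - 1"] exI[of _ "?o + 1"]) auto
  qed
  have sym: "polygon_vector N x i j = polygon_vector N x j i"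
  proof -
    have "ccw_offset N i j = ccw_offset N j i \<or> minor_arc N i j = minor_arc N j i"
      by (auto simp: minor_arc_def)
    \<comment> \<open>Equal offsets would mean antipodal endpoints, hence length
      \<open>N div 2\<close>, which is excluded.\<close>
    moreover have "ccw_offset N i j \<noteq> ccw_offset N j i"
    proof
      assume eq: "ccw_offset N i j = ccw_offset N j i"
      let ?o = "ccw_offset N i j"
      have o: "j = (i + ?o) mod N" "?o < N" using offset_exists v by blast+
      then have "?o \<noteq> 0" using v by (metis add_0_right mod_less)
      then have "ccw_offset N j i = N - ?o" using offset_sub[of ?o N i] o v by simp
      then show False using eq v(5) o by (auto simp: seg_length_def)
    qed
    ultimately show ?thesis by (simp add: polygon_vector_def segments_on_minor_arc_def)
  qed
  show "v \<in> {arc_vector a g | a g. 2 \<le> g \<and> g \<le> N div 2}"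
    using *[of i j] *[of j i] v sym by (auto simp: seg_length_def min_def split: if_splits)
qed

lemma bounded_linear_wall: "bounded_linear (wall a b)"
  unfolding wall_def[abs_def] W_def
  by (intro bounded_linear_add bounded_linear_sub bounded_linear_const_mult bounded_linear_lookup)

lemma polygon_vector_weight_space: "polygon_vectors N x \<subseteq> weight_space vars"
proof
  fix v assume "v \<in> polygon_vectors N x"
  then obtain a g where v: "v = arc_vector a g" "2 \<le> g" "g \<le> N div 2" by (auto simp: polygon_vectors_eq)
  let ?Seg = "segments_on_minor_arc N (Suc a mod N) ((a + g) mod N)"
  have "keys v \<subseteq> (\<Union>k\<in>?Seg. keys (single (x k) (1::real)))"
    unfolding v arc_vector_def polygon_vector_def keys_minus by (rule keys_sum)
  also have "\<dots> \<subseteq> vars"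
  proof -
    have "x k \<in> vars" if "k \<in> ?Seg" for k
    proof -
      have "\<exists>p q. k = {p, q} \<and> p < N \<and> q < N \<and> p \<noteq> q"
        using that unfolding segments_on_minor_arc_def minor_arc_eq[OF v(2,3)] by blast
      then obtain p q where "k = {p, q}" "p < N" "q < N" "p \<noteq> q" by blast
      then show ?thesis using X_vars[of p q] by (simp add: X_def seg_def)
    qed
    then show ?thesis by auto
  qed
  finally show "v \<in> weight_space vars" by (simp add: weight_space_def)
qed

theorem rays_of_polygon_cone:
  defines "C \<equiv> closure {\<omega> \<in> weight_space vars. strict \<omega>}"
  shows "generated_ray (lineality_space C) ` polygon_vectors N x = rays_mod_lineality C"
proof -
  have bl: "bounded_linear h" if "h \<in> walls" for h
    using that bounded_linear_wall by (auto simp: walls_def)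
  let ?w = "\<Sum>v\<in>{arc_vector a g | a g. a < N \<and> 2 \<le> g \<and> g \<le> N div 2}. v"
  have mod_arc: "arc_vector (a mod N) g = arc_vector a g" for a g
    by (simp add: arc_vector_def mod_simps)
  have eqset: "{arc_vector a g | a g. a < N \<and> 2 \<le> g \<and> g \<le> N div 2} = polygon_vectors N x" (is "?B = _")
  proof (intro equalityI subsetI)
    fix v assume "v \<in> polygon_vectors N x"
    then obtain a g where v: "v = arc_vector a g" "2 \<le> g" "g \<le> N div 2" by (auto simp: polygon_vectors_eq)
    then show "v \<in> ?B"
      using mod_arc[of a g] N by (intro CollectI exI[of _ "a mod N"] exI[of _ g]) auto
  qed (auto simp: polygon_vectors_eq)
  have fin: "finite (polygon_vectors N x)"
  proof -
    have "?B \<subseteq> (\<lambda>(a, g). arc_vector a g) ` ({..<N} \<times> {..N div 2})" by auto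
    then show ?thesis unfolding eqset by (rule finite_subset) auto
  qed
  have nn: "0 \<le> h v" if h: "h \<in> walls" and vP: "v \<in> polygon_vectors N x" for h v
  proof -
    obtain a g where v: "v = arc_vector a g" "2 \<le> g" "g \<le> N div 2" using vP by (auto simp: polygon_vectors_eq)
    show ?thesis using wall_arc_vector_dual[OF v(2,3), where a = a] h
      unfolding v(1) by (metis less_imp_le order_refl)
  qed
  have dual1: "\<exists>h\<in>walls. 0 < h v \<and> (\<forall>h'\<in>walls. h' \<noteq> h \<longrightarrow> h' v = 0)" if vP: "v \<in> polygon_vectors N x" for v
  proof -
    obtain a g where v: "v = arc_vector a g" "2 \<le> g" "g \<le> N div 2" using vP by (auto simp: polygon_vectors_eq)
    have "wall a (a + g) \<in> walls" using v by (auto simp: walls_def)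
    with wall_arc_vector_dual[OF v(2,3), where a = a] show ?thesis unfolding v(1) by blast
  qed
  have dual2: "\<exists>v\<in>polygon_vectors N x. 0 < h v \<and> (\<forall>h'\<in>walls. h' \<noteq> h \<longrightarrow> h' v = 0)" if hW: "h \<in> walls" for h
  proof -
    obtain a g where h: "h = wall a (a + g)" "2 \<le> g" "g \<le> N div 2" using hW by (auto simp: walls_def)
    have "arc_vector a g \<in> polygon_vectors N x" using h by (auto simp: polygon_vectors_eq)
    with wall_arc_vector_dual[OF h(2,3), where a = a] show ?thesis unfolding h(1) by blast
  qed
  \<comment> \<open>By duality the sum of all polygon vectors is strictly positive on every wall; it
    is the interior point that the computation of the closure requires.\<close>
  define w0 where "w0 = (\<Sum>v\<in>polygon_vectors N x. v)"
  have "w0 \<in> weight_space vars"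
    unfolding w0_def using polygon_vector_weight_space by (intro subspace_sum subspace_weight_space) auto
  moreover have "0 < h w0" if h: "h \<in> walls" for h
  proof -
    obtain v where v: "v \<in> polygon_vectors N x" "0 < h v" using dual2[OF h] by blast
    have "h w0 = (\<Sum>v\<in>polygon_vectors N x. h v)"
      unfolding w0_def using bl[OF h] by (simp add: linear_sum bounded_linear.linear)
    also have "0 < \<dots>" using v nn[OF h] fin by (intro sum_pos2[of _ v]) auto
    finally show ?thesis .
  qed
  ultimately have "C = {\<omega> \<in> weight_space vars. \<forall>h\<in>walls. 0 \<le> h \<omega>}"
    unfolding C_def strict_def
    by (intro closure_strict_cone[of _ _ w0] subspace_weight_space closed_weight_space bl)
  then show ?thesis
    using polygon_vector_weight_space dual1 dual2 bl
    by (intro rays_of_simplicial_cone[where H = walls and W = "weight_space vars"] subspace_weight_space)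
      (auto intro: bounded_linear.linear)
qed

end

section \<open>Straightening relations: type A\<close>

lemma presentation_single_add:
  assumes "field_embedding \<iota>"
  shows "presentation \<iota> (single (a + b) 1) =
    presentation \<iota> (single a 1) * presentation \<iota> (single b 1)"
  using presentation_simps(3)[OF assms, of "single a 1" "single b 1"]
  by (simp add: mult_single)

lemma presentation_single_single:
  assumes "field_embedding \<iota>"
  shows "presentation \<iota> (single (single v k) 1) = v ^ k"
  unfolding single_Var by (simp add: presentation_simps assms)

lemma not_crossing_edge: "2 < N \<Longrightarrow> \<not> crossing N (seg N a (Suc a)) k"
proof
  assume N: "2 < N" and cr: "crossing N (seg N a (Suc a)) k"
  from crossing_diagonals(1)[OF cr] obtain i j where ij: "seg N a (Suc a) = {i, j}" "2 \<le> seg_length N i j"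
    by (auto simp: diagonals_def)
  have "seg_length N (a mod N) (Suc a mod N) = 1"
    using seg_length_add[of 1 N a] N by simp
  moreover have "seg_length N i j = seg_length N (a mod N) (Suc a mod N)"
    using ij(1) by (auto simp: seg_def doubleton_eq_iff seg_length_def)
  ultimately show False using ij(2) by simp
qed

context polygon_frame
begin

definition inc :: "'f \<Rightarrow> 'f \<Rightarrow> bool" where
  "inc v w \<longleftrightarrow> (\<exists>l k. crossing N l k \<and> v = x l \<and> w = x k)"

text \<open>Weights are indexed by variables, so the multiplicity has to be read off from the
  variable; \<open>var_mult_X\<close> shows that it agrees with \<open>mult\<close>.\<close>

definition var_mult :: "'f \<Rightarrow> nat" where
  "var_mult v = (if \<exists>a. v = X a (a + P) \<and> a mod N \<noteq> (a + P) mod N then e else 1)"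

text \<open>Normalised so that \<open>W degree_vector\<close> is constantly \<open>e\<close>, which
  makes all the relations homogeneous. In type B diameters get degree 1 and all other segments
  degree 2.\<close>

definition degree_vector :: "'f \<Rightarrow>\<^sub>0 real" where
  "degree_vector = (\<Sum>v\<in>vars. single v (real e / real (var_mult v)))"

text \<open>One polynomial has to serve all strict \<open>\<omega>\<close> at once.\<close>

definition straight :: "('k::field \<Rightarrow> 'f) \<Rightarrow> 'f \<Rightarrow> 'f \<Rightarrow> bool" where
  "straight \<iota> v w \<longleftrightarrow> (\<exists>p\<in>poly_ring vars. presentation \<iota> p = v * w \<and>
     (\<forall>a\<in>keys p. weight degree_vector a \<le> weight degree_vector (pair_monomial v w) \<and>
        (\<forall>\<omega>. strict \<omega> \<longrightarrow> weight \<omega> a < weight \<omega> (pair_monomial v w))))"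

text \<open>A relation with exactly one nonstandard monomial. If the initial ideal is the ideal of
  incompatible pairs, \<open>m0\<close> must outweigh \<open>m2\<close>, and the wall is positive.
  The factor \<open>c\<close> accounts for the multiplicity of diameters.\<close>

definition separated_wall :: "('k::field \<Rightarrow> 'f) \<Rightarrow> nat \<Rightarrow> nat \<Rightarrow> bool" where
  "separated_wall \<iota> a g \<longleftrightarrow> (\<exists>m0 m1 m2 c. 0 < c \<and> \<not> standard inc m0 \<and> standard inc m1 \<and> standard inc m2 \<and>
     keys m0 \<subseteq> vars \<and> keys m1 \<subseteq> vars \<and> keys m2 \<subseteq> vars \<and>
     presentation \<iota> (single m0 1) =
       presentation \<iota> (single m1 1) + presentation \<iota> (single m2 1) \<and>
     (\<forall>\<omega>. wall a (a + g) \<omega> = c * (weight \<omega> m0 - weight \<omega> m2)))"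

lemma seg_eq_cases:
  "seg N c d = seg N a b \<longleftrightarrow>
    c mod N = a mod N \<and> d mod N = b mod N \<or> c mod N = b mod N \<and> d mod N = a mod N"
  by (auto simp: seg_def doubleton_eq_iff)

lemma shift_cancel: "(a + P) mod N = (b + P) mod N \<longleftrightarrow> a mod N = b mod N"
  by (metis P2 mod_add_left_eq)

lemma var_mult_X: 
  assumes ab: "a mod N \<noteq> b mod N" shows "var_mult (X a b) = mult a b"
proof (cases "(a + P) mod N = b mod N")
  case True
  then have "X a b = X a (a + P)" by (intro X_cong) auto
  then show ?thesis using True ab unfolding var_mult_def mult_def by metis
next
  case False
  have "\<not> (X a b = X c (c + P) \<and> c mod N \<noteq> (c + P) mod N)" for c
  proof
    assume *: "X a b = X c (c + P) \<and> c mod N \<noteq> (c + P) mod N"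
    then have "seg N c (c + P) = seg N a b \<or> seg N c (c + P) = seg N (a + P) (b + P)"
      using x_eq[OF ab, of c "c + P"] by (simp add: X_def)
    then have "(a + P) mod N = b mod N"
      unfolding seg_eq_cases by (metis P2 shift_cancel)
    with False show False ..
  qed
  then show ?thesis using False unfolding var_mult_def mult_def by auto
qed

lemma lookup_degree_vector: "v \<in> vars \<Longrightarrow> lookup degree_vector v = real e / real (var_mult v)"
  using finite_vars by (simp add: degree_vector_def lookup_sum lookup_single when_def)

lemma degree_vector_ge_1: "v \<in> vars \<Longrightarrow> 1 \<le> lookup degree_vector v"
  using e by (auto simp: lookup_degree_vector var_mult_def)

lemma W_degree_vector: "a mod N \<noteq> b mod N \<Longrightarrow> W degree_vector a b = real e"
  using mult_pos[of a b] by (simp add: W_def lookup_degree_vector X_vars var_mult_X)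

text \<open>The monomials form a list rather than a set: the coefficient 2 occurring in type B is
  expressed by repetition.\<close>

lemma straightI:
  fixes \<iota> :: "'k::field \<Rightarrow> 'f"
  assumes emb: "field_embedding \<iota>"
    and vw: "v * w = (\<Sum>a\<leftarrow>ms. presentation \<iota> (single a 1))"
    and ms: "\<And>a. a \<in> set ms \<Longrightarrow> keys a \<subseteq> vars \<and>
      weight degree_vector a = lookup degree_vector v + lookup degree_vector w \<and>
      (\<forall>\<omega>. strict \<omega> \<longrightarrow> weight \<omega> a < lookup \<omega> v + lookup \<omega> w)"
  shows "straight \<iota> v w"
proof -
  define p :: "('f, 'k) mpoly" where "p = (\<Sum>a\<leftarrow>ms. single a 1)"
  have "presentation \<iota> (\<Sum>a\<leftarrow>as. single a 1) = (\<Sum>a\<leftarrow>as. presentation \<iota> (single a 1))" for as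
    by (induction as) (simp_all add: presentation_simps emb, simp add: presentation_def)
  then have "presentation \<iota> p = v * w" by (simp add: p_def vw)
  moreover have keys: "keys (\<Sum>a\<leftarrow>as. single a (1::'k)) \<subseteq> set as" for as :: "('f \<Rightarrow>\<^sub>0 nat) list"
  proof (induction as)
    case (Cons a as)
    then show ?case using Poly_Mapping.keys_add[of "single a (1::'k)" "\<Sum>a\<leftarrow>as. single a 1"]
      by auto
  qed simp
  moreover have "p \<in> poly_ring vars" using keys[of ms] ms unfolding poly_ring_def p_def by blast
  moreover have "weight degree_vector a \<le> weight degree_vector (pair_monomial v w) \<and>
      (\<forall>\<omega>. strict \<omega> \<longrightarrow> weight \<omega> a < weight \<omega> (pair_monomial v w))"
    if "a \<in> keys p" for a
  proof -
    have "a \<in> set ms" using that keys[of ms] by (auto simp: p_def)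
    from ms[OF this] show ?thesis by simp
  qed
  ultimately show ?thesis unfolding straight_def by blast
qed

lemma straight_sym: "straight \<iota> v w \<Longrightarrow> straight \<iota> w v"
  by (simp add: straight_def mult.commute add.commute)

abbreviation mono1 :: "nat \<Rightarrow> nat \<Rightarrow> 'f \<Rightarrow>\<^sub>0 nat" where
  "mono1 a b \<equiv> single (X a b) (mult a b)"

lemma weight_mono1: "weight \<omega> (mono1 a b) = W \<omega> a b"
  by (simp add: W_def)

text \<open>As the crossing pair has multiplicity 1, its weight is a sum of two values of
  \<open>W\<close>. The monomials on the right are built from powers \<open>X a b ^ mult a b\<close>
  so that theirs are such sums as well.\<close>

lemma straight_quadratic:
  fixes \<iota> :: "'k::field \<Rightarrow> 'f"
  assumes emb: "field_embedding \<iota>" and ij: "i mod N \<noteq> k mod N" "j mod N \<noteq> l mod N"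
    and m1: "mult i k = 1" "mult j l = 1"
    and eq: "X i k * X j l = (\<Sum>(a, b, c, d)\<leftarrow>ts. X a b ^ mult a b * X c d ^ mult c d)"
    and ts: "\<And>a b c d. (a, b, c, d) \<in> set ts \<Longrightarrow> a mod N \<noteq> b mod N \<and> c mod N \<noteq> d mod N \<and>
      (\<forall>\<omega>. strict \<omega> \<longrightarrow> W \<omega> a b + W \<omega> c d < W \<omega> i k + W \<omega> j l)"
  shows "straight \<iota> (X i k) (X j l)"
proof (rule straightI[OF emb, where ms = "map (\<lambda>(a, b, c, d). mono1 a b + mono1 c d) ts"])
  show "X i k * X j l = (\<Sum>a\<leftarrow>map (\<lambda>(a, b, c, d). mono1 a b + mono1 c d) ts. presentation \<iota> (single a 1))"
    unfolding eq map_map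
    by (intro arg_cong[where f = sum_list] map_cong)
      (auto simp: presentation_single_add[OF emb] presentation_single_single[OF emb])
  fix m assume "m \<in> set (map (\<lambda>(a, b, c, d). mono1 a b + mono1 c d) ts)"
  then obtain a b c d where m: "(a, b, c, d) \<in> set ts" "m = mono1 a b + mono1 c d" by auto
  have look: "lookup \<omega> (X i k) = W \<omega> i k" "lookup \<omega> (X j l) = W \<omega> j l" for \<omega>
    by (simp_all add: W_def m1)
  show "keys m \<subseteq> vars \<and>
      weight degree_vector m = lookup degree_vector (X i k) + lookup degree_vector (X j l) \<and>
      (\<forall>\<omega>. strict \<omega> \<longrightarrow> weight \<omega> m < lookup \<omega> (X i k) + lookup \<omega> (X j l))"
    using ts[OF m(1)] ij unfolding m(2) look weight_add weight_mono1
    by (auto simp: keys_add_nat X_vars W_degree_vector)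
qed

lemma straight_ptolemy:
  fixes \<iota> :: "'k::field \<Rightarrow> 'f"
  assumes emb: "field_embedding \<iota>" and ord: "i < j" "j < k" "k < l" "l < i + N"
    and m1: "mult i k = 1" "mult j l = 1"
    and eq: "X i k * X j l = X i j ^ mult i j * X k l ^ mult k l + X i l ^ mult i l * X j k ^ mult j k"
  shows "straight \<iota> (X i k) (X j l)"
proof -
  have ne: "a mod N \<noteq> b mod N" if "a < b" "b < a + N" for a b
    using add_mod_ne[of "b - a" a] that by auto
  have nes: "i mod N \<noteq> k mod N" "j mod N \<noteq> l mod N" "i mod N \<noteq> j mod N" "k mod N \<noteq> l mod N"
    "i mod N \<noteq> l mod N" "j mod N \<noteq> k mod N"
    using ord by - (rule ne; linarith)+
  show ?thesis
  proof (rule straight_quadratic[OF emb nes(1,2) m1, where ts = "[(i, j, k, l), (i, l, j, k)]"])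
    fix a b c d assume "(a, b, c, d) \<in> set [(i, j, k, l), (i, l, j, k)]"
    then have "(a, b, c, d) = (i, j, k, l) \<or> (a, b, c, d) = (i, l, j, k)" by simp
    then show "a mod N \<noteq> b mod N \<and> c mod N \<noteq> d mod N \<and>
        (\<forall>\<omega>. strict \<omega> \<longrightarrow> W \<omega> a b + W \<omega> c d < W \<omega> i k + W \<omega> j l)"
      using nes four_point1[OF _ ord] four_point2[OF _ ord] by (elim disjE) simp_all
  qed (simp add: eq)
qed

lemma separated_wallI:
  assumes "0 < c" "\<not> standard inc m0" "standard inc m1" "standard inc m2"
    "keys m0 \<subseteq> vars \<and> keys m1 \<subseteq> vars \<and> keys m2 \<subseteq> vars"
    "presentation \<iota> (single m0 1) =
       presentation \<iota> (single m1 1) + presentation \<iota> (single m2 1)"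
    "\<And>\<omega>. wall a (a + g) \<omega> = c * (weight \<omega> m0 - weight \<omega> m2)"
  shows "separated_wall \<iota> a g"
  unfolding separated_wall_def using assms
  by (intro exI[of _ m0] exI[of _ m1] exI[of _ m2] exI[of _ c]) simp

text \<open>Rotating both segments by \<open>P\<close> preserves crossing, so the representative of
  the first variable may be fixed; only that of the second remains ambiguous.\<close>

lemma X_of_inc:
  assumes "inc (X a b) (X c d)" "a mod N \<noteq> b mod N" "c mod N \<noteq> d mod N"
  shows "crossing N (seg N a b) (seg N c d) \<or> crossing N (seg N a b) (seg N (c + P) (d + P))"
proof -
  from assms(1) obtain l k where lk: "crossing N l k" "X a b = x l" "X c d = x k" by (auto simp: inc_def)
  have nd: "\<exists>p q. l = seg N p q \<and> p mod N \<noteq> q mod N" if "crossing N l k" for l k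
    using that
  proof (rule crossingE)
    fix a b c d assume "a < b" "b < c" "c < d" "d < a + N" "l = seg N a c"
    then show ?thesis using add_mod_ne[of "c - a" a] by (intro exI[of _ a] exI[of _ c]) simp
  qed
  obtain p q where pq: "l = seg N p q" "p mod N \<noteq> q mod N" using nd[OF lk(1)] by blast
  obtain p' q' where pq': "k = seg N p' q'" "p' mod N \<noteq> q' mod N" using nd[OF crossing_sym[OF lk(1)]] by blast
  have l: "l = seg N a b \<or> l = seg N (a + P) (b + P)"
    using x_eq[OF assms(2) pq(2)] lk pq by (simp add: X_def)
  have k: "k = seg N c d \<or> k = seg N (c + P) (d + P)"
    using x_eq[OF assms(3) pq'(2)] lk pq' by (simp add: X_def)
  have dbl: "seg N (a + P + P) (b + P + P) = seg N a b" for a b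
    by (simp add: seg_def P2)
  show ?thesis
    using l k lk(1) crossing_rot[OF lk(1), of P] by (auto simp: rot_seg dbl)
qed

lemma not_inc_edge: "\<not> inc (X a (Suc a)) v"
proof
  assume "inc (X a (Suc a)) v"
  then obtain l k where lk: "crossing N l k" "X a (Suc a) = x l" by (auto simp: inc_def)
  from lk(1) obtain p q r t where pq: "p < q" "q < r" "r < t" "t < p + N" "l = seg N p r" by (rule crossingE)
  have ne: "p mod N \<noteq> r mod N" using pq add_mod_ne[of "r - p" p] by auto
  have "a mod N \<noteq> Suc a mod N" using add_mod_ne[of 1 a] N by auto
  then have "l = seg N a (Suc a) \<or> l = seg N (a + P) (Suc (a + P))"
    using x_eq[OF _ ne, of a "Suc a"] lk pq by (simp add: X_def)
  then show False using lk(1) not_crossing_edge N by force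
qed

lemma inc_sym: "inc v w \<Longrightarrow> inc w v"
  by (auto simp: inc_def intro: crossing_sym)

lemma inc_crossing: "i < j \<Longrightarrow> j < k \<Longrightarrow> k < l \<Longrightarrow> l < i + N \<Longrightarrow> inc (X i k) (X j l)"
  unfolding inc_def X_def using crossingI by blast

text \<open>This makes one product of opposite sides of the quadrilateral standard. In types B and C
  the antipode of the inner segment has to be checked too; for \<open>g = P\<close> it ends in the
  vertex \<open>a\<close> of the outer one.\<close>

lemma not_inc_nested:
  assumes g: "2 \<le> g" "g \<le> N div 2"
  shows "\<not> inc (X a (Suc (a + g))) (X (Suc a) (a + g))"
proof
  assume inc: "inc (X a (Suc (a + g))) (X (Suc a) (a + g))"
  have n: "a mod N \<noteq> Suc (a + g) mod N" "Suc a mod N \<noteq> (a + g) mod N"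
    using add_mod_ne[of "Suc g" a] add_mod_ne[of "g - 1" "Suc a"] g N by auto
  have no: "\<not> crossing N (seg N a (a + Suc g)) (seg N (a + 1) (a + g))"
    using crossing_seg_iff[of "Suc g" N 1 g a] g N by auto
  moreover have "\<not> crossing N (seg N a (a + Suc g)) (seg N (a + (1 + P)) (a + (g + P)))"
  proof (cases "P = N")
    case True
    then have "seg N (a + (1 + P)) (a + (g + P)) = seg N (a + 1) (a + g)"
      by (simp add: seg_def flip: add.assoc del: add_Suc add_Suc_right)
    then show ?thesis using no by simp
  next
    case False
    then have NP: "N = 2 * P" using P by auto
    show ?thesis
    proof (cases "g = P")
      case True
      then have "(a + (g + P)) mod N = (a + 0) mod N" using NP by (simp flip: mult_2)
      then have "seg N (a + (1 + P)) (a + (g + P)) = seg N (a + (1 + P)) (a + 0)" by (simp add: seg_def)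
      then show ?thesis using crossing_seg_iff[of "Suc g" N "1 + P" 0 a] g NP N True by auto
    next
      case F: False
      then show ?thesis using crossing_seg_iff[of "Suc g" N "1 + P" "g + P" a] g NP N by auto
    qed
  qed
  ultimately show False using X_of_inc[OF inc n] by (simp add: add_ac)
qed

text \<open>For strict weights, each pair in \<open>inc\<close> has representatives in cyclic
  position \<open>i < j < k < l < i + N\<close>, which can be straightened. Conversely
  \<open>initial_ideal_eqD\<close> is applied to the relation of each wall.\<close>

lemma initial_ideal_iff_strict:
  fixes \<iota> :: "'k::field_char_0 \<Rightarrow> 'f"
  assumes emb: "field_embedding \<iota>"
    and indep: "\<And>p. p \<in> poly_ring vars \<Longrightarrow> \<forall>a\<in>keys p. standard inc a \<Longrightarrow> presentation \<iota> p = 0 \<Longrightarrow> p = 0"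
    and str: "\<And>i j k l. i < j \<Longrightarrow> j < k \<Longrightarrow> k < l \<Longrightarrow> l < i + N \<Longrightarrow> straight \<iota> (X i k) (X j l)"
    and sep: "\<And>a g. 2 \<le> g \<Longrightarrow> g \<le> N div 2 \<Longrightarrow> separated_wall \<iota> a g"
    and irrefl: "\<And>v. \<not> inc v v"
  shows "initial_ideal vars \<omega> {p \<in> poly_ring vars. presentation \<iota> p = 0} =
      ideal_gen vars {Var v * Var w | v w. inc v w} \<longleftrightarrow> strict \<omega>"
proof -
  have cross: "\<exists>i j k l. i < j \<and> j < k \<and> k < l \<and> l < i + N \<and> v = X i k \<and> w = X j l" if vw: "inc v w" for v w
  proof -
    obtain l k where lk: "crossing N l k" "v = x l" "w = x k" using vw by (auto simp: inc_def)
    from lk(1) show ?thesis using lk(2,3) by (elim crossingE) (auto simp: X_def)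
  qed
  interpret md: monomial_degeneration \<iota> vars inc degree_vector
  proof
    show "v \<in> vars \<and> w \<in> vars" if vw: "inc v w" for v w
    proof -
      obtain i j k l where *: "i < j" "j < k" "k < l" "l < i + N" "v = X i k" "w = X j l"
        using cross[OF vw] by blast
      then show ?thesis using X_vars[of i k] X_vars[of j l] add_mod_ne[of "k - i" i] add_mod_ne[of "l - j" j] by auto
    qed
  qed (use emb indep irrefl finite_vars degree_vector_ge_1 in auto)
  show ?thesis
  proof
    assume st: "strict \<omega>"
    have "md.straightening \<omega>"
      unfolding md.straightening_def
    proof (intro allI impI)
      fix v w assume "inc v w"
      then have "straight \<iota> v w" using cross str by blast
      then show "\<exists>p\<in>poly_ring vars. presentation \<iota> p = v * w \<and>
          (\<forall>a\<in>keys p. weight degree_vector a \<le> weight degree_vector (pair_monomial v w) \<and>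
            weight \<omega> a < weight \<omega> (pair_monomial v w))"
        using st unfolding straight_def by fast
    qed
    from md.initial_ideal_eq[OF this]
    show "initial_ideal vars \<omega> {p \<in> poly_ring vars. presentation \<iota> p = 0} = ideal_gen vars {Var v * Var w | v w. inc v w}"
      by (simp add: md.kernel_def md.pair_ideal_def)
  next
    assume "initial_ideal vars \<omega> {p \<in> poly_ring vars. presentation \<iota> p = 0} = ideal_gen vars {Var v * Var w | v w. inc v w}"
    then have eq: "initial_ideal vars \<omega> md.kernel = md.pair_ideal"
      by (simp add: md.kernel_def md.pair_ideal_def)
    show "strict \<omega>"
      unfolding strict_def
    proof
      fix h assume "h \<in> walls"
      then obtain a g where h: "h = wall a (a + g)" "2 \<le> g" "g \<le> N div 2" by (auto simp: walls_def)
      obtain m0 m1 m2 c where m: "0 < c" "\<not> standard inc m0" "standard inc m1" "standard inc m2"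
        "keys m0 \<subseteq> vars" "keys m1 \<subseteq> vars" "keys m2 \<subseteq> vars"
        "presentation \<iota> (single m0 1) =
          presentation \<iota> (single m1 1) + presentation \<iota> (single m2 1)"
        and hw: "\<And>\<omega>. wall a (a + g) \<omega> = c * (weight \<omega> m0 - weight \<omega> m2)"
        using sep[OF h(2,3), of a] unfolding separated_wall_def by blast
      let ?f = "single m0 1 - single m1 1 - single m2 (1::'k)"
      have ne: "m0 \<noteq> m1" "m0 \<noteq> m2" using m by auto
      have "?f \<in> md.kernel"
        unfolding md.kernel_def using m
        by (simp add: presentation_simps emb poly_ring_diff poly_ring_single)
      moreover have "standard inc b" if "b \<in> keys ?f" "b \<noteq> m0" for b
        using that m(3,4) by (auto simp: in_keys_iff lookup_minus lookup_single when_def split: if_splits)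
      \<comment> \<open>If \<open>m1 = m2\<close>, the coefficient is -2, which is nonzero in
        characteristic zero.\<close>
      moreover have "m2 \<in> keys ?f"
        using ne by (auto simp: in_keys_iff lookup_minus lookup_single when_def)
      ultimately have "weight \<omega> m2 < weight \<omega> m0"
        using md.initial_ideal_eqD[OF eq, of ?f m0 m2] m(4) by blast
      then show "0 < h \<omega>" using m(1) by (simp add: h(1) hw)
    qed
  qed
qed

end

locale ptolemy_polygon = polygon_frame N P e x
  for N P e :: nat and x :: "nat set \<Rightarrow> 'f::field" +
  assumes PN: "P = N" and e1: "e = 1"
    and ptolemy: "i < j \<Longrightarrow> j < k \<Longrightarrow> k < l \<Longrightarrow> l < i + N \<Longrightarrow> X i k * X j l = X i j * X k l + X i l * X j k"
begin

lemma mult_1: "mult a b = 1"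
  unfolding mult_def by (simp add: e1)

lemma ne: "i < j \<Longrightarrow> j < i + N \<Longrightarrow> i mod N \<noteq> j mod N"
  using add_mod_ne[of "j - i" i] by auto

lemma straight:
  assumes emb: "field_embedding \<iota>" and ord: "i < j" "j < k" "k < l" "l < i + N"
  shows "straight \<iota> (X i k) (X j l)"
  by (rule straight_ptolemy[OF emb ord]) (simp_all only: mult_1 power_one_right ptolemy[OF ord])

text \<open>Exchange relation of the quadrilateral on the boundary edges at \<open>a\<close> and
  \<open>a + g\<close>. Boundary edges cross nothing and the other two sides are nested, so the
  product of the diagonals is the only nonstandard monomial.\<close>

lemma separated_wall:
  fixes \<iota> :: "'k::field \<Rightarrow> 'f"
  assumes emb: "field_embedding \<iota>" and g: "2 \<le> g" "g \<le> N div 2"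
  shows "separated_wall \<iota> a g"
proof -
  let ?j = "Suc a" and ?k = "a + g" and ?l = "Suc (a + g)"
  have ord: "a < ?j" "?j < ?k" "?k < ?l" "?l < a + N" using g N by auto
  let ?m0 = "pair_monomial (X a ?k) (X ?j ?l)" and ?m1 = "pair_monomial (X a ?j) (X ?k ?l)"
    and ?m2 = "pair_monomial (X a ?l) (X ?j ?k)"
  have "\<not> standard inc ?m0" using inc_crossing[OF ord] by (auto simp: standard_def keys_add_nat)
  moreover have "standard inc ?m1"
    using not_inc_edge[of a] not_inc_edge[of "a + g"] by (auto simp: standard_def keys_add_nat)
  moreover have "standard inc ?m2"
  proof -
    have "\<not> inc v v" if "v = X c d" "c < d" "d < c + N" for v c d
    proof
      assume "inc v v"
      from X_of_inc[of c d c d] this that ne[of c d]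
      show False using not_crossing_self[of N "seg N c d"] by (simp add: PN)
    qed
    from this[of _ a ?l] this[of _ ?j ?k] show ?thesis
      using ord not_inc_nested[OF g, of a] inc_sym by (auto simp: standard_def keys_add_nat)
  qed
  moreover have "keys ?m0 \<subseteq> vars \<and> keys ?m1 \<subseteq> vars \<and> keys ?m2 \<subseteq> vars"
    using ord ne[of a ?k] ne[of ?j ?l] ne[of a ?j] ne[of ?k ?l] ne[of a ?l] ne[of ?j ?k]
    by (simp add: keys_add_nat X_vars)
  moreover have "presentation \<iota> (single ?m0 1) =
      presentation \<iota> (single ?m1 1) + presentation \<iota> (single ?m2 1)"
    using ptolemy[OF ord] by (simp only: presentation_single_add[OF emb] presentation_single_single[OF emb] power_one_right)
  moreover have "wall a (a + g) \<omega> = 1 * (weight \<omega> ?m0 - weight \<omega> ?m2)" for \<omega>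
    by (simp add: wall_def W_def mult_1)
  ultimately show ?thesis by (rule separated_wallI[OF zero_less_one])
qed

end

section \<open>Straightening relations: types B and C\<close>

text \<open>Types B and C, with \<open>r = 1\<close> resp. \<open>r = 2\<close>. Choosing a vertex \<open>a\<close> and writing \<open>s i\<close>, \<open>t i\<close> for the
  variables of \<open>[a, i]\<close> and \<open>[i, a']\<close> with the antipode \<open>a'\<close> of \<open>a\<close>, all other variables become
  polynomials in \<open>s\<close>, \<open>t\<close> divided by the element \<open>U\<close> of \<open>[a, a']\<close>. The number \<open>\<tau>\<close> is
  the trace of the monodromy around the centre of the polygon.\<close>

locale symmetric_polygon = polygon_frame N P e x
  for N P e :: nat and x :: "nat set \<Rightarrow> 'f::field" +
  fixes r :: nat and \<tau> :: 'f
  assumes NP: "N = 2 * P" and re: "r = 1 \<and> e = 2 \<and> \<tau> = 2 \<or> r = 2 \<and> e = 1 \<and> \<tau> = 0"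
    and X_nonzero: "a mod N \<noteq> b mod N \<Longrightarrow> X a b \<noteq> 0"
    and rel1: "i < j \<Longrightarrow> j < k \<Longrightarrow> k < l \<Longrightarrow> l < i + P \<Longrightarrow> X i k * X j l = X i j * X k l + X i l * X j k"
    and rel2: "i < j \<Longrightarrow> j < k \<Longrightarrow> k < i + P \<Longrightarrow>
      X i k * X j (i + P) = X i j * X k (i + P) + X i (i + P) ^ e * X j k"
    and rel3: "i < j \<Longrightarrow> j < i + P \<Longrightarrow> X i (i + P) * X j (j + P) = X i j ^ r + X j (i + P) ^ r"
begin

lemma ne: "i < j \<Longrightarrow> j < i + N \<Longrightarrow> i mod N \<noteq> j mod N"
  using add_mod_ne[of "j - i" i] by auto

lemma NPs: "N \<le> 2 * P" "2 * P \<le> N"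
  by (simp_all add: NP)

lemma P2le: "2 \<le> P"
  using N NP by simp

lemma mult_diameter: "mult i (i + P) = e"
  by (simp add: mult_def)

lemma mult_short: "i < j \<Longrightarrow> j < i + P \<Longrightarrow> mult i j = 1"
proof -
  assume ij: "i < j" "j < i + P"
  have "(i + P) mod N \<noteq> j mod N" using ne[of j "i + P"] ij NPs by auto
  then show ?thesis by (simp add: mult_def)
qed

lemma mult_long: "i + P < j \<Longrightarrow> j < i + N \<Longrightarrow> mult i j = 1"
proof -
  assume ij: "i + P < j" "j < i + N"
  have "(i + P) mod N \<noteq> j mod N" using ne[of "i + P" j] ij by auto
  then show ?thesis by (simp add: mult_def)
qed

lemma X_antipodal: "i < j \<Longrightarrow> j < i + N \<Longrightarrow> X (i + P) (j + P) = X i j"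
  by (intro X_shift ne)

lemma W_antipodal: "i < j \<Longrightarrow> j < i + N \<Longrightarrow> W \<omega> (i + P) (j + P) = W \<omega> i j"
  by (intro W_shift ne)

lemma X_opposite: "i < j \<Longrightarrow> j < i + P \<Longrightarrow> X j (i + P) = X i (j + P)"
proof -
  assume ij: "i < j" "j < i + P"
  have "X i (j + P) = X (i + P) (j + P + P)" using X_antipodal[of i "j + P"] ij NPs by simp
  also have "\<dots> = X j (i + P)" by (subst X_commute) (rule X_cong, simp_all add: P2)
  finally show ?thesis by simp
qed

lemma W_opposite: "i < j \<Longrightarrow> j < i + P \<Longrightarrow> W \<omega> j (i + P) = W \<omega> i (j + P)"
proof -
  assume ij: "i < j" "j < i + P"
  have "W \<omega> i (j + P) = W \<omega> (i + P) (j + P + P)" using W_antipodal[of i "j + P"] ij NPs by simp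
  also have "\<dots> = W \<omega> j (i + P)" by (subst W_commute) (rule W_cong, simp_all add: P2)
  finally show ?thesis by simp
qed

text \<open>This determines \<open>\<tau>\<close>: \<open>(s ^ r + t ^ r) ^ e\<close> equals
  \<open>s ^ 2 + t ^ 2 + \<tau> * s * t\<close> both for \<open>r = 1\<close>, \<open>e = 2\<close>,
  \<open>\<tau> = 2\<close> and for \<open>r = 2\<close>, \<open>e = 1\<close>,
  \<open>\<tau> = 0\<close>.\<close>

lemma diameter_eq:
  assumes "a < j" "j < a + P"
  shows "X a (a + P) ^ e * X j (j + P) ^ e =
    X a j ^ 2 + X j (a + P) ^ 2 + \<tau> * X a j * X j (a + P)"
proof -
  have "X a (a + P) ^ e * X j (j + P) ^ e = (X a j ^ r + X j (a + P) ^ r) ^ e"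
    using rel3[OF assms] by (metis power_mult_distrib)
  then show ?thesis using re by (auto simp: power2_sum)
qed

lemma short_eq:
  assumes "a < i" "i < j" "j < a + P"
  shows "X a (a + P) ^ e * X i j = X a j * X i (a + P) - X a i * X j (a + P)"
  using rel2[OF assms] by simp

text \<open>The relation \<open>rel2\<close> based at \<open>j\<close> expresses the segment through
  the diameter of \<open>j\<close>. Multiplied by \<open>?U\<close>, everything becomes polynomial
  in \<open>?s\<close> and \<open>?t\<close>, and the factor \<open>?t j\<close> cancels.\<close>

lemma wrapped_eq:
  assumes "a < j" "j < i" "i < a + P"
  shows "X a (a + P) ^ e * X i (j + P) =
    X a i * X a j + X i (a + P) * X j (a + P) + \<tau> * X a j * X i (a + P)"
proof -
  let ?U = "X a (a + P) ^ e" and ?s = "X a" and ?t = "\<lambda>i. X i (a + P)"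
  have "X j (a + P) * X i (j + P) = X j i * X (a + P) (j + P) + X j (j + P) ^ e * X i (a + P)"
    using assms by (intro rel2) auto
  moreover have "X (a + P) (j + P) = ?s j" using assms NPs by (intro X_antipodal) auto
  ultimately have "?U * (?t j * X i (j + P)) = (?U * X j i) * ?s j + (?U * X j (j + P) ^ e) * ?t i"
    by (simp add: distrib_left mult_ac)
  also have "\<dots> = (?s i * ?t j - ?s j * ?t i) * ?s j + (?s j ^ 2 + ?t j ^ 2 + \<tau> * ?s j * ?t j) * ?t i"
    using short_eq[of a j i] diameter_eq[of a j] assms by simp
  also have "\<dots> = ?t j * (?s i * ?s j + ?t i * ?t j + \<tau> * ?s j * ?t i)"
    by (simp add: algebra_simps power2_eq_square)
  finally have "?t j * (?U * X i (j + P)) = ?t j * (?s i * ?s j + ?t i * ?t j + \<tau> * ?s j * ?t i)"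
    by (simp add: mult_ac)
  moreover have "?t j \<noteq> 0" using assms NPs by (intro X_nonzero ne) auto
  ultimately show ?thesis by simp
qed

text \<open>Two segments of which each crosses both the other one and its antipode are incompatible, but
  not exchangeable, so this is not one of the exchange relations.\<close>

lemma four_terms:
  assumes "i < m" "m < j" "j < k" "k < i + P"
  shows "X i k * X j (m + P) =
    X i j * X k (m + P) + X i (m + P) * X j k + \<tau> * (X i m * X j k)"
proof -
  let ?U = "X i (i + P) ^ e"
  have U: "?U \<noteq> 0" using X_nonzero[OF ne[of i "i + P"]] P2le NPs by simp
  have "?U * (X i k * X j (m + P)) = X i k * (?U * X j (m + P))" by (simp add: mult_ac)
  also have "\<dots> = X i k * (X i j * X i m + X j (i + P) * X m (i + P) + \<tau> * X i m * X j (i + P))"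
    using wrapped_eq[of i m j] assms by simp
  \<comment> \<open>Regrouped so that \<open>wrapped_eq\<close> for \<open>[k, m + P]\<close> and
    \<open>short_eq\<close> for \<open>[j, k]\<close> can be read backwards.\<close>
  also have "\<dots> = X i j * (X i k * X i m + X k (i + P) * X m (i + P) + \<tau> * X i m * X k (i + P))
      + X m (i + P) * (X i k * X j (i + P) - X i j * X k (i + P))
      + \<tau> * (X i m * (X i k * X j (i + P) - X i j * X k (i + P)))"
    by (simp add: algebra_simps)
  also have "\<dots> = X i j * (?U * X k (m + P)) + X m (i + P) * (?U * X j k) + \<tau> * (X i m * (?U * X j k))"
    using wrapped_eq[of i m k] short_eq[of i j k] assms by simp
  also have "\<dots> = ?U * (X i j * X k (m + P) + X i (m + P) * X j k + \<tau> * (X i m * X j k))"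
    using X_opposite[of i m] assms by (simp add: algebra_simps)
  finally show ?thesis using mult_left_cancel[OF U] by blast
qed

text \<open>The extra monomial of \<open>four_terms\<close> is not a pair of sides of the
  quadrilateral \<open>i, j, k, m + P\<close>; its inequality is derived by way of the diameter at
  \<open>m\<close>.\<close>

lemma four_terms_weight:
  assumes st: "strict \<omega>" and ord: "i < m" "m < j" "j < k" "k < i + P"
  shows "W \<omega> i m + W \<omega> j k < W \<omega> i k + W \<omega> j (m + P)"
proof -
  let ?l = "m + P"
  have l: "?l < i + N" "?l < m + N" "i + P < ?l" using ord NPs by auto
  have "W \<omega> m k + W \<omega> (i + P) ?l < W \<omega> m (i + P) + W \<omega> k ?l"
    using ord l by (intro four_point2[OF st]) auto
  moreover have "W \<omega> (i + P) ?l = W \<omega> i m" using ord NPs by (intro W_antipodal) auto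
  moreover have "W \<omega> m (i + P) = W \<omega> i ?l" using ord by (intro W_opposite) auto
  moreover have "W \<omega> i ?l + W \<omega> m k < W \<omega> i k + W \<omega> m ?l" "W \<omega> i m + W \<omega> k ?l < W \<omega> i k + W \<omega> m ?l"
    using ord l by (intro four_point1[OF st] four_point2[OF st]; simp)+
  moreover have "W \<omega> m ?l + W \<omega> j k < W \<omega> m k + W \<omega> j ?l"
    using ord l by (intro four_point1[OF st]) auto
  \<comment> \<open>Add the four inequalities, the last one with factor 2, and halve.\<close>
  ultimately show ?thesis by linarith
qed

text \<open>In type C this is \<open>wrapped_eq\<close> itself. In type B that relation contains the
  square of the diameter; one factor is divided out by means of \<open>rel3\<close>, whose right
  side is linear there.\<close>

lemma straight_diameter:
  fixes \<iota> :: "'k::field \<Rightarrow> 'f"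
  assumes emb: "field_embedding \<iota>" and ord: "i < m" "m < j" "j < i + P"
  shows "straight \<iota> (X i (i + P)) (X j (m + P))"
proof -
  let ?k = "i + P" and ?l = "m + P"
  have o4: "i < j" "j < ?k" "?k < ?l" "?l < i + N" using ord NPs by auto
  have opp: "X i ?l = X m ?k" using X_opposite[of i m] ord by simp
  have ant: "X ?k ?l = X i m" using X_antipodal[of i m] ord NPs by simp
  have wr: "X i ?k ^ e * X j ?l = X i j * X i m + X j ?k * X m ?k + \<tau> * X i m * X j ?k"
    using wrapped_eq[of i m j] ord by simp
  from re consider "e = 1" "\<tau> = 0" | "e = 2" "\<tau> = 2" "r = 1" by auto
  then show ?thesis
  proof cases
    case 1
    have m1: "mult a b = 1" for a b unfolding mult_def by (simp add: 1(1))
    have wr1: "X i ?k * X j ?l = X i j * X i m + X j ?k * X m ?k"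
      using wr unfolding 1 by simp
    show ?thesis
      by (rule straight_ptolemy[OF emb o4]) (simp_all only: m1 power_one_right wr1 opp ant mult.commute)
  next
    case 2
    have d: "X i ?k * X j (j + P) = X i j + X j ?k" "X i ?k * X m ?l = X i m + X m ?k"
      using rel3[of i j] rel3[of i m] ord 2 by auto
    \<comment> \<open>The two copies of the mixed term are distributed so that the right side
      becomes a sum of two products, each with a factor to which \<open>rel3\<close>
      applies.\<close>
    have "X i ?k * (X i ?k * X j ?l) = (X i ?k * X j (j + P)) * X i m + (X i ?k * X m ?l) * X j ?k"
      using wr unfolding d 2 by (simp add: algebra_simps power2_eq_square)
    then have "X i ?k * (X i ?k * X j ?l) = X i ?k * (X j (j + P) * X i m + X m ?l * X j ?k)"
      by (simp add: algebra_simps)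
    moreover have "X i ?k \<noteq> 0" using ne[of i ?k] o4 X_nonzero by auto
    ultimately have eq: "X i ?k * X j ?l = X j (j + P) * X i m + X m ?l * X j ?k" by simp
    have lk: "real e * lookup \<omega> (X c (c + P)) = W \<omega> c (c + P)" for \<omega> c
      unfolding W_def mult_diameter ..
    have e2: "real e = 2" by (simp add: 2)
    have lk2: "lookup \<omega> (X c (c + P)) = W \<omega> c (c + P) / 2" for \<omega> c
      using lk[of \<omega> c] unfolding e2 by simp
    have sh: "mult j ?l = 1" "mult i m = 1" "mult j ?k = 1"
      using mult_short[of j ?l] mult_short[of i m] mult_short[of j ?k] ord by auto
    have lk': "lookup \<omega> (X j ?l) = W \<omega> j ?l" "lookup \<omega> (X i m) = W \<omega> i m"
      "lookup \<omega> (X j ?k) = W \<omega> j ?k" for \<omega>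
      by (simp_all add: W_def sh)
    let ?ms = "[pair_monomial (X j (j + P)) (X i m), pair_monomial (X m ?l) (X j ?k)]"
    show ?thesis
    proof (rule straightI[OF emb, where ms = ?ms])
      show "X i ?k * X j ?l = (\<Sum>a\<leftarrow>?ms. presentation \<iota> (single a 1))"
        unfolding eq
        by (simp only: list.map sum_list.Cons sum_list.Nil presentation_single_add[OF emb]
            presentation_single_single[OF emb] power_one_right add_0_right)
      fix a assume a: "a \<in> set ?ms"
      have vars: "X j (j + P) \<in> vars" "X i m \<in> vars" "X m ?l \<in> vars" "X j ?k \<in> vars"
        using ord NPs P2le by - ((rule X_vars, rule ne); linarith)+
      have deg: "lookup degree_vector (X c (c + P)) = 1" for c
      proof -
        have "W degree_vector c (c + P) = real e"
          using NPs P2le by - ((rule W_degree_vector, rule ne); linarith)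
        then show ?thesis using lk[of degree_vector c] e by simp
      qed
      have deg': "W degree_vector j ?l = real e" "W degree_vector i m = real e" "W degree_vector j ?k = real e"
        using ord NPs by - ((rule W_degree_vector, rule ne); linarith)+
      \<comment> \<open>The inequalities are doubled, because the weight of a diameter is half of
        its \<open>W\<close> in type B.\<close>
      have wt: "W \<omega> j (j + P) + 2 * W \<omega> i m < W \<omega> i ?k + 2 * W \<omega> j ?l \<and>
          W \<omega> m ?l + 2 * W \<omega> j ?k < W \<omega> i ?k + 2 * W \<omega> j ?l" if st: "strict \<omega>" for \<omega>
      proof -
        have "W \<omega> j (j + P) + W \<omega> ?k ?l < W \<omega> j ?l + W \<omega> ?k (j + P)"
          using ord NPs four_point1[OF st, of j ?k ?l "j + P"] by auto
        moreover have "W \<omega> i j + W \<omega> ?k ?l < W \<omega> i ?k + W \<omega> j ?l" "W \<omega> i ?l + W \<omega> j ?k < W \<omega> i ?k + W \<omega> j ?l"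
          using four_point1[OF st o4] four_point2[OF st o4] by auto
        moreover have "W \<omega> m ?l + W \<omega> j ?k < W \<omega> m ?k + W \<omega> j ?l"
          using ord NPs by (intro four_point1[OF st]) auto
        moreover have "W \<omega> ?k ?l = W \<omega> i m" "W \<omega> ?k (j + P) = W \<omega> i j" "W \<omega> m ?k = W \<omega> i ?l"
          using W_antipodal[of i m] W_antipodal[of i j] W_opposite[of i m] ord NPs by auto
        ultimately show ?thesis by linarith
      qed
      show "keys a \<subseteq> vars \<and>
          weight degree_vector a = lookup degree_vector (X i ?k) + lookup degree_vector (X j ?l) \<and>
          (\<forall>\<omega>. strict \<omega> \<longrightarrow> weight \<omega> a < lookup \<omega> (X i ?k) + lookup \<omega> (X j ?l))"
      proof (intro conjI allI impI)
        show "keys a \<subseteq> vars" using a vars by (auto simp: keys_add_nat)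
        show "weight degree_vector a = lookup degree_vector (X i ?k) + lookup degree_vector (X j ?l)"
          using a deg[of i] deg[of j] deg[of m] deg' by (auto simp: lk')
        fix \<omega> assume "strict \<omega>"
        from wt[OF this] show "weight \<omega> a < lookup \<omega> (X i ?k) + lookup \<omega> (X j ?l)"
          using a by (auto simp: lk' lk2)
      qed
    qed
  qed
qed

lemma straight_diameters:
  fixes \<iota> :: "'k::field \<Rightarrow> 'f"
  assumes emb: "field_embedding \<iota>" and ord: "i < j" "j < i + P"
  shows "straight \<iota> (X i (i + P)) (X j (j + P))"
proof -
  let ?k = "i + P" and ?l = "j + P"
  have o4: "i < j" "j < ?k" "?k < ?l" "?l < i + N" using ord NPs by auto
  let ?ms = "[single (X i j) r, single (X j ?k) r]"
  \<comment> \<open>Multiplied by \<open>e\<close>, the weight of an \<open>r\<close>-th power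
    becomes \<open>2 * W\<close> and that of a diameter becomes \<open>W\<close>.\<close>
  have er: "real e * real r = 2" using re by auto
  have e0: "0 < real e" using e by simp
  have lk: "real e * lookup \<omega> (X c (c + P)) = W \<omega> c (c + P)" for \<omega> c
    by (simp add: W_def mult_diameter)
  have lk': "lookup \<omega> (X i j) = W \<omega> i j" "lookup \<omega> (X j ?k) = W \<omega> j ?k" for \<omega>
    using mult_short[of i j] mult_short[of j ?k] ord by (simp_all add: W_def)
  show ?thesis
  proof (rule straightI[OF emb, where ms = ?ms])
    show "X i ?k * X j ?l = (\<Sum>a\<leftarrow>?ms. presentation \<iota> (single a 1))"
      unfolding rel3[OF ord] by (simp add: presentation_single_single[OF emb] del: One_nat_def)
    fix a assume a: "a \<in> set ?ms"
    have vars: "X i j \<in> vars" "X j ?k \<in> vars"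
      using ord NPs by - ((rule X_vars, rule ne); linarith)+
    have "real e * weight degree_vector a = 2 * real e"
    proof -
      have "W degree_vector i j = real e" "W degree_vector j ?k = real e"
        using ord NPs by - ((rule W_degree_vector, rule ne); linarith)+
      then have "weight degree_vector a = real r * real e" using a by (auto simp: lk')
      then show ?thesis using er by (simp add: mult_ac) 
    qed
    moreover have "real e * lookup degree_vector (X c (c + P)) = real e" for c
      using lk[of degree_vector c] W_degree_vector[OF ne[of c "c + P"]] P2le NPs by simp
    ultimately have "real e * weight degree_vector a =
        real e * (lookup degree_vector (X i ?k) + lookup degree_vector (X j ?l))"
      by (simp only: distrib_left)
    then have deg: "weight degree_vector a = lookup degree_vector (X i ?k) + lookup degree_vector (X j ?l)"
      using e0 by simp
    moreover have "weight \<omega> a < lookup \<omega> (X i ?k) + lookup \<omega> (X j ?l)"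
      if st: "strict \<omega>" for \<omega>
    proof -
      have "W \<omega> i j + W \<omega> ?k ?l < W \<omega> i ?k + W \<omega> j ?l" "W \<omega> i ?l + W \<omega> j ?k < W \<omega> i ?k + W \<omega> j ?l"
        using four_point1[OF st o4] four_point2[OF st o4] by auto
      moreover have "W \<omega> ?k ?l = W \<omega> i j" "W \<omega> j ?k = W \<omega> i ?l"
        using W_antipodal[of i j] W_opposite[of i j] ord NPs by auto
      ultimately have w: "2 * W \<omega> i j < W \<omega> i ?k + W \<omega> j ?l" "2 * W \<omega> j ?k < W \<omega> i ?k + W \<omega> j ?l" by linarith+
      have "real e * weight \<omega> a = 2 * W \<omega> i j \<or> real e * weight \<omega> a = 2 * W \<omega> j ?k"
        using a er by (auto simp: lk' simp flip: mult.assoc)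
      then have "real e * weight \<omega> a < real e * (lookup \<omega> (X i ?k) + lookup \<omega> (X j ?l))"
        using w by (auto simp: distrib_left lk)
      then show ?thesis using e0 by simp
    qed
    ultimately show "keys a \<subseteq> vars \<and>
        weight degree_vector a = lookup degree_vector (X i ?k) + lookup degree_vector (X j ?l) \<and>
        (\<forall>\<omega>. strict \<omega> \<longrightarrow> weight \<omega> a < lookup \<omega> (X i ?k) + lookup \<omega> (X j ?l))"
      using a vars by (auto split: if_splits)
  qed
qed

text \<open>Neither segment spans more than half of the polygon. If \<open>l\<close> lies before or
  at the antipode of \<open>i\<close>, an exchange relation applies. Beyond it,
  \<open>m = l - P\<close> satisfies \<open>i < m \<le> j\<close>, and \<open>four_terms\<close> or
  one of the lemmas on diameters takes over.\<close>

lemma straight_normalized: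
  fixes \<iota> :: "'k::field \<Rightarrow> 'f"
  assumes emb: "field_embedding \<iota>" and ord: "i < j" "j < k" "k < l" "k \<le> i + P" "l \<le> j + P"
  shows "straight \<iota> (X i k) (X j l)"
proof -
  have o4: "i < j" "j < k" "k < l" "l < i + N" using ord NPs by auto
  note fp = four_point1[OF _ o4] four_point2[OF _ o4]
  have nes: "i mod N \<noteq> j mod N" "k mod N \<noteq> l mod N" "i mod N \<noteq> l mod N" "j mod N \<noteq> k mod N"
    "i mod N \<noteq> k mod N" "j mod N \<noteq> l mod N"
    using o4 by - (rule ne; linarith)+
  consider (1) "l < i + P" | (2) "l = i + P" | (3) "i + P < l" by linarith
  then show ?thesis
  proof cases
    case 1
    have m: "mult i j = 1" "mult k l = 1" "mult i l = 1" "mult j k = 1" "mult i k = 1" "mult j l = 1"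
      using ord 1 by - (rule mult_short; linarith)+
    have "X i k * X j l = X i j * X k l + X i l * X j k" using ord 1 by (intro rel1)
    then show ?thesis by (intro straight_ptolemy[OF emb o4]) (simp_all only: m power_one_right)
  next
    case 2
    have m: "mult i j = 1" "mult k l = 1" "mult j k = 1" "mult i k = 1" "mult j l = 1"
      using ord 2 by - (rule mult_short; linarith)+
    have "mult i l = e" unfolding 2 by (rule mult_diameter)
    moreover have "X i k * X j l = X i j * X k l + X i l ^ e * X j k"
      unfolding 2 using ord 2 by (intro rel2) auto
    ultimately show ?thesis by (intro straight_ptolemy[OF emb o4]) (simp_all only: m power_one_right)
  next
    case 3
    define m where "m = l - P"
    have lm: "l = m + P" "i < m" "m \<le> j" using 3 ord by (auto simp: m_def)
    consider (a) "k < i + P" "m < j" | (b) "k = i + P" "m = j" | (c) "k = i + P" "m < j" | (d) "k < i + P" "m = j"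
      using ord lm by linarith
    then show ?thesis
    proof cases
      case a
      have ms: "mult i j = 1" "mult k l = 1" "mult j k = 1" "mult i k = 1" "mult j l = 1" "mult i m = 1"
        using ord a lm 3 by - (rule mult_short; linarith)+
      have ms': "mult i l = 1" using o4 3 by - (rule mult_long; linarith)
      have im: "i mod N \<noteq> m mod N" using lm a ord NPs by - (rule ne; linarith)
      have w4: "strict \<omega> \<Longrightarrow> W \<omega> i m + W \<omega> j k < W \<omega> i k + W \<omega> j l" for \<omega>
        using four_terms_weight[of \<omega> i m j k] lm a ord by simp
      have eq: "X i k * X j l = X i j * X k l + X i l * X j k + \<tau> * (X i m * X j k)"
        using four_terms[of i m j k] lm a ord by simp
      \<comment> \<open>As \<open>\<tau>\<close> is 0 or 2, the last term is absent or occurs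
        twice.\<close>
      let ?ts = "[(i, j, k, l), (i, l, j, k)] @ (if \<tau> = 0 then [] else [(i, m, j, k), (i, m, j, k)])"
      show ?thesis
      proof (rule straight_quadratic[OF emb, where ts = ?ts])
        show "X i k * X j l = (\<Sum>(a, b, c, d)\<leftarrow>?ts. X a b ^ mult a b * X c d ^ mult c d)"
          unfolding eq using re by (auto simp: ms ms')
        fix a b c d assume "(a, b, c, d) \<in> set ?ts"
        then show "a mod N \<noteq> b mod N \<and> c mod N \<noteq> d mod N \<and>
            (\<forall>\<omega>. strict \<omega> \<longrightarrow> W \<omega> a b + W \<omega> c d < W \<omega> i k + W \<omega> j l)"
          using nes fp w4 im by (auto split: if_splits)
      qed (use nes ms in auto)
    next
      case b
      then show ?thesis using straight_diameters[OF emb, of i j] ord lm by simp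
    next
      case c
      then show ?thesis using straight_diameter[OF emb, of i m j] ord lm by simp
    next
      case d
      have "straight \<iota> (X j (j + P)) (X (i + P) (k + P))"
        using ord d by (intro straight_diameter[OF emb]) auto
      moreover have "X (i + P) (k + P) = X i k" using ord d NPs by (intro X_antipodal) auto
      ultimately show ?thesis using d lm straight_sym by simp
    qed
  qed
qed

text \<open>Any crossing pair reaches the normalized position by interchanging the two segments or
  continuing endpoints past \<open>N\<close>.\<close>

lemma straight:
  fixes \<iota> :: "'k::field \<Rightarrow> 'f"
  assumes emb: "field_embedding \<iota>" and ord: "i < j" "j < k" "k < l" "l < i + N"
  shows "straight \<iota> (X i k) (X j l)"
proof -
  have X_N: "X (a + N) b = X a b" "X a (b + N) = X a b" for a b by (auto intro: X_cong)
  consider "k \<le> i + P" "l \<le> j + P" | "k \<le> i + P" "j + P \<le> l" | "i + P \<le> k" "l \<le> j + P" | "i + P \<le> k" "j + P \<le> l"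
    by linarith
  then show ?thesis
  proof cases
    case 1
    then show ?thesis using straight_normalized[OF emb, of i j k l] ord by simp
  next
    case 2
    then have "straight \<iota> (X l (j + N)) (X (i + N) (k + N))"
      using ord NPs by (intro straight_normalized[OF emb]) auto
    then show ?thesis using straight_sym by (simp add: X_N X_commute)
  next
    case 3
    then have "straight \<iota> (X j l) (X k (i + N))"
      using ord NPs by (intro straight_normalized[OF emb]) auto
    then show ?thesis using straight_sym by (simp add: X_N X_commute)
  next
    case 4
    then have "straight \<iota> (X k (i + N)) (X l (j + N))"
      using ord NPs by (intro straight_normalized[OF emb]) auto
    then show ?thesis by (simp add: X_N X_commute)
  qed
qed

lemma not_inc_self: "c < d \<Longrightarrow> d < c + N \<Longrightarrow> \<not> inc (X c d) (X c d)"
proof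
  assume cd: "c < d" "d < c + N" and inc: "inc (X c d) (X c d)"
  have cr: "crossing N (seg N c d) (rot N P (seg N c d))"
    using X_of_inc[OF inc ne[OF cd] ne[OF cd]] not_crossing_self by (auto simp: rot_seg)
  then show False
    using not_crossing_antipodal[of "seg N c d" P] crossing_diagonals(1)[OF cr] NPs by simp
qed

lemma separated_wall:
  fixes \<iota> :: "'k::field \<Rightarrow> 'f"
  assumes emb: "field_embedding \<iota>" and g: "2 \<le> g" "g \<le> N div 2"
  shows "separated_wall \<iota> a g"
proof -
  let ?j = "Suc a" and ?k = "a + g" and ?l = "Suc (a + g)"
  have gP: "g \<le> P" using g NPs by simp
  have ord: "a < ?j" "?j < ?k" "?k < ?l" "?l < a + N" using g N NPs P2le by auto
  have nes: "a mod N \<noteq> ?j mod N" "?k mod N \<noteq> ?l mod N" "a mod N \<noteq> ?l mod N" "?j mod N \<noteq> ?k mod N"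
    "a mod N \<noteq> ?k mod N" "?j mod N \<noteq> ?l mod N"
    using ord by - (rule ne; linarith)+
  let ?m0 = "pair_monomial (X a ?k) (X ?j ?l)"
  have m0: "\<not> standard inc ?m0" using inc_crossing[OF ord] by (auto simp: standard_def keys_add_nat)
  have self: "\<not> inc (X a ?l) (X a ?l)" "\<not> inc (X ?j ?k) (X ?j ?k)" using ord by - (rule not_inc_self; linarith)+
  show ?thesis
  proof (cases "g = P")
    case False
    let ?m1 = "pair_monomial (X a ?j) (X ?k ?l)" and ?m2 = "mono1 a ?l + mono1 ?j ?k"
    have m: "mult ?j ?k = 1" "mult a ?k = 1" "mult ?j ?l = 1"
      using ord False gP by - (rule mult_short; linarith)+
    have "standard inc ?m1"
      using not_inc_edge[of a] not_inc_edge[of "a + g"] by (auto simp: standard_def keys_add_nat)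
    moreover have "standard inc ?m2"
      using ord not_inc_nested[OF g, of a] inc_sym self by (auto simp: standard_def keys_add_nat split: if_splits)
    moreover have "keys ?m0 \<subseteq> vars \<and> keys ?m1 \<subseteq> vars \<and> keys ?m2 \<subseteq> vars"
      using nes by (simp add: keys_add_nat X_vars)
    \<comment> \<open>The side \<open>[a, a + g + 1]\<close> may be a diameter; then
      \<open>rel2\<close> takes the place of \<open>rel1\<close>.\<close>
    moreover have "X a ?k * X ?j ?l = X a ?j * X ?k ?l + X a ?l ^ mult a ?l * X ?j ?k"
    proof (cases "?l = a + P")
      case True
      then show ?thesis
        using rel2[of a ?j ?k, folded True] mult_diameter[of a, folded True] ord by simp
    next
      case F: False
      then have "?l < a + P" using False gP by simp
      then show ?thesis using rel1[of a ?j ?k ?l] ord mult_short[of a ?l] by simp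
    qed
    then have "presentation \<iota> (single ?m0 1) =
        presentation \<iota> (single ?m1 1) + presentation \<iota> (single ?m2 1)"
      by (simp only: presentation_single_add[OF emb] presentation_single_single[OF emb] power_one_right m)
    moreover have "wall a (a + g) \<omega> = 1 * (weight \<omega> ?m0 - weight \<omega> ?m2)" for \<omega>
      by (simp add: wall_def W_def m)
    ultimately show ?thesis using m0 by (intro separated_wallI[OF zero_less_one])
  next
    case True
    \<comment> \<open>For \<open>g = P\<close> the diagonals are diameters and opposite sides are
      antipodal, so \<open>rel3\<close> has powers instead of products. The factor \<open>e\<close>
      turns its weights into those of the wall.\<close>
    let ?m1 = "single (X a ?j) r" and ?m2 = "single (X ?j ?k) r"
    have m: "mult ?j ?k = 1" "mult a ?k = e" "mult ?j ?l = e"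
      using mult_diameter[of a] mult_diameter[of ?j] mult_short[of ?j ?k] ord True by auto
    have rp: "0 < r" using re by auto
    have "standard inc ?m1" using not_inc_edge[of a] by (auto simp: standard_def split: if_splits)
    moreover have "standard inc ?m2" using self by (auto simp: standard_def split: if_splits)
    moreover have "keys ?m0 \<subseteq> vars \<and> keys ?m1 \<subseteq> vars \<and> keys ?m2 \<subseteq> vars"
      using nes by (simp add: keys_add_nat X_vars)
    moreover have "X a ?k * X ?j ?l = X a ?j ^ r + X ?j ?k ^ r"
      using rel3[of a ?j] ord True by simp
    then have "presentation \<iota> (single ?m0 1) =
        presentation \<iota> (single ?m1 1) + presentation \<iota> (single ?m2 1)"
      by (simp only: presentation_single_add[OF emb] presentation_single_single[OF emb] power_one_right)
    moreover have "wall a (a + g) \<omega> = real e * (weight \<omega> ?m0 - weight \<omega> ?m2)" for \<omega>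
    proof -
      have opp: "W \<omega> a ?l = W \<omega> ?j ?k" using W_opposite[of a ?j] True ord by simp
      have er: "real e * (real r * z) = 2 * z" for z using re by auto
      have lk: "lookup \<omega> (X ?j ?k) = W \<omega> ?j ?k" unfolding W_def m by simp
      have lk0: "real e * lookup \<omega> (X a ?k) = W \<omega> a ?k"
        "real e * lookup \<omega> (X ?j ?l) = W \<omega> ?j ?l" unfolding W_def m by simp_all
      have "real e * (weight \<omega> ?m0 - weight \<omega> ?m2) =
          real e * lookup \<omega> (X a ?k) + real e * lookup \<omega> (X ?j ?l) -
          real e * (real r * lookup \<omega> (X ?j ?k))"
        by (simp only: weight_add weight_single of_nat_1 mult_1 right_diff_distrib distrib_left)
      then show ?thesis unfolding lk0 er lk by (simp add: wall_def opp)
    qed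
    moreover have "0 < real e" using e by simp
    ultimately show ?thesis using m0 by (intro separated_wallI)
  qed
qed

end

section \<open>Leading Laurent monomials\<close>

locale laurent_family =
  fixes \<iota> :: "'k::field \<Rightarrow> 'f::field" and Y :: "'f set" and w :: "'f \<Rightarrow> int"
  assumes emb: "field_embedding \<iota>" and finY: "finite Y" and Y0: "0 \<notin> Y"
    and independent: "finite E \<Longrightarrow> (\<And>a. a \<in> E \<Longrightarrow> keys a \<subseteq> Y) \<Longrightarrow>
      (\<Sum>a\<in>E. \<iota> (c a) * laurent Y a) = 0 \<Longrightarrow> a \<in> E \<Longrightarrow> c a = 0"
begin

definition wt :: "('f \<Rightarrow>\<^sub>0 int) \<Rightarrow> int" where
  "wt a = (\<Sum>y\<in>Y. w y * lookup a y)"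

definition ev :: "(('f \<Rightarrow>\<^sub>0 int) \<Rightarrow>\<^sub>0 'k) \<Rightarrow> 'f" where
  "ev C = (\<Sum>a\<in>keys C. \<iota> (lookup C a) * laurent Y a)"

definition below :: "int \<Rightarrow> (('f \<Rightarrow>\<^sub>0 int) \<Rightarrow>\<^sub>0 'k) set" where
  "below t = {C. \<forall>a\<in>keys C. keys a \<subseteq> Y \<and> wt a < t}"

text \<open>The leading coefficient is required to be 1, a form that is kept by products, by
  division by Laurent monomials and by adding a lighter summand.\<close>

definition leading :: "'f \<Rightarrow> ('f \<Rightarrow>\<^sub>0 int) \<Rightarrow> bool" where
  "leading f a \<longleftrightarrow> keys a \<subseteq> Y \<and> (\<exists>C\<in>below (wt a). f = laurent Y a + ev C)"

lemma wt_add [simp]: "wt (a + b) = wt a + wt b"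
  by (simp add: wt_def lookup_add distrib_left sum.distrib)

lemma wt_minus [simp]: "wt (- a) = - wt a"
  by (simp add: wt_def sum_negf)

lemma wt_diff [simp]: "wt (a - b) = wt a - wt b"
  using wt_add[of a "- b"] by simp

lemma wt_single: "y \<in> Y \<Longrightarrow> wt (single y c) = w y * c"
  using finY by (simp add: wt_def lookup_single when_def if_distrib[of "\<lambda>z. _ * z"] cong: if_cong)

lemma wt_0 [simp]: "wt 0 = 0"
  by (simp add: wt_def)

lemma laurent_0 [simp]: "laurent Y 0 = 1"
  by (simp add: laurent_def)

lemma laurent_add: "laurent Y (a + b) = laurent Y a * laurent Y b"
  unfolding laurent_def prod.distrib[symmetric]
proof (intro prod.cong refl)
  fix y assume "y \<in> Y"
  then have "y \<noteq> 0" using Y0 by auto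
  then show "y powi lookup (a + b) y = y powi lookup a y * y powi lookup b y"
    by (simp add: lookup_add power_int_add)
qed

lemma laurent_minus: "laurent Y (- a) = inverse (laurent Y a)"
  by (simp add: laurent_def power_int_minus flip: prod_inversef)

lemma laurent_nonzero: "laurent Y a \<noteq> 0"
  using laurent_add[of a "- a"] by auto

lemma laurent_single: "y \<in> Y \<Longrightarrow> laurent Y (single y (int k)) = y ^ k"
proof -
  assume y: "y \<in> Y"
  have "laurent Y (single y (int k)) = (\<Prod>z\<in>Y. if z = y then y ^ k else 1)"
    unfolding laurent_def by (intro prod.cong) (auto simp: lookup_single when_def)
  then show ?thesis using finY y by simp
qed

lemma ev_superset:
  "finite M \<Longrightarrow> keys C \<subseteq> M \<Longrightarrow> ev C = (\<Sum>a\<in>M. \<iota> (lookup C a) * laurent Y a)"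
  unfolding ev_def by (intro sum.mono_neutral_left) (auto simp: in_keys_iff field_embedding_0[OF emb])

lemma ev_single: "ev (single a c) = \<iota> c * laurent Y a"
  using ev_superset[of "{a}" "single a c"] by simp

lemma ev_0 [simp]: "ev 0 = 0"
  by (simp add: ev_def)

lemma \<iota>_simps: "\<iota> 1 = 1" "\<iota> (a + b) = \<iota> a + \<iota> b" "\<iota> (a * b) = \<iota> a * \<iota> b"
  using emb by (auto simp: field_embedding_def)

lemma ev_add: "ev (C + D) = ev C + ev D"
proof -
  let ?M = "keys C \<union> keys D"
  have "keys (C + D) \<subseteq> ?M" by (rule Poly_Mapping.keys_add)
  then show ?thesis
    by (simp add: ev_superset[of ?M] lookup_add \<iota>_simps distrib_right sum.distrib)
qed

lemma ev_sum: "ev (\<Sum>i\<in>A. C i) = (\<Sum>i\<in>A. ev (C i))"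
  by (induction A rule: infinite_finite_induct) (simp_all add: ev_add)

lemma ev_mult: "ev (C * D) = ev C * ev D"
proof -
  have "C * D = (\<Sum>a\<in>keys C. \<Sum>b\<in>keys D.
      single (a + b) (lookup C a * lookup D b))"
    by (subst mpoly_sum_terms[of C, symmetric], subst mpoly_sum_terms[of D, symmetric])
       (simp only: sum_product mult_single)
  then have "ev (C * D) = (\<Sum>a\<in>keys C. \<Sum>b\<in>keys D.
      \<iota> (lookup C a * lookup D b) * laurent Y (a + b))"
    by (simp add: ev_sum ev_single)
  also have "\<dots> = ev C * ev D"
    unfolding ev_def by (simp add: sum_product \<iota>_simps laurent_add mult_ac)
  finally show ?thesis .
qed

lemma ev_eq_0D:
  assumes "ev C = 0" "\<And>a. a \<in> keys C \<Longrightarrow> keys a \<subseteq> Y"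
  shows "C = 0"
proof (rule ccontr)
  assume "C \<noteq> 0"
  then obtain a where a: "a \<in> keys C" by (rule keys_nonempty_obtain)
  have "lookup C a = 0"
    using independent[of "keys C" "lookup C" a] assms a by (simp add: ev_def)
  with a show False by (simp add: in_keys_iff)
qed

lemma below_add: "C \<in> below t \<Longrightarrow> D \<in> below t \<Longrightarrow> C + D \<in> below t"
  unfolding below_def using Poly_Mapping.keys_add[of C D] by blast

lemma below_single: "keys a \<subseteq> Y \<Longrightarrow> wt a < t \<Longrightarrow> single a c \<in> below t"
  by (simp add: below_def)

lemma below_mono: "C \<in> below s \<Longrightarrow> s \<le> t \<Longrightarrow> C \<in> below t"
  by (force simp: below_def)

lemma keys_add_subset: "keys a \<subseteq> Y \<Longrightarrow> keys b \<subseteq> Y \<Longrightarrow> keys (a + b) \<subseteq> Y"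
  using Poly_Mapping.keys_add[of a b] by blast

lemma below_mult:
  assumes "\<And>a. a \<in> keys C \<Longrightarrow> keys a \<subseteq> Y \<and> wt a \<le> s" "D \<in> below t"
  shows "C * D \<in> below (s + t)"
  unfolding below_def
proof (intro CollectI ballI)
  fix a assume "a \<in> keys (C * D)"
  then obtain b c where bc: "b \<in> keys C" "c \<in> keys D" "a = b + c"
    using keys_mult[of C D] by blast
  moreover have "keys c \<subseteq> Y" "wt c < t" using assms(2) bc(2) by (auto simp: below_def)
  ultimately show "keys a \<subseteq> Y \<and> wt a < s + t"
    using assms(1)[OF bc(1)] keys_add_subset[of b c] by auto
qed

lemma leading_laurent: "keys a \<subseteq> Y \<Longrightarrow> leading (laurent Y a) a"
  unfolding leading_def by (intro conjI bexI[of _ 0]) (simp_all add: below_def)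

lemma leading_mult:
  assumes "leading f a" "leading g b" shows "leading (f * g) (a + b)"
proof -
  obtain C D where C: "C \<in> below (wt a)" "f = laurent Y a + ev C" and D: "D \<in> below (wt b)" "g = laurent Y b + ev D"
    and k: "keys a \<subseteq> Y" "keys b \<subseteq> Y"
    using assms by (auto simp: leading_def)
  let ?a = "single a (1::'k)" and ?b = "single b (1::'k)"
  have "f * g = laurent Y (a + b) + ev (?a * D + ?b * C + C * D)"
    by (simp add: C D ev_add ev_mult ev_single \<iota>_simps laurent_add algebra_simps)
  moreover have "?a * D \<in> below (wt (a + b))" "C * D \<in> below (wt (a + b))"
    unfolding wt_add using k C(1) D(1) by (intro below_mult; force simp: below_def)+
  moreover have "?b * C \<in> below (wt (b + a))"
    unfolding wt_add using k C(1) by (intro below_mult) auto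
  ultimately show ?thesis
    using k keys_add_subset unfolding leading_def by (metis add.commute below_add)
qed

lemma leading_div:
  assumes "leading f a" "keys b \<subseteq> Y" shows "leading (f / laurent Y b) (a - b)"
  using leading_mult[OF assms(1) leading_laurent[of "- b"]] assms(2)
  by (simp add: laurent_minus field_simps)

lemma leading_add:
  assumes "leading f a" "leading g b" "wt b < wt a" shows "leading (f + g) a"
proof -
  obtain C D where C: "C \<in> below (wt a)" "f = laurent Y a + ev C" and D: "D \<in> below (wt b)" "g = laurent Y b + ev D"
    and k: "keys a \<subseteq> Y" "keys b \<subseteq> Y"
    using assms by (auto simp: leading_def)
  have "f + g = laurent Y a + ev (C + (single b 1 + D))"
    by (simp add: C D ev_add ev_single \<iota>_simps)
  moreover have "C + (single b 1 + D) \<in> below (wt a)"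
    using C D k assms(3) by (intro below_add below_single) (auto intro: below_mono[of D "wt b"])
  ultimately show ?thesis using k unfolding leading_def by blast
qed

section \<open>Leading exponents of monomials and their supports\<close>

lemma frag_cmul_Suc: "frag_cmul (int (Suc n)) a = a + frag_cmul (int n) a"
  by (rule poly_mapping_eqI) (simp add: lookup_add algebra_simps)

lemma leading_power: "leading f a \<Longrightarrow> leading (f ^ n) (frag_cmul (int n) a)"
proof (induction n)
  case 0 then show ?case using leading_laurent[of 0] by simp
next
  case (Suc n)
  then show ?case using leading_mult[of f a "f ^ n" "frag_cmul (int n) a"] by (simp only: frag_cmul_Suc power_Suc)
qed

lemma leading_prod:
  "finite A \<Longrightarrow> (\<And>v. v \<in> A \<Longrightarrow> leading (f v) (a v)) \<Longrightarrow> leading (\<Prod>v\<in>A. f v) (\<Sum>v\<in>A. a v)"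
proof (induction A rule: finite_induct)
  case empty then show ?case using leading_laurent[of 0] by simp
next
  case (insert v A) then show ?case by (simp add: leading_mult)
qed

text \<open>If \<open>\<Lambda>\<close> assigns leading exponents to the variables, this is the
  leading exponent of a monomial in them; \<open>frag_cmul\<close> is multiplication by an
  integer.\<close>

definition exponent :: "('f \<Rightarrow> 'f \<Rightarrow>\<^sub>0 int) \<Rightarrow> ('f \<Rightarrow>\<^sub>0 nat) \<Rightarrow> 'f \<Rightarrow>\<^sub>0 int" where
  "exponent \<Lambda> a = (\<Sum>v\<in>keys a. frag_cmul (int (lookup a v)) (\<Lambda> v))"

lemma exponent_superset:
  "finite A \<Longrightarrow> keys a \<subseteq> A \<Longrightarrow>
    exponent \<Lambda> a = (\<Sum>v\<in>A. frag_cmul (int (lookup a v)) (\<Lambda> v))"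
  unfolding exponent_def by (intro sum.mono_neutral_left) (auto simp: in_keys_iff)

lemma exponent_add: "exponent \<Lambda> (a + b) = exponent \<Lambda> a + exponent \<Lambda> b"
  using exponent_superset[of "keys a \<union> keys b" a \<Lambda>]
    exponent_superset[of "keys a \<union> keys b" b \<Lambda>]
    exponent_superset[of "keys a \<union> keys b" "a + b" \<Lambda>] Poly_Mapping.keys_add[of a b]
  by (simp add: lookup_add frag_cmul_distrib sum.distrib)

text \<open>In a relation, take a monomial whose leading exponent has maximal weight. Others may
  share the weight but not the exponent, and lower terms have smaller weight, so nothing cancels
  it.\<close>

lemma independent_of_leading:
  assumes lead: "\<And>v. v \<in> V \<Longrightarrow> leading v (\<Lambda> v)"
    and inj: "\<And>a b. standard inc a \<Longrightarrow> standard inc b \<Longrightarrow> keys a \<subseteq> V \<Longrightarrow> keys b \<subseteq> V \<Longrightarrow>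
      exponent \<Lambda> a = exponent \<Lambda> b \<Longrightarrow> a = b"
    and p: "p \<in> poly_ring V" "\<forall>a\<in>keys p. standard inc a" "presentation \<iota> p = 0"
  shows "p = 0"
proof (rule ccontr)
  assume "p \<noteq> 0"
  have keysV: "keys a \<subseteq> V" if "a \<in> keys p" for a
    using that p(1) by (auto simp: poly_ring_def)
  let ?m = "\<lambda>a. \<Prod>v\<in>keys a. v ^ lookup a v"
  have "\<exists>C. C \<in> below (wt (exponent \<Lambda> a)) \<and> ?m a = laurent Y (exponent \<Lambda> a) + ev C \<and> keys (exponent \<Lambda> a) \<subseteq> Y"
    if a: "a \<in> keys p" for a
  proof -
    have "leading (?m a) (exponent \<Lambda> a)"
      unfolding exponent_def using keysV[OF a] by (intro leading_prod leading_power lead) auto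
    then show ?thesis by (auto simp: leading_def)
  qed
  then have "\<exists>C. \<forall>a\<in>keys p. C a \<in> below (wt (exponent \<Lambda> a)) \<and>
      ?m a = laurent Y (exponent \<Lambda> a) + ev (C a) \<and> keys (exponent \<Lambda> a) \<subseteq> Y"
    by (intro bchoice ballI)
  then obtain C where C: "\<And>a. a \<in> keys p \<Longrightarrow> C a \<in> below (wt (exponent \<Lambda> a))"
    "\<And>a. a \<in> keys p \<Longrightarrow> ?m a = laurent Y (exponent \<Lambda> a) + ev (C a)"
    "\<And>a. a \<in> keys p \<Longrightarrow> keys (exponent \<Lambda> a) \<subseteq> Y" by blast
  let ?c = "lookup p"
  define D where "D = (\<Sum>a\<in>keys p. single (exponent \<Lambda> a) (?c a) + single 0 (?c a) * C a)"
  have "presentation \<iota> p = ev D"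
    unfolding presentation_def eval_mpoly_def D_def ev_sum
    by (intro sum.cong refl) (simp add: C(2) ev_add ev_mult ev_single distrib_left)
  moreover have keysD: "\<exists>b\<in>keys p. a = exponent \<Lambda> b \<or> a \<in> keys (C b)"
    if "a \<in> keys D" for a
  proof -
    from that obtain b where b: "b \<in> keys p"
      "a \<in> keys (single (exponent \<Lambda> b) (?c b) + single 0 (?c b) * C b)"
      unfolding D_def by (rule keys_sumE)
    then have "a \<in> keys (single (exponent \<Lambda> b) (?c b)) \<or>
        a \<in> keys (single 0 (?c b) * C b)"
      using subsetD[OF Poly_Mapping.keys_add b(2)] by blast
    then have "a = exponent \<Lambda> b \<or> a \<in> keys (C b)"
      using in_keys_constant_times[of a "?c b" "C b"] by (auto split: if_splits)
    then show ?thesis using b(1) by blast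
  qed
  have "keys a \<subseteq> Y" if "a \<in> keys D" for a
    using keysD[OF that] C(1,3) by (force simp: below_def)
  ultimately have "D = 0" using ev_eq_0D p(3) by simp
  let ?W = "(\<lambda>a. wt (exponent \<Lambda> a)) ` keys p"
  have "?W \<noteq> {}" using \<open>p \<noteq> 0\<close> keys_nonempty_obtain by blast
  then have "Max ?W \<in> ?W" by (intro Max_in) auto
  then obtain a where a: "a \<in> keys p" "wt (exponent \<Lambda> a) = Max ?W" by auto
  have max: "wt (exponent \<Lambda> b) \<le> wt (exponent \<Lambda> a)" if "b \<in> keys p" for b
    unfolding a(2) using that by (intro Max_ge) auto
  have "lookup (single (exponent \<Lambda> b) (?c b) + single 0 (?c b) * C b) (exponent \<Lambda> a)
      = (if b = a then ?c a else 0)" if b: "b \<in> keys p" for b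
  proof -
    have "exponent \<Lambda> a \<notin> keys (C b)"
      using C(1)[OF b] max[OF b] by (force simp: below_def)
    then have "exponent \<Lambda> a \<notin> keys (single 0 (?c b) * C b)"
      using in_keys_constant_times by blast
    moreover have "exponent \<Lambda> b = exponent \<Lambda> a \<longleftrightarrow> b = a"
      using inj[of b a] p(2) keysV b a(1) by blast
    ultimately show ?thesis by (auto simp: lookup_add in_keys_iff lookup_single when_def)
  qed
  then have "lookup D (exponent \<Lambda> a) = ?c a"
    using a(1) unfolding D_def lookup_sum by simp
  with \<open>D = 0\<close> a(1) show False by (simp add: in_keys_iff)
qed

text \<open>Equal exponents need only force one common variable: it can be divided out on both
  sides, and induction on the degree does the rest.\<close>

lemma exponent_inj:
  assumes common: "\<And>a b. standard inc a \<Longrightarrow> standard inc b \<Longrightarrow> keys a \<subseteq> V \<Longrightarrow> keys b \<subseteq> V \<Longrightarrow>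
      exponent \<Lambda> a = exponent \<Lambda> b \<Longrightarrow> a \<noteq> 0 \<Longrightarrow> keys a \<inter> keys b \<noteq> {}"
    and ab: "standard inc a" "standard inc b" "keys a \<subseteq> V" "keys b \<subseteq> V"
      "exponent \<Lambda> a = exponent \<Lambda> b"
  shows "a = b"
  using ab
proof (induction "\<Sum>v\<in>keys a. lookup a v" arbitrary: a b rule: less_induct)
  case less
  show ?case
  proof (cases "a = 0")
    case True
    show ?thesis
    proof (rule ccontr)
      assume "a \<noteq> b"
      then have "b \<noteq> 0" using True by simp
      from common[OF less.prems(2,1,4,3) less.prems(5)[symmetric] this] True show False by simp
    qed
  next
    case False
    then obtain v where v: "v \<in> keys a" "v \<in> keys b"
      using common[OF less.prems] by blast
    let ?v = "single v (1::nat)"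
    have split: "c = c - ?v + ?v" if "v \<in> keys c" for c :: "'f \<Rightarrow>\<^sub>0 nat"
      using that by (intro poly_mapping_eqI)
        (auto simp: lookup_add minus_poly_mapping.rep_eq lookup_single when_def in_keys_iff)
    define a' where "a' = a - ?v" define b' where "b' = b - ?v"
    have a': "a = a' + ?v" and b': "b = b' + ?v" using split v by (simp_all add: a'_def b'_def)
    have sum_eq: "(\<Sum>u\<in>keys c. lookup c u) = (\<Sum>u\<in>A. lookup c u)"
      if "finite A" "keys c \<subseteq> A" for c :: "'f \<Rightarrow>\<^sub>0 nat" and A
      using that by (intro sum.mono_neutral_left) (auto simp: in_keys_iff)
    have "(\<Sum>u\<in>keys a'. lookup a' u) < (\<Sum>u\<in>keys a. lookup a u)"
      using sum_eq[of "keys a" a'] v(1)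
      by (subst sum_eq[of "keys a" a'])
        (auto simp: a' keys_add_nat lookup_add lookup_single when_def sum.distrib insert_absorb)
    moreover have "standard inc a'" "standard inc b'" "keys a' \<subseteq> V" "keys b' \<subseteq> V"
      using less.prems standard_mono[of inc a a'] standard_mono[of inc b b'] by (auto simp: a' b' keys_add_nat)
    moreover have "exponent \<Lambda> a' = exponent \<Lambda> b'"
      using less.prems(5) by (simp add: a' b' exponent_add)
    ultimately have "a' = b'" by (rule less.hyps)
    then show ?thesis by (simp add: a' b')
  qed
qed

text \<open>Nonnegativity excludes cancellation, so whether some variable of a monomial has a given
  feature can be read off from its exponent without knowing multiplicities.\<close>

lemma functional_support:
  assumes add: "\<And>a b. \<phi> (a + b) = \<phi> a + \<phi> (b :: 'f \<Rightarrow>\<^sub>0 int)"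
    and nn: "\<And>v. v \<in> V \<Longrightarrow> (0::int) \<le> \<phi> (\<Lambda> v)" and a: "keys a \<subseteq> V"
  shows "0 < \<phi> (exponent \<Lambda> a) \<longleftrightarrow> (\<exists>v\<in>keys a. 0 < \<phi> (\<Lambda> v))"
proof -
  have zero: "\<phi> 0 = 0" using add[of 0 0] by simp
  have smult: "\<phi> (frag_cmul (int n) b) = int n * \<phi> b" for n b
    by (induction n) (simp_all add: zero frag_cmul_Suc add algebra_simps del: of_nat_Suc, simp add: algebra_simps)
  have "\<phi> (\<Sum>v\<in>A. g v) = (\<Sum>v\<in>A. \<phi> (g v))" for A and g :: "'f \<Rightarrow> 'f \<Rightarrow>\<^sub>0 int"
    by (induction A rule: infinite_finite_induct) (simp_all add: zero add)
  then have eq: "\<phi> (exponent \<Lambda> a) = (\<Sum>v\<in>keys a. int (lookup a v) * \<phi> (\<Lambda> v))"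
    by (simp add: exponent_def smult)
  have nn': "0 \<le> int (lookup a v) * \<phi> (\<Lambda> v)" if "v \<in> keys a" for v
    using nn that a by auto
  show ?thesis
  proof
    assume "0 < \<phi> (exponent \<Lambda> a)"
    then obtain v where v: "v \<in> keys a" "0 < int (lookup a v) * \<phi> (\<Lambda> v)"
      unfolding eq by (metis (no_types, lifting) less_irrefl not_less sum_nonpos)
    then show "\<exists>v\<in>keys a. 0 < \<phi> (\<Lambda> v)" by (auto simp: zero_less_mult_iff)
  next
    assume "\<exists>v\<in>keys a. 0 < \<phi> (\<Lambda> v)"
    then obtain v where v: "v \<in> keys a" "0 < \<phi> (\<Lambda> v)" by blast
    then have "0 < int (lookup a v) * \<phi> (\<Lambda> v)" by (simp add: in_keys_iff)
    then show "0 < \<phi> (exponent \<Lambda> a)" unfolding eq using v(1) nn' by (intro sum_pos2[of _ v]) auto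
  qed
qed

end

text \<open>
  An arc from \<open>i\<close> to \<open>j\<close> on a disc with marked points \<open>0, \<dots>, L\<close> and a puncture passes the puncture on
  the side of \<open>0\<close> iff \<open>j \<le> i\<close>. The three kinds of data record the supports of the leading exponents: \<open>k\<close> opens
  an arc, \<open>k\<close> closes an arc, and \<open>0\<close> is an endpoint. As for parentheses, a noncrossing collection is
  determined by such data; it suffices to determine one arc.
\<close>

definition opens :: "nat \<Rightarrow> nat \<times> nat \<Rightarrow> bool" where
  "opens k z \<longleftrightarrow> 1 \<le> k \<and> (fst z = k \<or> snd z = k \<and> snd z \<le> fst z)"

definition closes :: "nat \<Rightarrow> nat \<times> nat \<Rightarrow> bool" where
  "closes k z \<longleftrightarrow> 1 \<le> k \<and> snd z = k \<and> fst z < snd z"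

definition at_zero :: "nat \<times> nat \<Rightarrow> bool" where
  "at_zero z \<longleftrightarrow> fst z = 0 \<or> snd z = 0"

definition arcs_cross :: "nat \<times> nat \<Rightarrow> nat \<times> nat \<Rightarrow> bool" where
  "arcs_cross z z' \<longleftrightarrow> (case (z, z') of ((i', j'), (i, j)) \<Rightarrow>
     i' < i \<and> i < j' \<and> j' < j \<or>
     i' < i \<and> i < j' \<and> j \<le> i \<or>
     i' < j \<and> j < j' \<and> j \<le> i \<or>
     j' \<le> i' \<and> j \<le> i \<and> i' < i \<and> j' < j)"

text \<open>All collections with the given data (\<open>good\<close>) are considered at once, and
  one arc is found that belongs to each of them. If an opening precedes a closing, it is an
  innermost matching pair. Otherwise every closing belongs to an arc from 0. Without closings all
  arcs are wrapped, and the arc with the largest first and the smallest second end is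
  determined.\<close>

lemma noncrossing_common_arc:
  fixes K K' :: "(nat \<times> nat) set"
  assumes bound: "K \<subseteq> {..L} \<times> {..L}" and ne: "K \<noteq> {}"
    and opens: "\<And>k. (\<exists>z\<in>K. opens k z) \<longleftrightarrow> (\<exists>z\<in>K'. opens k z)"
    and closes: "\<And>k. (\<exists>z\<in>K. closes k z) \<longleftrightarrow> (\<exists>z\<in>K'. closes k z)"
    and zero: "(\<exists>z\<in>K. at_zero z) \<longleftrightarrow> (\<exists>z\<in>K'. at_zero z)"
    and nc: "\<And>z z'. z \<in> K \<Longrightarrow> z' \<in> K \<Longrightarrow> \<not> arcs_cross z z'" "\<And>z z'. z \<in> K' \<Longrightarrow> z' \<in> K' \<Longrightarrow> \<not> arcs_cross z z'"
  shows "K \<inter> K' \<noteq> {}"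
proof -
  define op where "op k \<longleftrightarrow> (\<exists>z\<in>K. opens k z)" for k
  define cl where "cl k \<longleftrightarrow> (\<exists>z\<in>K. closes k z)" for k
  define ze where "ze \<longleftrightarrow> (\<exists>z\<in>K. at_zero z)"
  define good where "good M \<longleftrightarrow> M \<noteq> {} \<and> (\<forall>k. op k \<longleftrightarrow> (\<exists>z\<in>M. opens k z)) \<and> (\<forall>k. cl k \<longleftrightarrow> (\<exists>z\<in>M. closes k z)) \<and>
    (ze \<longleftrightarrow> (\<exists>z\<in>M. at_zero z)) \<and> (\<forall>z\<in>M. \<forall>z'\<in>M. \<not> arcs_cross z z')" for M
  have opL: "k \<le> L" if "op k" for k using that bound by (auto simp: op_def opens_def)
  have K'ne: "K' \<noteq> {}"
  proof
    assume K': "K' = {}"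
    obtain i j where ij: "(i, j) \<in> K" using ne by auto
    have "opens i (i, j) \<or> at_zero (i, j)" by (auto simp: opens_def at_zero_def)
    with ij opens[of i] zero K' show False by blast
  qed
  have gK: "good K" unfolding good_def using ne nc(1) by (simp add: op_def cl_def ze_def)
  have gK': "good K'" unfolding good_def op_def cl_def ze_def using K'ne nc(2) opens closes zero by blast
  have gop: "op k \<longleftrightarrow> (\<exists>z\<in>M. opens k z)" and gcl: "cl k \<longleftrightarrow> (\<exists>z\<in>M. closes k z)"
    and gze: "ze \<longleftrightarrow> (\<exists>z\<in>M. at_zero z)" if "good M" for M k
    using that unfolding good_def by blast+
  have opI: "op i" if "good M" "(i, j) \<in> M" "1 \<le> i" for M i j
    unfolding gop[OF that(1)] using that(2,3) by (intro bexI[of _ "(i, j)"]) (simp_all add: opens_def)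
  have opI2: "op j" if "good M" "(i, j) \<in> M" "1 \<le> j" "j \<le> i" for M i j
    unfolding gop[OF that(1)] using that(2-4) by (intro bexI[of _ "(i, j)"]) (simp_all add: opens_def)
  have clI: "cl j" if "good M" "(i, j) \<in> M" "i < j" for M i j
    unfolding gcl[OF that(1)] using that(2,3) by (intro bexI[of _ "(i, j)"]) (simp_all add: closes_def)
  have zeI: "ze" if "good M" "(i, j) \<in> M" "i = 0 \<or> j = 0" for M i j
    unfolding gze[OF that(1)] using that(2,3) by (intro bexI[of _ "(i, j)"]) (simp_all add: at_zero_def)
  have opD: "(\<exists>j. (i, j) \<in> M) \<or> (\<exists>k. (k, i) \<in> M \<and> i \<le> k)" if "good M" "op i" for M i
    using that by (fastforce simp: good_def opens_def)
  have clD: "\<exists>i. (i, j) \<in> M \<and> i < j" if "good M" "cl j" for M j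
    using that by (fastforce simp: good_def closes_def)
  have zeD: "\<exists>i j. (i, j) \<in> M \<and> (i = 0 \<or> j = 0)" if "good M" "ze" for M
    using that by (fastforce simp: good_def at_zero_def)
  have ncD: "\<not> arcs_cross z z'" if "good M" "z \<in> M" "z' \<in> M" for M z z'
    using that by (auto simp: good_def)
  have "\<exists>z. \<forall>M. good M \<longrightarrow> z \<in> M"
  proof (cases "\<exists>i j. op i \<and> cl j \<and> i < j")
    case True
    let ?A = "{i. op i \<and> (\<exists>j. cl j \<and> i < j)}"
    have finA: "finite ?A" by (rule finite_subset[of _ "{..L}"]) (use opL in auto)
    define i where "i = Max ?A"
    have "i \<in> ?A" unfolding i_def using finA True by (intro Max_in) auto
    then have i: "op i" "\<exists>j. cl j \<and> i < j" by auto
    have imax: "i' \<le> i" if "op i'" "cl j" "i' < j" for i' j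
      unfolding i_def using finA that by (intro Max_ge) auto
    define j where "j = (LEAST j. cl j \<and> i < j)"
    have j: "cl j" "i < j" unfolding j_def using LeastI_ex[OF i(2)] by auto
    have jmin: "j \<le> j'" if "cl j'" "i < j'" for j' unfolding j_def using that by (intro Least_le) auto
    have "(i, j) \<in> M" if M: "good M" for M
    proof -
      obtain i0 where i0: "(i0, j) \<in> M" "i0 < j" using clD[OF M j(1)] by blast
      have "i0 \<le> i" using imax[OF _ j(1) i0(2)] opI[OF M i0(1)] by (cases "i0 = 0") auto
      show ?thesis
      proof (cases "i0 = i")
        case False
        then have lt: "i0 < i" using \<open>i0 \<le> i\<close> by simp
        \<comment> \<open>Some arc of \<open>M\<close> opens at \<open>i\<close>, inside the arc
          from \<open>i0\<close> to \<open>j\<close>; as it must not cross that arc, it ends at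
          \<open>j\<close>.\<close>
        from opD[OF M i(1)] show ?thesis
        proof
          assume "\<exists>j. (i, j) \<in> M"
          then obtain j1 where j1: "(i, j1) \<in> M" by blast
          from ncD[OF M i0(1) j1] have "\<not> (j < j1)" "\<not> j1 \<le> i" using lt j(2) by (auto simp: arcs_cross_def)
          then have "j1 = j" using jmin[of j1] clI[OF M j1] by auto
          then show ?thesis using j1 by simp
        next
          assume "\<exists>k. (k, i) \<in> M \<and> i \<le> k"
          then obtain k where k: "(k, i) \<in> M" "i \<le> k" by blast
          from ncD[OF M i0(1) k(1)] show ?thesis using lt j(2) k(2) by (auto simp: arcs_cross_def)
        qed
      qed (use i0 in simp)
    qed
    then show ?thesis by blast
  next
    case noA: False
    show ?thesis
    proof (cases "\<exists>j. cl j")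
      case True
      then obtain j where j: "cl j" by blast
      have "(0, j) \<in> M" if M: "good M" for M
      proof -
        obtain i0 where i0: "(i0, j) \<in> M" "i0 < j" using clD[OF M j] by blast
        have "i0 = 0"
        proof (rule ccontr)
          assume "i0 \<noteq> 0"
          then have "op i0" using opI[OF M i0(1)] by simp
          with noA j i0(2) show False by blast
        qed
        then show ?thesis using i0 by simp
      qed
      then show ?thesis by blast
    next
      case nocl: False
      have le: "j \<le> i" if "good M" "(i, j) \<in> M" for M i j
        using clI[OF that] nocl by (meson not_le)
      show ?thesis
      proof (cases "\<exists>i. op i")
        case noop: False
        have "(0, 0) \<in> M" if M: "good M" for M
        proof -
          obtain i j where ij: "(i, j) \<in> M" using M by (auto simp: good_def)
          then have "i = 0" using opI[OF M ij] noop by (cases "i = 0") auto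
          then show ?thesis using le[OF M ij] ij by simp
        qed
        then show ?thesis by blast
      next
        case True
        have fin: "finite {i. op i}" by (rule finite_subset[of _ "{..L}"]) (use opL in auto)
        define i where "i = Max {i. op i}"
        have i: "op i" unfolding i_def using Max_in[OF fin] True by auto
        have imax: "i' \<le> i" if "op i'" for i' unfolding i_def using fin that by (intro Max_ge) auto
        \<comment> \<open>The smallest second end. An end at 0 produces no opening and is recorded
          by \<open>ze\<close> alone.\<close>
        define j where "j = (if ze then 0 else (LEAST j. op j))"
        have "(i, j) \<in> M" if M: "good M" for M
        proof -
          have fst_le: "a \<le> i" if "(a, b) \<in> M" for a b
            using opI[OF M that] imax by (cases "a = 0") auto
          have snd_ge: "j \<le> b" if ab: "(a, b) \<in> M" for a b
          proof (cases ze)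
            case False
            then have "1 \<le> b" using zeI[OF M ab] by (cases "b = 0") auto
            then have "op b" using opI2[OF M ab] le[OF M ab] by simp
            then show ?thesis using False by (simp add: j_def Least_le)
          qed (simp add: j_def)
          have "\<exists>j1. (i, j1) \<in> M"
            using opD[OF M i] fst_le by (metis le_antisym)
          then obtain j1 where j1: "(i, j1) \<in> M" by blast
          have "\<exists>i1. (i1, j) \<in> M"
          proof (cases ze)
            case True
            then obtain a b where "(a, b) \<in> M" "a = 0 \<or> b = 0" using zeD[OF M] by blast
            then have "(a, 0) \<in> M" using le[OF M, of a b] by auto
            then show ?thesis using True by (auto simp: j_def)
          next
            case False
            then have "op j" unfolding j_def using LeastI_ex[OF True] by simp
            from opD[OF M this] show ?thesis
            proof
              assume "\<exists>b. (j, b) \<in> M"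
              then obtain b where b: "(j, b) \<in> M" by blast
              then have "b = j" using le[OF M b] snd_ge[OF b] by simp
              then show ?thesis using b by blast
            qed blast
          qed
          then obtain i1 where i1: "(i1, j) \<in> M" by blast
          \<comment> \<open>Two wrapped arcs, one with the extreme first and one with the extreme
            second end, would cross unless one of them has both.\<close>
          have "\<not> (i1 < i \<and> j < j1)"
            using ncD[OF M i1 j1] le[OF M i1] le[OF M j1] by (auto simp: arcs_cross_def)
          then have "i1 = i \<or> j1 = j" using fst_le[OF i1] snd_ge[OF j1] by auto
          then show ?thesis using i1 j1 by auto
        qed
        then show ?thesis by blast
      qed
    qed
  qed
  then show ?thesis using gK gK' by blast
qed

section \<open>Linear independence of cluster monomials\<close>

context laurent_family
begin

text \<open>Each kind of data is detected by an additive functional, so equal leading exponents give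
  arc collections with equal data. Standardness makes these noncrossing, hence they share an
  arc.\<close>

lemma independent_of_arcs:
  fixes y :: "nat \<times> nat \<Rightarrow> 'f"
  assumes V: "V = y ` I" and I: "I \<subseteq> {..L} \<times> {..L}"
    and lead: "\<And>z. z \<in> I \<Longrightarrow> leading (y z) (lam z)"
    and opens: "\<And>k. \<exists>\<phi> :: ('f \<Rightarrow>\<^sub>0 int) \<Rightarrow> int. (\<forall>a b. \<phi> (a + b) = \<phi> a + \<phi> b) \<and>
      (\<forall>z\<in>I. 0 \<le> \<phi> (lam z) \<and> (0 < \<phi> (lam z) \<longleftrightarrow> opens k z))"
    and closes: "\<And>k. \<exists>\<phi> :: ('f \<Rightarrow>\<^sub>0 int) \<Rightarrow> int. (\<forall>a b. \<phi> (a + b) = \<phi> a + \<phi> b) \<and>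
      (\<forall>z\<in>I. 0 \<le> \<phi> (lam z) \<and> (0 < \<phi> (lam z) \<longleftrightarrow> closes k z))"
    and zero: "\<exists>\<phi> :: ('f \<Rightarrow>\<^sub>0 int) \<Rightarrow> int. (\<forall>a b. \<phi> (a + b) = \<phi> a + \<phi> b) \<and>
      (\<forall>z\<in>I. 0 \<le> \<phi> (lam z) \<and> (0 < \<phi> (lam z) \<longleftrightarrow> at_zero z))"
    and cross: "\<And>z z'. z \<in> I \<Longrightarrow> z' \<in> I \<Longrightarrow> arcs_cross z z' \<Longrightarrow> inc (y z) (y z')"
    and p: "p \<in> poly_ring V" "\<forall>a\<in>keys p. standard inc a" "presentation \<iota> p = 0"
  shows "p = 0"
proof -
  \<comment> \<open>Injectivity of \<open>y\<close> is not assumed; one arc is fixed for each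
    variable.\<close>
  define \<rho> where "\<rho> v = (SOME z. z \<in> I \<and> y z = v)" for v
  have \<rho>: "\<rho> v \<in> I" "y (\<rho> v) = v" if "v \<in> V" for v
    using someI_ex[of "\<lambda>z. z \<in> I \<and> y z = v"] that unfolding V \<rho>_def by blast+
  define \<Lambda> where "\<Lambda> v = lam (\<rho> v)" for v
  have common: "keys a \<inter> keys b \<noteq> {}"
    if st: "standard inc a" "standard inc b" and kV: "keys a \<subseteq> V" "keys b \<subseteq> V"
      and eq: "exponent \<Lambda> a = exponent \<Lambda> b" and a0: "a \<noteq> 0" for a b
  proof -
    have supp: "(\<exists>z\<in>\<rho> ` keys a. Q z) \<longleftrightarrow> (\<exists>z\<in>\<rho> ` keys b. Q z)"
      if "\<exists>\<phi> :: ('f \<Rightarrow>\<^sub>0 int) \<Rightarrow> int. (\<forall>a b. \<phi> (a + b) = \<phi> a + \<phi> b) \<and>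
        (\<forall>z\<in>I. 0 \<le> \<phi> (lam z) \<and> (0 < \<phi> (lam z) \<longleftrightarrow> Q z))" for Q
    proof -
      from that obtain \<phi> :: "('f \<Rightarrow>\<^sub>0 int) \<Rightarrow> int" where \<phi>: "\<And>a b. \<phi> (a + b) = \<phi> a + \<phi> b"
        "\<And>z. z \<in> I \<Longrightarrow> 0 \<le> \<phi> (lam z)" "\<And>z. z \<in> I \<Longrightarrow> 0 < \<phi> (lam z) \<longleftrightarrow> Q z" by blast
      have "(\<exists>z\<in>\<rho> ` keys c. Q z) \<longleftrightarrow> 0 < \<phi> (exponent \<Lambda> c)" if c: "keys c \<subseteq> V" for c
      proof -
        have "Q (\<rho> v) \<longleftrightarrow> 0 < \<phi> (\<Lambda> v)" if "v \<in> keys c" for v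
        proof -
          have "\<rho> v \<in> I" using \<rho>(1) c that by blast
          from \<phi>(3)[OF this] show ?thesis by (simp add: \<Lambda>_def)
        qed
        then have "(\<exists>z\<in>\<rho> ` keys c. Q z) \<longleftrightarrow> (\<exists>v\<in>keys c. 0 < \<phi> (\<Lambda> v))"
          by simp
        also have "\<dots> \<longleftrightarrow> 0 < \<phi> (exponent \<Lambda> c)"
        proof (rule functional_support[symmetric, OF \<phi>(1) _ c])
          show "0 \<le> \<phi> (\<Lambda> v)" if "v \<in> V" for v unfolding \<Lambda>_def by (rule \<phi>(2)[OF \<rho>(1)[OF that]])
        qed
        finally show ?thesis .
      qed
      from this[OF kV(1)] this[OF kV(2)] eq show ?thesis by simp
    qed
    have nc: "\<not> arcs_cross z z'" if z: "z \<in> \<rho> ` keys c" "z' \<in> \<rho> ` keys c"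
      and c: "standard inc c" "keys c \<subseteq> V" for z z' c
    proof
      assume cr: "arcs_cross z z'"
      obtain v w where vw: "v \<in> keys c" "w \<in> keys c" "z = \<rho> v" "z' = \<rho> w" using z by auto
      then have V: "v \<in> V" "w \<in> V" using c(2) by auto
      have "inc (y (\<rho> v)) (y (\<rho> w))"
        using cross[OF \<rho>(1)[OF V(1)] \<rho>(1)[OF V(2)]] cr vw(3,4) by simp
      then have "inc v w" by (simp only: \<rho>(2) V)
      with vw c(1) show False by (auto simp: standard_def)
    qed
    have "\<rho> ` keys a \<inter> \<rho> ` keys b \<noteq> {}"
    proof (rule noncrossing_common_arc)
      show "\<rho> ` keys a \<subseteq> {..L} \<times> {..L}" using \<rho>(1) kV(1) I by blast
      show "\<rho> ` keys a \<noteq> {}" using keys_nonempty_obtain[OF a0] by blast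
      show "(\<exists>z\<in>\<rho> ` keys a. opens k z) \<longleftrightarrow> (\<exists>z\<in>\<rho> ` keys b. opens k z)" for k
        by (rule supp[OF opens])
      show "(\<exists>z\<in>\<rho> ` keys a. closes k z) \<longleftrightarrow> (\<exists>z\<in>\<rho> ` keys b. closes k z)" for k
        by (rule supp[OF closes])
      show "(\<exists>z\<in>\<rho> ` keys a. at_zero z) \<longleftrightarrow> (\<exists>z\<in>\<rho> ` keys b. at_zero z)"
        by (rule supp[OF zero])
      show "\<not> arcs_cross z z'" if "z \<in> \<rho> ` keys a" "z' \<in> \<rho> ` keys a" for z z'
        by (rule nc[OF that st(1) kV(1)])
      show "\<not> arcs_cross z z'" if "z \<in> \<rho> ` keys b" "z' \<in> \<rho> ` keys b" for z z'
        by (rule nc[OF that st(2) kV(2)])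
    qed
    then obtain z where z: "z \<in> \<rho> ` keys a" "z \<in> \<rho> ` keys b" by blast
    from z(1) obtain v where v: "z = \<rho> v" "v \<in> keys a" by (rule imageE)
    from z(2) obtain v' where v': "z = \<rho> v'" "v' \<in> keys b" by (rule imageE)
    have "v \<in> keys a" "v' \<in> keys b" "\<rho> v = \<rho> v'" using v v' by simp_all
    moreover from this have "v = v'" using \<rho>(2)[of v] \<rho>(2)[of v'] kV by auto
    ultimately show ?thesis by blast
  qed
  show ?thesis
  proof (rule independent_of_leading[OF _ _ p])
    show "leading v (\<Lambda> v)" if "v \<in> V" for v
      using lead[OF \<rho>(1)[OF that]] \<rho>(2)[OF that] by (simp add: \<Lambda>_def)
    show "a = b" if "standard inc a" "standard inc b" "keys a \<subseteq> V" "keys b \<subseteq> V"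
      "exponent \<Lambda> a = exponent \<Lambda> b" for a b
      using exponent_inj[OF common that] .
  qed
qed

end

text \<open>The triangles \<open>[0, i], [i, i + 1], [0, i + 1]\<close> with \<open>1 \<le> i < M\<close> are part of the initial
  triangulation. The weights make \<open>[i, i + 1]\<close> dominate \<open>[j, j + 1]\<close> for \<open>i < j\<close>.\<close>

locale polygon_sector = polygon_frame N P e x
  for N P e :: nat and x :: "nat set \<Rightarrow> 'f::field" +
  fixes M :: nat
  assumes M2: "2 \<le> M"
    and sector_inj: "a < b \<Longrightarrow> b \<le> M \<Longrightarrow> c < d \<Longrightarrow> d \<le> M \<Longrightarrow> X a b = X c d \<longleftrightarrow> a = c \<and> b = d"
    and sector_rel: "1 \<le> i \<Longrightarrow> Suc i < j \<Longrightarrow> j \<le> M \<Longrightarrow>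
      X 0 (Suc i) * X i j = X 0 i * X (Suc i) j + X 0 j ^ (if j = M then e else 1) * X i (Suc i)"
begin

definition base :: "'f set" where
  "base = X 0 ` {1..M} \<union> (\<lambda>i. X i (Suc i)) ` {1..<M}"

definition base_weight :: "'f \<Rightarrow> int" where
  "base_weight v = (\<Sum>i\<in>{1..<M}. if v = X i (Suc i) then int (M - i) else 0)"

text \<open>In the fan at 0, \<open>X i j\<close> is \<open>X 0 i * X 0 j\<close> times the sum of
  \<open>X k (k + 1) / (X 0 k * X 0 (k + 1))\<close> over \<open>i \<le> k < j\<close>, up to the
  power \<open>e\<close> of the last spoke. The dominant term \<open>k = i\<close> splits into
  \<open>opener i\<close> and \<open>closer j\<close>.\<close>

definition closer :: "nat \<Rightarrow> 'f \<Rightarrow>\<^sub>0 int" where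
  "closer j = single (X 0 j) (if j = M then int e else 1)"

definition opener :: "nat \<Rightarrow> 'f \<Rightarrow>\<^sub>0 int" where
  "opener i = (if i = 0 then 0 else single (X i (Suc i)) 1 - closer (Suc i))"

definition opener_count :: "nat \<Rightarrow> ('f \<Rightarrow>\<^sub>0 int) \<Rightarrow> int" where
  "opener_count k a = lookup a (X k (Suc k))"

text \<open>The second summand cancels the spoke in the denominator of
  \<open>opener (k - 1)\<close>. For the last spoke this fails if \<open>e = 2\<close>;
  \<open>winding\<close> is the corrected count there.\<close>

definition closer_count :: "nat \<Rightarrow> ('f \<Rightarrow>\<^sub>0 int) \<Rightarrow> int" where
  "closer_count k a = lookup a (X 0 k) + (if 2 \<le> k then lookup a (X (k - 1) k) else 0)"

definition winding :: "('f \<Rightarrow>\<^sub>0 int) \<Rightarrow> int" where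
  "winding a = lookup a (X 0 M) + int e * lookup a (X (M - 1) M)"

lemma counts_add:
  "opener_count k (a + b) = opener_count k a + opener_count k b"
  "closer_count k (a + b) = closer_count k a + closer_count k b"
  "winding (a + b) = winding a + winding b"
  by (simp_all add: opener_count_def closer_count_def winding_def lookup_add algebra_simps)

lemma lookup_closer:
  assumes "1 \<le> j" "j \<le> M" "a < b" "b \<le> M"
  shows "lookup (closer j) (X a b) = (if a = 0 \<and> b = j then if j = M then int e else 1 else 0)"
  using sector_inj[of 0 j a b] assms by (auto simp: closer_def lookup_single when_def)

lemma lookup_opener:
  assumes "i < M" "a < b" "b \<le> M"
  shows "lookup (opener i) (X a b) =
    (if i = 0 then 0 else of_bool (a = i \<and> b = Suc i) - (if a = 0 \<and> b = Suc i then if Suc i = M then int e else 1 else 0))"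
  using sector_inj[of i "Suc i" a b] lookup_closer[of "Suc i" a b] assms
  by (auto simp: opener_def lookup_minus lookup_single when_def)

lemma opener_count_opener: "i < M \<Longrightarrow> 1 \<le> k \<Longrightarrow> k < M \<Longrightarrow> opener_count k (opener i) = of_bool (i = k)"
  by (auto simp: opener_count_def lookup_opener)

lemma opener_count_closer: "1 \<le> j \<Longrightarrow> j \<le> M \<Longrightarrow> 1 \<le> k \<Longrightarrow> k < M \<Longrightarrow> opener_count k (closer j) = 0"
  by (simp add: opener_count_def lookup_closer)

lemma closer_count_opener:
  "i < M \<Longrightarrow> 1 \<le> k \<Longrightarrow> k \<le> M \<Longrightarrow> k < M \<or> e = 1 \<Longrightarrow> closer_count k (opener i) = 0"
  by (auto simp: closer_count_def lookup_opener)

lemma closer_count_closer: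
  "1 \<le> j \<Longrightarrow> j \<le> M \<Longrightarrow> 1 \<le> k \<Longrightarrow> k \<le> M \<Longrightarrow> k < M \<or> e = 1 \<Longrightarrow> closer_count k (closer j) = of_bool (j = k)"
  by (auto simp: closer_count_def lookup_closer)

lemma winding_opener: "i < M \<Longrightarrow> winding (opener i) = 0"
  using M2 by (auto simp: winding_def lookup_opener)

lemma winding_closer: "1 \<le> j \<Longrightarrow> j \<le> M \<Longrightarrow> winding (closer j) = (if j = M then int e else 0)"
  using M2 by (auto simp: winding_def lookup_closer)

lemma counts_last:
  "1 \<le> k \<Longrightarrow> k < M \<Longrightarrow> opener_count k (single (X 0 M) c) = 0"
  "1 \<le> k \<Longrightarrow> k < M \<Longrightarrow> closer_count k (single (X 0 M) c) = 0"
  "winding (single (X 0 M) c) = c"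
  using sector_inj[of 0 M k "Suc k"] sector_inj[of 0 M 0 k] sector_inj[of 0 M "k - 1" k]
    sector_inj[of 0 M "M - 1" M] M2
  by (auto simp: opener_count_def closer_count_def winding_def lookup_single when_def)

lemma base_weight_edge: "1 \<le> i \<Longrightarrow> i < M \<Longrightarrow> base_weight (X i (Suc i)) = int (M - i)"
proof -
  assume i: "1 \<le> i" "i < M"
  have "base_weight (X i (Suc i)) = (\<Sum>k\<in>{1..<M}. if k = i then int (M - i) else 0)"
    unfolding base_weight_def using sector_inj[of i "Suc i"] i by (intro sum.cong) auto
  then show ?thesis using i by simp
qed

lemma base_weight_0: "1 \<le> j \<Longrightarrow> j \<le> M \<Longrightarrow> base_weight (X 0 j) = 0"
  unfolding base_weight_def using sector_inj[of 0 j] by (intro sum.neutral) auto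

end

locale polygon_sector_laurent =
  polygon_sector N P e x M + laurent_family \<iota> Y "polygon_sector.base_weight N x M"
  for N P e :: nat and x :: "nat set \<Rightarrow> 'f::field" and M :: nat and \<iota> :: "'k::field \<Rightarrow> 'f" and Y :: "'f set" +
  assumes base_Y: "base \<subseteq> Y"
begin

lemma Y_mem: "1 \<le> j \<Longrightarrow> j \<le> M \<Longrightarrow> X 0 j \<in> Y" "1 \<le> i \<Longrightarrow> i < M \<Longrightarrow> X i (Suc i) \<in> Y"
  using base_Y by (auto simp: base_def)

lemma keys_closer: "1 \<le> j \<Longrightarrow> j \<le> M \<Longrightarrow> keys (closer j) \<subseteq> Y"
  using Y_mem by (simp add: closer_def)

lemma wt_closer: "1 \<le> j \<Longrightarrow> j \<le> M \<Longrightarrow> wt (closer j) = 0"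
  using Y_mem base_weight_0 by (simp add: closer_def wt_single)

lemma wt_opener: "i < M \<Longrightarrow> wt (opener i) = (if i = 0 then 0 else int (M - i))"
  using Y_mem(2)[of i] base_weight_edge[of i] wt_closer[of "Suc i"] by (simp add: opener_def wt_single)

lemma laurent_closer: "1 \<le> j \<Longrightarrow> j \<le> M \<Longrightarrow> laurent Y (closer j) = X 0 j ^ (if j = M then e else 1)"
  using Y_mem(1)[of j] laurent_single[of "X 0 j" "if j = M then e else 1"]
  by (simp add: closer_def split: if_splits)

lemma leading_closer: "1 \<le> j \<Longrightarrow> j \<le> M \<Longrightarrow> leading (X 0 j ^ (if j = M then e else 1)) (closer j)"
  using leading_laurent[OF keys_closer] laurent_closer by metis

lemma leading_single: "v \<in> Y \<Longrightarrow> leading v (single v 1)"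
  using leading_laurent[of "single v 1"] laurent_single[of v 1] by simp

text \<open>Induction on \<open>j - i\<close> through \<open>sector_rel\<close>. The term with the
  edge \<open>[i, i + 1]\<close> dominates because that edge is heavier than
  \<open>[i + 1, i + 2]\<close>, which governs the other term.\<close>

lemma leading_sector: "1 \<le> i \<Longrightarrow> i < j \<Longrightarrow> j \<le> M \<Longrightarrow> leading (X i j) (opener i + closer j)"
proof -
  assume ij: "1 \<le> i" "i < j" "j \<le> M"
  define d where "d = j - Suc i"
  have "leading (X i (Suc i + d)) (opener i + closer (Suc i + d))" if "1 \<le> i" "Suc i + d \<le> M" for i
    using that
  proof (induction d arbitrary: i)
    case 0
    then have "leading (X i (Suc i)) (single (X i (Suc i)) 1)" by (intro leading_single Y_mem) auto
    then show ?case using 0 by (simp add: opener_def)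
  next
    case (Suc d)
    let ?j = "Suc i + Suc d" and ?S = "\<lambda>j. X 0 j ^ (if j = M then e else 1)"
    have S: "?S (Suc i) = X 0 (Suc i)" "?S i = X 0 i" using Suc.prems by auto
    have ne: "X 0 (Suc i) \<noteq> 0"
      using laurent_nonzero[of "closer (Suc i)"] laurent_closer[of "Suc i"] Suc.prems by auto
    have "leading (X i (Suc i) * ?S ?j) (single (X i (Suc i)) 1 + closer ?j)"
      using Suc.prems by (intro leading_mult leading_single leading_closer Y_mem) auto
    moreover have "leading (?S i * X (Suc i) ?j) (closer i + (opener (Suc i) + closer ?j))"
      using Suc.prems Suc.IH[of "Suc i"] by (intro leading_mult leading_closer) auto
    ultimately have "leading (X i (Suc i) * ?S ?j + ?S i * X (Suc i) ?j) (single (X i (Suc i)) 1 + closer ?j)"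
      by (rule leading_add)
        (use Suc.prems in \<open>simp add: wt_closer wt_opener wt_single Y_mem base_weight_edge of_nat_diff\<close>)
    from leading_div[OF this keys_closer[of "Suc i"]]
    have "leading ((X i (Suc i) * ?S ?j + ?S i * X (Suc i) ?j) / X 0 (Suc i))
        (single (X i (Suc i)) 1 + closer ?j - closer (Suc i))"
      using Suc.prems S laurent_closer[of "Suc i"] by simp
    moreover have "(X i (Suc i) * ?S ?j + ?S i * X (Suc i) ?j) / X 0 (Suc i) = X i ?j"
    proof -
      have "X 0 (Suc i) * X i ?j = X 0 i * X (Suc i) ?j + ?S ?j * X i (Suc i)"
        using Suc.prems by (intro sector_rel) auto
      then have "X i (Suc i) * ?S ?j + ?S i * X (Suc i) ?j = X 0 (Suc i) * X i ?j"
        unfolding S(2) by (simp only: mult.commute add.commute)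
      then show ?thesis using ne by simp
    qed
    moreover have "single (X i (Suc i)) 1 + closer ?j - closer (Suc i) = opener i + closer ?j"
      using Suc.prems by (simp add: opener_def)
    ultimately show ?case by (simp only:)
  qed
  from this[of i] ij show ?thesis by (simp add: d_def)
qed

end

locale ptolemy_laurent = ptolemy_polygon N P e x + polygon_sector_laurent N P e x M \<iota> Y
  for N P e :: nat and x :: "nat set \<Rightarrow> 'f::field" and M :: nat and \<iota> :: "'k::field \<Rightarrow> 'f" and Y :: "'f set" +
  assumes MN: "N = Suc M"
begin

lemma standard_independent:
  assumes p: "p \<in> poly_ring vars" "\<forall>a\<in>keys p. standard inc a" "presentation \<iota> p = 0"
  shows "p = 0"
proof (rule independent_of_arcs[where y = "\<lambda>(i, j). X i j" and I = "{(i, j). i < j \<and> j \<le> M}" and L = "M"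
      and lam = "\<lambda>(i, j). opener i + closer j", OF _ _ _ _ _ _ _ p])
  let ?I = "{(i, j). i < j \<and> j \<le> M}" and ?lam = "\<lambda>(i, j). opener i + closer j"
  let ?op = "\<lambda>k a. if 1 \<le> k \<and> k < M then opener_count k a else 0"
  let ?cl = "\<lambda>k a. if 1 \<le> k \<and> k \<le> M then closer_count k a else 0"
  have N': "i < N \<longleftrightarrow> i \<le> M" for i by (simp add: MN less_Suc_eq_le)
  show "vars = (\<lambda>(i, j). X i j) ` ?I"
    unfolding vars_def N' by auto
  show "leading ((\<lambda>(i, j). X i j) z) (?lam z)" if z: "z \<in> ?I" for z
  proof -
    obtain i j where ij: "z = (i, j)" "i < j" "j \<le> M" using z by auto
    show ?thesis
    proof (cases "i = 0")
      case True
      have e': "(if j = M then e else 1) = 1" by (simp add: e1)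
      show ?thesis
        using leading_closer[of j, unfolded e' power_one_right] ij True by (simp add: opener_def)
    next
      case False
      then show ?thesis using leading_sector[of i j] ij by simp
    qed
  qed
  have cc: "closer_count k (opener i) = 0" if "i < M" "1 \<le> k" "k \<le> M" for i k
    by (rule closer_count_opener[OF that disjI2[OF e1]])
  have cc': "closer_count k (closer j) = of_bool (j = k)" if "1 \<le> j" "j \<le> M" "1 \<le> k" "k \<le> M" for j k
    by (rule closer_count_closer[OF that disjI2[OF e1]])
  have op: "?op k (?lam (i, j)) = of_bool (opens k (i, j))" if "i < j" "j \<le> M" for i j k
    using that by (auto simp: opens_def counts_add opener_count_opener opener_count_closer)
  have cl: "?cl k (?lam (i, j)) = of_bool (closes k (i, j))" if "i < j" "j \<le> M" for i j k
    using that by (auto simp: closes_def counts_add cc cc')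
  show "\<exists>\<phi> :: ('f \<Rightarrow>\<^sub>0 int) \<Rightarrow> int. (\<forall>a b. \<phi> (a + b) = \<phi> a + \<phi> b) \<and>
      (\<forall>z\<in>?I. 0 \<le> \<phi> (?lam z) \<and> (0 < \<phi> (?lam z) \<longleftrightarrow> opens k z))" for k
  proof (rule exI[of _ "?op k"], intro conjI allI ballI)
    show "?op k (a + b) = ?op k a + ?op k b" for a b by (simp add: counts_add)
    fix z assume "z \<in> ?I"
    then obtain i j where z: "z = (i, j)" "i < j" "j \<le> M" by auto
    show "0 \<le> ?op k (?lam z)" "0 < ?op k (?lam z) \<longleftrightarrow> opens k z"
      unfolding z(1) op[OF z(2,3)] by simp_all
  qed
  show "\<exists>\<phi> :: ('f \<Rightarrow>\<^sub>0 int) \<Rightarrow> int. (\<forall>a b. \<phi> (a + b) = \<phi> a + \<phi> b) \<and>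
      (\<forall>z\<in>?I. 0 \<le> \<phi> (?lam z) \<and> (0 < \<phi> (?lam z) \<longleftrightarrow> closes k z))" for k
  proof (rule exI[of _ "?cl k"], intro conjI allI ballI)
    show "?cl k (a + b) = ?cl k a + ?cl k b" for a b by (simp add: counts_add)
    fix z assume "z \<in> ?I"
    then obtain i j where z: "z = (i, j)" "i < j" "j \<le> M" by auto
    show "0 \<le> ?cl k (?lam z)" "0 < ?cl k (?lam z) \<longleftrightarrow> closes k z"
      unfolding z(1) cl[OF z(2,3)] by simp_all
  qed
  \<comment> \<open>Every arc closes once and, unless it starts at 0, opens once; so the difference
    detects the arcs at 0.\<close>
  let ?z = "\<lambda>a. (\<Sum>k\<in>{..M}. ?cl k a) - (\<Sum>k\<in>{..M}. ?op k a)"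
  show "\<exists>\<phi> :: ('f \<Rightarrow>\<^sub>0 int) \<Rightarrow> int. (\<forall>a b. \<phi> (a + b) = \<phi> a + \<phi> b) \<and>
      (\<forall>z\<in>?I. 0 \<le> \<phi> (?lam z) \<and> (0 < \<phi> (?lam z) \<longleftrightarrow> at_zero z))"
  proof (rule exI[of _ ?z], intro conjI allI ballI)
    show "?z (a + b) = ?z a + ?z b" for a b
    proof -
      have "?cl k (a + b) = ?cl k a + ?cl k b" "?op k (a + b) = ?op k a + ?op k b" for k by (simp_all add: counts_add)
      then show ?thesis by (simp only: sum.distrib)
    qed
    fix z assume "z \<in> ?I"
    then obtain i j where z: "z = (i, j)" "i < j" "j \<le> M" by auto
    have "(\<Sum>k\<in>{..M}. ?cl k (?lam z)) = (\<Sum>k\<in>{..M}. if k = j then 1 else 0)"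
      unfolding z(1) cl[OF z(2,3)] using z by (intro sum.cong) (auto simp: closes_def)
    also have "\<dots> = 1" using z by simp
    finally have 1: "(\<Sum>k\<in>{..M}. ?cl k (?lam z)) = 1" .
    have "(\<Sum>k\<in>{..M}. ?op k (?lam z)) = (\<Sum>k\<in>{..M}. if k = i then of_bool (1 \<le> i) else 0)"
      unfolding z(1) op[OF z(2,3)] using z by (intro sum.cong) (auto simp: opens_def)
    also have "\<dots> = of_bool (1 \<le> i)" using z by simp
    finally have 2: "(\<Sum>k\<in>{..M}. ?op k (?lam z)) = of_bool (1 \<le> i)" .
    show "0 \<le> ?z (?lam z)" "0 < ?z (?lam z) \<longleftrightarrow> at_zero z"
      unfolding 1 2 using z by (auto simp: at_zero_def)
  qed
  show "inc ((\<lambda>(i, j). X i j) z) ((\<lambda>(i, j). X i j) z')" if "z \<in> ?I" "z' \<in> ?I" "arcs_cross z z'" for z z'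
  proof -
    obtain i j i' j' where z: "z = (i', j')" "z' = (i, j)" by (cases z; cases z')
    then have "i' < i" "i < j'" "j' < j" using that by (auto simp: arcs_cross_def)
    moreover have "j < i' + N" using that z MN by simp
    ultimately show ?thesis unfolding z using inc_crossing[of i' i j' j] by simp
  qed
qed auto

end

locale symmetric_laurent = symmetric_polygon N P e x r \<tau> + polygon_sector_laurent N P e x P \<iota> Y
  for N P e :: nat and x :: "nat set \<Rightarrow> 'f::field" and r :: nat and \<tau> :: 'f
    and \<iota> :: "'k::field \<Rightarrow> 'f" and Y :: "'f set"
begin

text \<open>Representatives of antipodal pairs: \<open>i\<close> is reduced below \<open>P\<close>,
  and an arc with \<open>j \<le> i\<close> continues beyond \<open>P\<close> to
  \<open>j + P\<close>. The case \<open>i = j\<close> gives the diameters.\<close>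

definition arc_var :: "nat \<times> nat \<Rightarrow> 'f" where
  "arc_var z = (case z of (i, j) \<Rightarrow> if i < j then X i j else X i (j + P))"

text \<open>The second case is the dominant term of \<open>wrapped_eq\<close> based at 0, the third
  that of \<open>rel3\<close>, each after division by the power of \<open>X 0 P\<close> on the left
  side.\<close>

definition arc_exponent :: "nat \<times> nat \<Rightarrow> 'f \<Rightarrow>\<^sub>0 int" where
  "arc_exponent z = (case z of (i, j) \<Rightarrow>
     if i < j then opener i + closer j
     else if j < i then opener i + opener j + closer P
     else frag_cmul (int r) (opener i) + single (X 0 P) 1)"

lemma closer_last: "closer P = single (X 0 P) (int e)"
  by (simp add: closer_def)

lemma leading_arc:
  assumes ij: "i < P" "j < P" shows "leading (arc_var (i, j)) (arc_exponent (i, j))"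
proof -
  have S: "X 0 k ^ (if k = P then e else 1) = X 0 k" if "k < P" for k using that by simp
  have U: "laurent Y (closer P) = X 0 P ^ e" using laurent_closer[of P] P2le by simp
  have d: "laurent Y (single (X 0 P) 1) = X 0 P"
    using laurent_single[of "X 0 P" 1] Y_mem(1)[of P] P2le by simp
  have d0: "X 0 P \<noteq> 0" using laurent_nonzero[of "single (X 0 P) 1"] d by simp
  have keysU: "keys (closer P) \<subseteq> Y" using keys_closer[of P] P2le by simp
  have keysd: "keys (single (X 0 P) (1::int)) \<subseteq> Y" using Y_mem(1)[of P] P2le by simp
  have ld: "leading (X 0 k) (closer k)" if "1 \<le> k" "k < P" for k
    using leading_closer[of k] that by simp
  have lt: "leading (X k P) (opener k + closer P)" if "1 \<le> k" "k < P" for k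
    using leading_sector[of k P] that by simp
  have wts: "wt (closer k) = 0" if "1 \<le> k" "k \<le> P" for k using wt_closer that by simp
  consider (unwrapped0) "i = 0" "0 < j" | (unwrapped) "1 \<le> i" "i < j" | (zero) "i = 0" "j = 0"
    | (to0) "1 \<le> i" "j = 0" | (diameter) "1 \<le> i" "i = j" | (wrapped) "1 \<le> j" "j < i" by linarith
  then show ?thesis
  proof cases
    case unwrapped0
    then show ?thesis using ld[of j] ij by (simp add: arc_var_def arc_exponent_def opener_def)
  next
    case unwrapped
    then show ?thesis using leading_sector[of i j] ij by (simp add: arc_var_def arc_exponent_def)
  next
    case zero
    then show ?thesis
      using leading_single[OF Y_mem(1)[of P]] P2le by (simp add: arc_var_def arc_exponent_def opener_def)
  next
    case to0
    then show ?thesis using lt[of i] ij by (simp add: arc_var_def arc_exponent_def opener_def[of 0])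
  next
    case diameter
    have wo: "0 < wt (opener i)" using wt_opener[of i] diameter ij by simp
    have rp: "0 < r" using re by auto
    have wtc: "wt (frag_cmul (int k) a) = int k * wt a" for k a
      by (simp add: wt_def sum_distrib_left mult_ac)
    have "leading (X i P ^ r + X 0 i ^ r) (frag_cmul (int r) (opener i + closer P))"
      using diameter ij P2le wo rp
      by (intro leading_add[of _ _ _ "frag_cmul (int r) (closer i)"] leading_power lt ld) (simp_all add: wtc wts)
    from leading_div[OF this keysd]
    have "leading ((X i P ^ r + X 0 i ^ r) / X 0 P)
        (frag_cmul (int r) (opener i + closer P) - single (X 0 P) 1)"
      by (simp add: d)
    moreover have "X 0 P * X i (i + P) = X i P ^ r + X 0 i ^ r"
      using rel3[of 0 i] diameter ij by (simp add: add.commute)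
    then have "(X i P ^ r + X 0 i ^ r) / X 0 P = X i (i + P)" using d0 by (metis nonzero_mult_div_cancel_left)
    \<comment> \<open>The last spoke is left \<open>r * e - 1 = 1\<close> times.\<close>
    moreover have "frag_cmul (int r) (opener i + closer P) - single (X 0 P) 1 =
        frag_cmul (int r) (opener i) + single (X 0 P) 1"
      using re by (intro poly_mapping_eqI) (auto simp: lookup_add lookup_minus closer_last lookup_single when_def)
    moreover have "arc_var (i, j) = X i (i + P)"
      "arc_exponent (i, j) = frag_cmul (int r) (opener i) + single (X 0 P) 1"
      using diameter by (simp_all add: arc_var_def arc_exponent_def)
    ultimately show ?thesis by (simp only:)
  next
    case wrapped
    have wo: "0 < wt (opener i)" "0 < wt (opener j)"
      using wt_opener[of i] wt_opener[of j] wrapped ij by simp_all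
    let ?t = "X i P * X j P" and ?b = "X 0 i * X 0 j" and ?c = "X 0 j * X i P"
    let ?a = "opener i + closer P + (opener j + closer P)"
    have t: "leading ?t ?a" using wrapped ij by (intro leading_mult lt) auto
    have b: "leading ?b (closer i + closer j)" using wrapped ij by (intro leading_mult ld) auto
    have c: "leading ?c (closer j + (opener i + closer P))" using wrapped ij by (intro leading_mult lt ld) auto
    have tb: "leading (?t + ?b) ?a"
    proof (rule leading_add[OF t b])
      show "wt (closer i + closer j) < wt ?a"
        unfolding wt_add using wts[of i] wts[of j] wts[of P] wo wrapped ij by linarith
    qed
    have wc: "wt (closer j + (opener i + closer P)) < wt ?a"
      unfolding wt_add using wts[of j] wts[of P] wo wrapped ij by linarith
    \<comment> \<open>Only \<open>?t\<close> contains two openers; the mixed term has one and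
      \<open>?b\<close> none.\<close>
    have "leading (?t + ?b + \<tau> * ?c) ?a"
    proof (cases "\<tau> = 0")
      case True then show ?thesis using tb by simp
    next
      case False
      then have "\<tau> = 2" using re by auto
      then have eq: "?t + ?b + \<tau> * ?c = ?t + ?b + ?c + ?c" by simp
      show ?thesis unfolding eq by (rule leading_add[OF leading_add[OF tb c wc] c wc])
    qed
    from leading_div[OF this keysU]
    have "leading ((?t + ?b + \<tau> * ?c) / X 0 P ^ e) (?a - closer P)" by (simp only: U)
    moreover have "X 0 P ^ e * X i (j + P) = ?t + ?b + \<tau> * ?c"
      using wrapped_eq[of 0 j i] wrapped ij by (simp add: mult_ac add_ac)
    then have "(?t + ?b + \<tau> * ?c) / X 0 P ^ e = X i (j + P)"
      using d0 by (metis nonzero_mult_div_cancel_left power_not_zero)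
    moreover have "?a - closer P = opener i + opener j + closer P" by simp
    moreover have "arc_var (i, j) = X i (j + P)" "arc_exponent (i, j) = opener i + opener j + closer P"
      using wrapped by (simp_all add: arc_var_def arc_exponent_def)
    ultimately show ?thesis by (simp only:)
  qed
qed

lemma opener_count_arc:
  assumes "i < P" "j < P" "1 \<le> k" "k < P"
  shows "opener_count k (arc_exponent (i, j)) =
    (if i < j then of_bool (i = k) else if j < i then of_bool (i = k) + of_bool (j = k) else int r * of_bool (i = k))"
proof -
  have fc: "opener_count k (frag_cmul c a) = c * opener_count k a" for c a by (simp add: opener_count_def)
  show ?thesis
    using assms P2le opener_count_opener[of i k] opener_count_opener[of j k] opener_count_closer[of j k]
      opener_count_closer[of P k] counts_last(1)[of k 1]
    by (simp add: arc_exponent_def counts_add fc)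
qed

lemma closer_count_arc:
  assumes "i < P" "j < P" "1 \<le> k" "k < P"
  shows "closer_count k (arc_exponent (i, j)) = of_bool (i < j \<and> j = k)"
proof -
  have fc: "closer_count k (frag_cmul c a) = c * closer_count k a" for c a
    by (simp add: closer_count_def algebra_simps)
  show ?thesis
    using assms P2le closer_count_opener[of i k] closer_count_opener[of j k] closer_count_closer[of j k]
      closer_count_closer[of P k] counts_last(2)[of k 1]
    by (simp add: arc_exponent_def counts_add fc)
qed

lemma winding_arc:
  assumes "i < P" "j < P"
  shows "winding (arc_exponent (i, j)) = (if i < j then 0 else if j < i then int e else 1)"
proof -
  have fc: "winding (frag_cmul c a) = c * winding a" for c a by (simp add: winding_def algebra_simps)
  show ?thesis
    using assms P2le winding_opener[of i] winding_opener[of j] winding_closer[of j] winding_closer[of P] counts_last(3)[of 1]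
    by (simp add: arc_exponent_def counts_add fc)
qed

text \<open>Segments starting at \<open>P\<close> or later are replaced by their antipodes, and so
  are those with \<open>i < j - P\<close>; all others already have the required form.\<close>

lemma vars_eq: "vars = arc_var ` ({..<P} \<times> {..<P})"
proof (intro equalityI subsetI)
  fix v assume "v \<in> vars"
  then obtain i j where ij: "i < j" "j < N" "v = X i j" by (auto simp: vars_def)
  have jP: "j < P + P" using ij(2) NP by linarith
  consider "j < P" | "P \<le> i" | "i < P" "P \<le> j" "j - P \<le> i" | "i < P" "P \<le> j" "i < j - P" by linarith
  then show "v \<in> arc_var ` ({..<P} \<times> {..<P})"
  proof cases
    case 1 then show ?thesis using ij by (intro image_eqI[of _ _ "(i, j)"]) (auto simp: arc_var_def)
  next
    case 2
    then have "v = X (i - P) (j - P)" using X_antipodal[of "i - P" "j - P"] ij jP by simp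
    then show ?thesis using ij 2 jP by (intro image_eqI[of _ _ "(i - P, j - P)"]) (auto simp: arc_var_def)
  next
    case 3 then show ?thesis using ij jP by (intro image_eqI[of _ _ "(i, j - P)"]) (auto simp: arc_var_def)
  next
    case 4
    then have "v = X (j - P) (i + P)" using X_opposite[of i "j - P"] ij jP by simp
    then show ?thesis using ij 4 jP by (intro image_eqI[of _ _ "(j - P, i)"]) (auto simp: arc_var_def)
  qed
next
  fix v assume "v \<in> arc_var ` ({..<P} \<times> {..<P})"
  then obtain i j where ij: "i < P" "j < P" "v = arc_var (i, j)" by auto
  have "X i j \<in> vars" if "i < j"
    using that ij NPs by - ((rule X_vars, rule ne); linarith)
  moreover have "X i (j + P) \<in> vars" if "\<not> i < j"
    using that ij NPs by - ((rule X_vars, rule ne); linarith)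
  ultimately show "v \<in> vars" using ij by (auto simp: arc_var_def)
qed

lemma arcs_cross_inc:
  assumes z: "i' < P" "j' < P" "i < P" "j < P" and cr: "arcs_cross (i', j') (i, j)"
  shows "inc (arc_var (i', j')) (arc_var (i, j))"
proof -
  consider "i' < i" "i < j'" "j' < j" | "i' < i" "i < j'" "j \<le> i" | "i' < j" "j < j'" "j \<le> i"
    | "j' \<le> i'" "j \<le> i" "i' < i" "j' < j" using cr by (auto simp: arcs_cross_def)
  then show ?thesis
  proof cases
    case 1
    have "inc (X i' j') (X i j)" using z 1 NPs by - (rule inc_crossing; linarith)
    then show ?thesis using 1 by (simp add: arc_var_def)
  next
    case 2
    have "inc (X i' j') (X i (j + P))" using z 2 NPs by - (rule inc_crossing; linarith)
    then show ?thesis using 2 by (simp add: arc_var_def)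
  next
    case 3
    have "inc (X i' j') (X j (i + P))" using z 3 NPs by - (rule inc_crossing; linarith)
    moreover have "X j (i + P) = X i (j + P)"
      using X_opposite[of j i] 3 z by (cases "i = j") auto
    ultimately show ?thesis using 3 by (simp add: arc_var_def)
  next
    case 4
    have "inc (X i' (j' + P)) (X i (j + P))" using z 4 NPs by - (rule inc_crossing; linarith)
    then show ?thesis using 4 by (simp add: arc_var_def)
  qed
qed

lemma standard_independent:
  assumes p: "p \<in> poly_ring vars" "\<forall>a\<in>keys p. standard inc a" "presentation \<iota> p = 0"
  shows "p = 0"
proof (rule independent_of_arcs[where y = arc_var and I = "{..<P} \<times> {..<P}" and L = P and lam = arc_exponent,
      OF vars_eq _ _ _ _ _ _ p])
  let ?I = "{..<P} \<times> {..<P}"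
  let ?op = "\<lambda>k a. if 1 \<le> k \<and> k < P then opener_count k a else 0"
  let ?cl = "\<lambda>k a. if 1 \<le> k \<and> k < P then closer_count k a else 0"
  have rp: "0 < r" using re by auto
  show "?I \<subseteq> {..P} \<times> {..P}" by auto
  show "leading (arc_var z) (arc_exponent z)" if "z \<in> ?I" for z
    using that leading_arc by (cases z) auto
  have op_pos: "0 \<le> ?op k (arc_exponent (i, j)) \<and> (0 < ?op k (arc_exponent (i, j)) \<longleftrightarrow> opens k (i, j))"
    if "i < P" "j < P" for i j k
    using that rp by (auto simp: opens_def opener_count_arc)
  have cl: "?cl k (arc_exponent (i, j)) = of_bool (closes k (i, j))" if "i < P" "j < P" for i j k
    using that by (auto simp: closes_def closer_count_arc)
  show "\<exists>\<phi> :: ('f \<Rightarrow>\<^sub>0 int) \<Rightarrow> int. (\<forall>a b. \<phi> (a + b) = \<phi> a + \<phi> b) \<and>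
      (\<forall>z\<in>?I. 0 \<le> \<phi> (arc_exponent z) \<and> (0 < \<phi> (arc_exponent z) \<longleftrightarrow> opens k z))" for k
  proof (rule exI[of _ "?op k"], intro conjI allI ballI)
    show "?op k (a + b) = ?op k a + ?op k b" for a b by (simp add: counts_add)
    fix z assume "z \<in> ?I"
    then obtain i j where z: "z = (i, j)" "i < P" "j < P" by auto
    show "0 \<le> ?op k (arc_exponent z)" "0 < ?op k (arc_exponent z) \<longleftrightarrow> opens k z"
      unfolding z(1) using op_pos[OF z(2,3), of k] by blast+
  qed
  show "\<exists>\<phi> :: ('f \<Rightarrow>\<^sub>0 int) \<Rightarrow> int. (\<forall>a b. \<phi> (a + b) = \<phi> a + \<phi> b) \<and>
      (\<forall>z\<in>?I. 0 \<le> \<phi> (arc_exponent z) \<and> (0 < \<phi> (arc_exponent z) \<longleftrightarrow> closes k z))" for k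
  proof (rule exI[of _ "?cl k"], intro conjI allI ballI)
    show "?cl k (a + b) = ?cl k a + ?cl k b" for a b by (simp add: counts_add)
    fix z assume "z \<in> ?I"
    then obtain i j where z: "z = (i, j)" "i < P" "j < P" by auto
    show "0 \<le> ?cl k (arc_exponent z)" "0 < ?cl k (arc_exponent z) \<longleftrightarrow> closes k z"
      unfolding z(1) cl[OF z(2,3)] by simp_all
  qed
  \<comment> \<open>As \<open>r * e = 2\<close>, a wrapped arc that is no diameter counts 2, minus 1
    for each end different from 0; a diameter counts \<open>r\<close>, minus \<open>r\<close> unless
    it ends at 0; a plain arc counts 1 for its closing, minus 1 unless it starts at 0. So exactly
    the arcs at 0 have a positive value.\<close>
  let ?z = "\<lambda>a. int r * winding a + (\<Sum>k\<in>{..<P}. ?cl k a) - (\<Sum>k\<in>{..<P}. ?op k a)"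
  show "\<exists>\<phi> :: ('f \<Rightarrow>\<^sub>0 int) \<Rightarrow> int. (\<forall>a b. \<phi> (a + b) = \<phi> a + \<phi> b) \<and>
      (\<forall>z\<in>?I. 0 \<le> \<phi> (arc_exponent z) \<and> (0 < \<phi> (arc_exponent z) \<longleftrightarrow> at_zero z))"
  proof (rule exI[of _ ?z], intro conjI allI ballI)
    show "?z (a + b) = ?z a + ?z b" for a b
    proof -
      have "?cl k (a + b) = ?cl k a + ?cl k b" "?op k (a + b) = ?op k a + ?op k b" for k by (simp_all add: counts_add)
      then show ?thesis by (simp only: sum.distrib counts_add distrib_left)
    qed
    fix z assume "z \<in> ?I"
    then obtain i j where z: "z = (i, j)" "i < P" "j < P" by auto
    have "(\<Sum>k\<in>{..<P}. ?cl k (arc_exponent z)) = (\<Sum>k\<in>{..<P}. if k = j then of_bool (i < j) else 0)"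
      unfolding z(1) cl[OF z(2,3)] using z by (intro sum.cong) (auto simp: closes_def)
    also have "\<dots> = of_bool (i < j)" using z by simp
    finally have 1: "(\<Sum>k\<in>{..<P}. ?cl k (arc_exponent z)) = of_bool (i < j)" .
    have "(\<Sum>k\<in>{..<P}. ?op k (arc_exponent z)) =
        (\<Sum>k\<in>{..<P}. (if k = i then of_bool (1 \<le> i) * (if i = j then int r else 1) else 0) +
          (if k = j then of_bool (1 \<le> j \<and> j < i) else 0))"
      unfolding z(1) using z by (intro sum.cong) (auto simp: opener_count_arc)
    also have "\<dots> = of_bool (1 \<le> i) * (if i = j then int r else 1) + of_bool (1 \<le> j \<and> j < i)"
      using z by (simp add: sum.distrib)
    finally have 2: "(\<Sum>k\<in>{..<P}. ?op k (arc_exponent z)) =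
        of_bool (1 \<le> i) * (if i = j then int r else 1) + of_bool (1 \<le> j \<and> j < i)" .
    have re2: "int r * int e = 2" using re by auto
    show "0 \<le> ?z (arc_exponent z)" "0 < ?z (arc_exponent z) \<longleftrightarrow> at_zero z"
      unfolding 1 2 unfolding z(1) winding_arc[OF z(2,3)] using z re2 rp by (auto simp: at_zero_def)
  qed
  show "inc (arc_var z) (arc_var z')" if "z \<in> ?I" "z' \<in> ?I" "arcs_cross z z'" for z z'
    using that arcs_cross_inc by (cases z; cases z') auto
qed

end

section \<open>The Groebner cone\<close>

lemma cluster_union_frozen:
  fixes \<iota> :: "'k::field_char_0 \<Rightarrow> 'f::field"
  assumes emb: "field_embedding \<iota>" and seed: "is_seed \<iota> n m s" and C: "C \<in> clusters n m s"
  obtains z where "algebraically_independent \<iota> m z" "C \<union> frozen_vars n m s = z ` {..<m}"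
    "C = z ` {..<n}" "frozen_vars n m s = z ` {n..<m}"
proof -
  obtain s' where s': "s' \<in> mutation_class n m s" "C = fst s' ` {..<n}"
    using C by (auto simp: clusters_def)
  have inv: "algebraically_independent \<iota> m (fst s')" "\<forall>i\<ge>n. fst s' i = fst s i"
    using mutation_class_invariants[OF emb seed s'(1)] by auto
  have nm: "n \<le> m" using seed by (simp add: is_seed_def)
  have frozen: "frozen_vars n m s = fst s' ` {n..<m}"
    unfolding frozen_vars_def using inv(2) by (intro image_cong) auto
  have "C \<union> frozen_vars n m s = fst s' ` ({..<n} \<union> {n..<m})" by (simp add: s'(2) frozen image_Un)
  also have "{..<n} \<union> {n..<m} = {..<m}" using nm by auto
  finally show thesis using that[of "fst s'"] inv(1) s'(2) frozen by blast
qed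

text \<open>Any cluster can serve as a basis of Laurent expansions, as mutation preserves algebraic
  independence.\<close>

lemma laurent_family_cluster:
  fixes \<iota> :: "'k::field_char_0 \<Rightarrow> 'f::field"
  assumes emb: "field_embedding \<iota>" and seed: "is_seed \<iota> n m s" and C: "C \<in> clusters n m s"
  shows "laurent_family \<iota> (C \<union> frozen_vars n m s)"
proof -
  obtain z where z: "algebraically_independent \<iota> m z" "C \<union> frozen_vars n m s = z ` {..<m}"
    using cluster_union_frozen[OF assms] by metis
  show ?thesis
  proof
    show "0 \<notin> C \<union> frozen_vars n m s"
      unfolding z(2) using algebraically_independent_nonzero[OF emb z(1)] by (metis imageE lessThan_iff)
    show "c a = 0" if "finite E" "\<And>a. a \<in> E \<Longrightarrow> keys a \<subseteq> C \<union> frozen_vars n m s"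
      "(\<Sum>a\<in>E. \<iota> (c a) * laurent (C \<union> frozen_vars n m s) a) = 0" "a \<in> E" for E c a
      using laurent_independent[OF emb z(1), of E c a] that unfolding z(2) by blast
  qed (use emb z(2) in auto)
qed

text \<open>The polygon models compare diagonals with diagonals and edges with edges. That a
  diagonal and an edge never share a variable follows from the independence of each extended
  cluster.\<close>

lemma cluster_frozen_disjoint:
  fixes \<iota> :: "'k::field_char_0 \<Rightarrow> 'f::field"
  assumes emb: "field_embedding \<iota>" and seed: "is_seed \<iota> n m s"
  shows "cluster_vars n m s \<inter> frozen_vars n m s = {}"
proof -
  have "C \<inter> frozen_vars n m s = {}" if C: "C \<in> clusters n m s" for C
  proof -
    obtain z where z: "algebraically_independent \<iota> m z" "C = z ` {..<n}" "frozen_vars n m s = z ` {n..<m}"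
      using cluster_union_frozen[OF emb seed C] by metis
    have "inj_on z {..<m}" by (rule algebraically_independent_inj[OF emb z(1)])
    then have "z ` {..<n} \<inter> z ` {n..<m} = z ` ({..<n} \<inter> {n..<m})"
      using seed by (intro inj_on_image_Int[symmetric]) (auto simp: is_seed_def)
    moreover have "{..<n} \<inter> {n..<m} = {}" by auto
    ultimately show ?thesis by (simp add: z(2,3))
  qed
  then show ?thesis by (auto simp: cluster_vars_def)
qed

lemma all_vars_nonzero:
  fixes \<iota> :: "'k::field_char_0 \<Rightarrow> 'f::field"
  assumes emb: "field_embedding \<iota>" and seed: "is_seed \<iota> n m s" and v: "v \<in> all_vars n m s"
  shows "v \<noteq> 0"
proof -
  have "clusters n m s \<noteq> {}" unfolding clusters_def using mutation_class.initial by blast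
  then obtain C where "C \<in> clusters n m s" "v \<in> C \<union> frozen_vars n m s"
    using v unfolding all_vars_def cluster_vars_def by blast
  then show ?thesis using laurent_family.Y0[OF laurent_family_cluster[OF emb seed]] by auto
qed

lemma seg_mem:
  assumes "2 < N" "a mod N \<noteq> b mod N" shows "seg N a b \<in> diagonals N \<union> edges N"
proof -
  have *: "seg N i j \<in> diagonals N \<union> edges N" if "i < j" "j < N" for i j
    using that segments_eq[OF assms(1)] by blast
  have "seg N a b = seg N (a mod N) (b mod N)" by simp
  moreover have "a mod N < N" "b mod N < N" using assms(1) by auto
  ultimately show ?thesis
    using *[of "a mod N" "b mod N"] *[of "b mod N" "a mod N"] assms(2) seg_commute[of N "a mod N" "b mod N"]
    by (metis linorder_neqE_nat)
qed

text \<open>Merges the separate rules for diagonals and for edges into the single rule that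
  \<open>polygon_frame\<close> demands.\<close>

lemma segment_variables_eq_iff:
  assumes N: "2 < N" and P: "P = N \<or> N = 2 * P"
    and D: "\<And>l k. l \<in> diagonals N \<Longrightarrow> k \<in> diagonals N \<Longrightarrow> x l = x k \<longleftrightarrow> k = l \<or> k = rot N P l"
    and E: "\<And>l k. l \<in> edges N \<Longrightarrow> k \<in> edges N \<Longrightarrow> x l = x k \<longleftrightarrow> k = l \<or> k = rot N P l"
    and disj: "x ` diagonals N \<inter> x ` edges N = {}"
    and ne: "a mod N \<noteq> b mod N" "c mod N \<noteq> d mod N"
  shows "x (seg N a b) = x (seg N c d) \<longleftrightarrow> seg N c d = seg N a b \<or> seg N c d = seg N (a + P) (b + P)"
proof -
  have DE: "l \<notin> edges N" "x l \<noteq> x k" if "l \<in> diagonals N" "k \<in> edges N" for l k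
    using disj that by blast+
  have rr: "rot N P (seg N (a + P) (b + P)) = seg N a b"
  proof -
    have "(i + P + P) mod N = i mod N" for i using P by (auto simp: add.assoc simp flip: mult_2)
    then show ?thesis unfolding rot_seg by (simp add: seg_def)
  qed
  have mem: "seg N a b \<in> diagonals N \<union> edges N" "seg N c d \<in> diagonals N \<union> edges N"
    using seg_mem[OF N] ne by blast+
  show ?thesis
  proof (cases "seg N a b \<in> diagonals N")
    case True
    show ?thesis
    proof (cases "seg N c d \<in> diagonals N")
      case True2: True
      show ?thesis using D[OF True True2] by (simp add: rot_seg)
    next
      case False
      then have "seg N c d \<in> edges N" using mem by blast
      moreover have "seg N (a + P) (b + P) \<in> diagonals N" using rot_diagonal[OF True, of P] by (simp add: rot_seg)
      ultimately show ?thesis using DE True by metis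
    qed
  next
    case False
    then have e: "seg N a b \<in> edges N" using mem by blast
    show ?thesis
    proof (cases "seg N c d \<in> diagonals N")
      case True
      have "seg N c d \<noteq> seg N (a + P) (b + P)"
      proof
        assume "seg N c d = seg N (a + P) (b + P)"
        then have "seg N a b = rot N P (seg N c d)" using rr by simp
        then show False using rot_diagonal[OF True, of P] False by simp
      qed
      then show ?thesis using DE(2)[OF True e] True False by metis
    next
      case False2: False
      then have "seg N c d \<in> edges N" using mem by blast
      from E[OF e this] show ?thesis by (simp add: rot_seg)
    qed
  qed
qed

context polygon_frame
begin

lemma vars_eq_segments: "vars = x ` (diagonals N \<union> edges N)"
  using N by (subst segments_eq) (auto simp: vars_def X_def)

text \<open>If no representatives of \<open>v\<close> and \<open>w\<close> cross, their two orbits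
  together form an invariant noncrossing collection, which extends to an invariant
  triangulation.\<close>

lemma inc_iff_no_common_cluster:
  assumes V: "x ` diagonals N = V"
    and clusters: "Cs = (\<lambda>T. x ` T) ` {T \<in> triangulations N. rot N P ` T = T}"
  shows "inc v w \<longleftrightarrow> v \<in> V \<and> w \<in> V \<and> \<not> (\<exists>C\<in>Cs. v \<in> C \<and> w \<in> C)"
proof -
  have \<sigma>: "rot N P l \<in> diagonals N \<and> rot N P (rot N P l) = l \<and> \<not> crossing N l (rot N P l)"
    if l: "l \<in> diagonals N" for l
  proof (cases "P = N")
    case True
    then have "rot N P l = l" using rot_N[OF diagonals_subset[OF l]] by simp
    then show ?thesis using l not_crossing_self by simp
  next
    case False
    then have NP: "N = 2 * P" using P by blast
    show ?thesis
      using rot_diagonal[OF l] rot_involution[of l P] not_crossing_antipodal[of l P] l unfolding NP by blast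
  qed
  have x_diag: "x l = x k \<longleftrightarrow> k = l \<or> k = rot N P l" if l: "l \<in> diagonals N" and k: "k \<in> diagonals N" for l k
  proof -
    have "\<exists>a b. l = seg N a b \<and> a mod N \<noteq> b mod N" if "l \<in> diagonals N" for l
      using that
    proof (rule diagonalsE)
      fix i j assume "i < j" "j < N" "l = seg N i j"
      then show ?thesis by (intro exI[of _ i] exI[of _ j]) simp
    qed
    from this[OF l] this[OF k] obtain a b c d where "l = seg N a b" "a mod N \<noteq> b mod N" "k = seg N c d" "c mod N \<noteq> d mod N"
      by blast
    then show ?thesis using x_eq[of a b c d] by (simp add: rot_seg)
  qed
  show ?thesis
  proof
    assume "inc v w"
    then obtain l k where lk: "crossing N l k" "v = x l" "w = x k" by (auto simp: inc_def)
    note d = crossing_diagonals[OF lk(1)]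
    have "\<not> (\<exists>C\<in>Cs. v \<in> C \<and> w \<in> C)"
    proof
      assume "\<exists>C\<in>Cs. v \<in> C \<and> w \<in> C"
      then obtain T where T: "T \<in> triangulations N" "rot N P ` T = T" "v \<in> x ` T" "w \<in> x ` T"
        unfolding clusters by blast
      have sub: "T \<subseteq> diagonals N" and nc: "\<And>l k. l \<in> T \<Longrightarrow> k \<in> T \<Longrightarrow> \<not> crossing N l k"
        using T(1) by (auto simp: triangulations_def)
      have mem: "l \<in> T" if l: "l \<in> diagonals N" "x l \<in> x ` T" for l
      proof -
        obtain l' where l': "l' \<in> T" "x l' = x l" using l(2) by auto
        then have "l = l' \<or> l = rot N P l'" using x_diag[of l' l] l(1) sub by blast
        then show ?thesis using l'(1) T(2) by blast
      qed
      have "l \<in> T" "k \<in> T" using mem[OF d(1)] mem[OF d(2)] T(3,4) lk(2,3) by auto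
      then show False using nc lk(1) by blast
    qed
    moreover have "v \<in> V" "w \<in> V" unfolding V[symmetric] lk(2,3) using d by simp_all
    ultimately show "v \<in> V \<and> w \<in> V \<and> \<not> (\<exists>C\<in>Cs. v \<in> C \<and> w \<in> C)" by blast
  next
    assume vw: "v \<in> V \<and> w \<in> V \<and> \<not> (\<exists>C\<in>Cs. v \<in> C \<and> w \<in> C)"
    show "inc v w"
    proof (rule ccontr)
      assume no: "\<not> inc v w"
      obtain l k where lk: "l \<in> diagonals N" "k \<in> diagonals N" "v = x l" "w = x k" using vw V by blast
      let ?A = "{l, rot N P l}" and ?B = "{k, rot N P k}"
      let ?K = "?A \<union> ?B"
      have val: "x (rot N P a) = x a" if "a \<in> diagonals N" for a
        using x_diag[of a "rot N P a"] \<sigma>[OF that] that by simp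
      have self: "\<not> crossing N a b" if a: "a \<in> {q, rot N P q}" and b: "b \<in> {q, rot N P q}" and q: "q \<in> diagonals N" for a b q
      proof -
        have "\<not> crossing N q (rot N P q)" "\<not> crossing N (rot N P q) q"
          using \<sigma>[OF q] crossing_sym[of N "rot N P q" q] by blast+
        then show ?thesis using a b not_crossing_self[of N] by auto
      qed
      have mix: "\<not> crossing N a b" if "a \<in> ?A" "b \<in> ?B" for a b
      proof
        assume "crossing N a b"
        moreover have "x a = v" "x b = w" using that val lk by auto
        ultimately show False using no unfolding inc_def by blast
      qed
      have nc: "\<forall>a\<in>?K. \<forall>b\<in>?K. \<not> crossing N a b"
      proof (intro ballI)
        fix a b assume "a \<in> ?K" "b \<in> ?K"
        then show "\<not> crossing N a b"
        proof (elim UnE)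
          assume "a \<in> ?A" "b \<in> ?A" then show ?thesis using lk(1) by (rule self)
        next
          assume "a \<in> ?B" "b \<in> ?B" then show ?thesis using lk(2) by (rule self)
        next
          assume "a \<in> ?A" "b \<in> ?B" then show ?thesis by (rule mix)
        next
          assume "a \<in> ?B" "b \<in> ?A"
          then have "\<not> crossing N b a" by (intro mix)
          then show ?thesis using crossing_sym by blast
        qed
      qed
      have Kd: "?K \<subseteq> diagonals N" using \<sigma>[OF lk(1)] \<sigma>[OF lk(2)] lk(1,2) by simp
      have K\<sigma>: "rot N P ` ?K = ?K"
        using \<sigma>[OF lk(1)] \<sigma>[OF lk(2)] by (simp add: insert_commute)
      have "\<exists>T\<in>triangulations N. rot N P ` T = T \<and> ?K \<subseteq> T"
        by (rule extend_to_symmetric_triangulation[OF _ _ Kd K\<sigma> nc]) (fact \<sigma>, fact crossing_rot)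
      then obtain T where T: "T \<in> triangulations N" "rot N P ` T = T" "?K \<subseteq> T" by (elim bexE conjE)
      have C: "x ` T \<in> Cs"
        unfolding clusters by (rule image_eqI[OF refl]) (simp only: mem_Collect_eq T(1,2) simp_thms)
      have "v \<in> x ` T \<and> w \<in> x ` T" unfolding lk(3,4) using T(3) by (intro conjI imageI) simp_all
      from bexI[where P = "\<lambda>C. v \<in> C \<and> w \<in> C", OF this C] vw show False by (elim conjE notE)
    qed
  qed
qed

lemma rays_of_groebner_cone:
  fixes \<iota> :: "'k::field_char_0 \<Rightarrow> 'f"
  assumes emb: "field_embedding \<iota>"
    and V: "x ` diagonals N = cluster_vars n m s" and F: "x ` edges N = frozen_vars n m s"
    and clusters: "clusters n m s = (\<lambda>T. x ` T) ` {T \<in> triangulations N. rot N P ` T = T}"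
    and indep: "\<And>p. p \<in> poly_ring vars \<Longrightarrow> \<forall>a\<in>keys p. standard inc a \<Longrightarrow> presentation \<iota> p = 0 \<Longrightarrow> p = 0"
    and str: "\<And>i j k l. i < j \<Longrightarrow> j < k \<Longrightarrow> k < l \<Longrightarrow> l < i + N \<Longrightarrow> straight \<iota> (X i k) (X j l)"
    and sep: "\<And>a g. 2 \<le> g \<Longrightarrow> g \<le> N div 2 \<Longrightarrow> separated_wall \<iota> a g"
  shows "generated_ray (lineality_space (groebner_cone \<iota> n m s)) ` polygon_vectors N x
    = rays_mod_lineality (groebner_cone \<iota> n m s)"
proof -
  note inc_iff = inc_iff_no_common_cluster[OF V clusters]
  have all: "all_vars n m s = vars" by (simp add: all_vars_def vars_eq_segments image_Un V F)
  have irrefl: "\<not> inc v v" for v unfolding inc_iff cluster_vars_def by blast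
  have J: "incompatible_ideal n m s = ideal_gen vars {Var v * Var w | v w. inc v w}"
    unfolding incompatible_ideal_def all inc_iff ..
  have "groebner_cone \<iota> n m s = closure {\<omega> \<in> weight_space vars. strict \<omega>}"
    unfolding groebner_cone_def cluster_ideal_def all J
    by (simp only: initial_ideal_iff_strict[OF emb indep str sep irrefl])
  then show ?thesis using rays_of_polygon_cone by simp
qed

end

lemma type_A:
  fixes \<iota> :: "'k::field_char_0 \<Rightarrow> 'f::field"
  assumes emb: "field_embedding \<iota>" and seed: "is_seed \<iota> n m s" and N: "4 \<le> N"
    and model: "polygon_model_A \<iota> N n m s x"
  shows "generated_ray (lineality_space (groebner_cone \<iota> n m s)) ` polygon_vectors N x
    = rays_mod_lineality (groebner_cone \<iota> n m s)"
proof -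
  have bijD: "bij_betw x (diagonals N) (cluster_vars n m s)" and bijE: "bij_betw x (edges N) (frozen_vars n m s)"
    and cl: "clusters n m s = (\<lambda>T. x ` T) ` triangulations N"
    and ex: "(exchange_polys n m s :: ('f, 'k) mpoly set) = polygon_exchange_polys_A N x"
    using model by (auto simp: polygon_model_A_def)
  have V: "x ` diagonals N = cluster_vars n m s" and F: "x ` edges N = frozen_vars n m s"
    using bijD bijE by (auto simp: bij_betw_def)
  have edge_sub: "l \<subseteq> {..<N}" if "l \<in> edges N" for l using that by (auto simp: edges_def)
  have frame_eq: "x (seg N a b) = x (seg N c d) \<longleftrightarrow> seg N c d = seg N a b \<or> seg N c d = seg N (a + N) (b + N)"
    if "a mod N \<noteq> b mod N" "c mod N \<noteq> d mod N" for a b c d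
  proof (rule segment_variables_eq_iff[OF _ _ _ _ _ that])
    show "x l = x k \<longleftrightarrow> k = l \<or> k = rot N N l" if "l \<in> diagonals N" "k \<in> diagonals N" for l k
      using bijD that rot_N[OF diagonals_subset[OF that(1)]] by (auto simp: bij_betw_def inj_on_def)
    show "x l = x k \<longleftrightarrow> k = l \<or> k = rot N N l" if "l \<in> edges N" "k \<in> edges N" for l k
      using bijE that rot_N[OF edge_sub[OF that(1)]] by (auto simp: bij_betw_def inj_on_def)
    show "x ` diagonals N \<inter> x ` edges N = {}" unfolding V F by (rule cluster_frozen_disjoint[OF emb seed])
  qed (use N in auto)
  interpret polygon_frame N N 1 x by unfold_locales (use N frame_eq in auto)
  interpret ptolemy_polygon N N 1 x
  proof
    fix i j k l assume ord: "i < j" "j < k" "k < l" "l < i + N"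
    let ?p = "Var (x {i mod N, k mod N}) * Var (x {j mod N, l mod N})
        - Var (x {i mod N, j mod N}) * Var (x {k mod N, l mod N})
        - Var (x {i mod N, l mod N}) * Var (x {j mod N, k mod N}) :: ('f, 'k) mpoly"
    have "?p \<in> exchange_polys n m s"
      unfolding ex polygon_exchange_polys_A_def using ccw4I[OF ord] by blast
    from exchange_polys_presentation[OF emb seed this]
    show "X i k * X j l = X i j * X k l + X i l * X j k"
      by (simp add: presentation_simps emb X_def seg_def algebra_simps)
  qed simp_all
  \<comment> \<open>One fan at 0 covers the whole polygon, so the sector ends at the last
    vertex.\<close>
  define M where "M = N - 1"
  have NM: "N = Suc M" and M: "3 \<le> M" using N by (auto simp: M_def)
  interpret polygon_sector N N 1 x M
  proof
    fix a b c d assume *: "a < b" "b \<le> M" "c < d" "d \<le> M"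
    then have lt: "a < N" "b < N" "c < N" "d < N" using NM by auto
    then show "X a b = X c d \<longleftrightarrow> a = c \<and> b = d"
      using frame_eq[of a b c d] * by (auto simp: X_def seg_def doubleton_eq_iff)
  next
    fix i j assume "1 \<le> i" "Suc i < j" "j \<le> M"
    then show "X 0 (Suc i) * X i j = X 0 i * X (Suc i) j + X 0 j ^ (if j = M then 1 else 1) * X i (Suc i)"
      using ptolemy[of 0 i "Suc i" j] NM by simp
  qed (use M in simp)
  let ?T = "(\<lambda>j. seg N 0 j) ` {2..N - 2}"
  have C: "x ` ?T \<in> clusters n m s" unfolding cl using fan_triangulation[OF N] by blast
  let ?Y = "x ` ?T \<union> frozen_vars n m s"
  have edge: "X i (Suc i) \<in> ?Y" for i
    using edgesI[of N i] N unfolding F[symmetric] X_def by auto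
  have spoke: "X 0 j \<in> ?Y" if "j \<in> {1..M}" for j
  proof -
    have "1 \<le> j" "j \<le> M" using that by auto
    then consider "j = 1" | "j = M" | "2 \<le> j \<and> j \<le> N - 2" using NM by linarith
    then show ?thesis
    proof cases
      case 1 then show ?thesis using edge[of 0] by simp
    next
      case 2
      \<comment> \<open>The last spoke is a boundary edge, hence a frozen variable.\<close>
      have "X 0 M = X M (Suc M)" unfolding X_commute[of 0 M] by (rule X_cong) (simp_all add: NM)
      then show ?thesis using edge[of M] 2 by simp
    next
      case 3 then show ?thesis by (auto simp: X_def)
    qed
  qed
  have base_sub: "base \<subseteq> ?Y" unfolding base_def using edge spoke by blast
  interpret lf: laurent_family \<iota> ?Y base_weight by (rule laurent_family_cluster[OF emb seed C])
  interpret ptolemy_laurent N N 1 x M \<iota> ?Y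
    by unfold_locales (use base_sub NM in auto)
  \<comment> \<open>In type A the symmetry is rotation by \<open>N\<close>, the identity, so every
    triangulation is symmetric.\<close>
  have fixed: "rot N N ` T = T" if "T \<in> triangulations N" for T
  proof -
    have "rot N N ` T = id ` T"
      using that by (intro image_cong) (auto simp: triangulations_def intro!: rot_N diagonals_subset)
    then show ?thesis by simp
  qed
  show ?thesis
  proof (rule rays_of_groebner_cone[OF emb V F])
    show "clusters n m s = (\<lambda>T. x ` T) ` {T \<in> triangulations N. rot N N ` T = T}"
      unfolding cl using fixed by auto
  qed (use standard_independent straight[OF emb] separated_wall[OF emb] in blast)+
qed

lemma type_BC:
  fixes \<iota> :: "'k::field_char_0 \<Rightarrow> 'f::field"
  assumes emb: "field_embedding \<iota>" and seed: "is_seed \<iota> n m s" and P_ge: "2 \<le> P" and r: "r = 1 \<or> r = 2"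
    and model: "polygon_model_BC r \<iota> (2 * P) n m s x"
  shows "generated_ray (lineality_space (groebner_cone \<iota> n m s)) ` polygon_vectors (2 * P) x
    = rays_mod_lineality (groebner_cone \<iota> n m s)"
proof -
  define N where "N = 2 * P"
  define e where "e = 2 div r"
  define \<tau> :: 'f where "\<tau> = (if r = 1 then 2 else 0)"
  have ant: "antipode N ` l = rot N P l" for l by (simp add: rot_def antipode_def N_def)
  have V: "x ` diagonals N = cluster_vars n m s" and F: "x ` edges N = frozen_vars n m s"
    and D: "\<And>l k. l \<in> diagonals N \<Longrightarrow> k \<in> diagonals N \<Longrightarrow> x l = x k \<longleftrightarrow> k = l \<or> k = rot N P l"
    and E: "\<And>l k. l \<in> edges N \<Longrightarrow> k \<in> edges N \<Longrightarrow> x l = x k \<longleftrightarrow> k = l \<or> k = rot N P l"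
    and cl: "clusters n m s = (\<lambda>T. x ` T) ` symmetric_triangulations N"
    and ex: "(exchange_polys n m s :: ('f, 'k) mpoly set) = polygon_exchange_polys_BC r N x"
  proof -
    note m = model[unfolded polygon_model_BC_def, folded N_def, unfolded ant]
    show "x ` diagonals N = cluster_vars n m s" using m[THEN conjunct1] .
    note m = m[THEN conjunct2]
    show "x l = x k \<longleftrightarrow> k = l \<or> k = rot N P l" if "l \<in> diagonals N" "k \<in> diagonals N" for l k
      using m[THEN conjunct1] that by simp
    note m = m[THEN conjunct2]
    show "x ` edges N = frozen_vars n m s" using m[THEN conjunct1] .
    note m = m[THEN conjunct2]
    show "x l = x k \<longleftrightarrow> k = l \<or> k = rot N P l" if "l \<in> edges N" "k \<in> edges N" for l k
      using m[THEN conjunct1] that by simp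
    note m = m[THEN conjunct2]
    show "clusters n m s = (\<lambda>T. x ` T) ` symmetric_triangulations N" using m[THEN conjunct1] .
    show "(exchange_polys n m s :: ('f, 'k) mpoly set) = polygon_exchange_polys_BC r N x"
      using m[THEN conjunct2] .
  qed
  have N4: "4 \<le> N" and NP: "N = 2 * P" using P_ge by (auto simp: N_def)
  have frame_eq: "x (seg N a b) = x (seg N c d) \<longleftrightarrow> seg N c d = seg N a b \<or> seg N c d = seg N (a + P) (b + P)"
    if "a mod N \<noteq> b mod N" "c mod N \<noteq> d mod N" for a b c d
  proof (rule segment_variables_eq_iff[OF _ _ D E _ that])
    show "x ` diagonals N \<inter> x ` edges N = {}" unfolding V F by (rule cluster_frozen_disjoint[OF emb seed])
  qed (use N4 NP in auto)
  interpret polygon_frame N P e x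
    by unfold_locales (use N4 NP frame_eq r in \<open>auto simp: e_def\<close>)
  have anti: "antipode N (a mod N) = (a + P) mod N" for a
    by (simp add: antipode_def NP mod_add_left_eq)
  have rel: "presentation \<iota> p = 0" if "p \<in> polygon_exchange_polys_BC r N x" for p :: "('f, 'k) mpoly"
    using exchange_polys_presentation[OF emb seed] that unfolding ex by blast
  have opp: "X i (j + P) = X j (i + P)" if "i < j" "j < i + P" for i j
  proof -
    have "i mod N \<noteq> (j + P) mod N" using add_mod_ne[of "j + P - i" i] that NP by simp
    then have "X i (j + P) = X (i + P) (j + P + P)" by (rule X_shift[symmetric])
    also have "\<dots> = X j (i + P)" by (subst X_commute) (rule X_cong, simp_all add: P2)
    finally show ?thesis .
  qed
  interpret symmetric_polygon N P e x r \<tau>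
  proof
    show "N = 2 * P" by (rule NP)
    show "r = 1 \<and> e = 2 \<and> \<tau> = 2 \<or> r = 2 \<and> e = 1 \<and> \<tau> = 0" using r by (auto simp: e_def \<tau>_def)
    show "X a b \<noteq> 0" if "a mod N \<noteq> b mod N" for a b
    proof (rule all_vars_nonzero[OF emb seed])
      show "X a b \<in> all_vars n m s"
        using X_vars[OF that] by (simp add: all_vars_def vars_eq_segments image_Un V F)
    qed
  next
    fix i j k l assume ord: "i < j" "j < k" "k < l" "l < i + P"
    have ccw: "ccw N [i mod N, j mod N, k mod N, l mod N, antipode N (i mod N)]"
      unfolding anti using ord NP by (intro ccw5I) auto
    have "Var (x {i mod N, k mod N}) * Var (x {j mod N, l mod N})
        - Var (x {i mod N, j mod N}) * Var (x {k mod N, l mod N})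
        - Var (x {i mod N, l mod N}) * Var (x {j mod N, k mod N}) \<in> (polygon_exchange_polys_BC r N x :: ('f, 'k) mpoly set)"
      unfolding polygon_exchange_polys_BC_def using ccw by blast
    from rel[OF this] show "X i k * X j l = X i j * X k l + X i l * X j k"
      by (simp add: presentation_simps emb X_def seg_def algebra_simps)
  next
    fix i j k assume ord: "i < j" "j < k" "k < i + P"
    have ccw: "ccw N [i mod N, j mod N, k mod N, antipode N (i mod N)]"
      unfolding anti using ord NP by (intro ccw4I) auto
    have "Var (x {i mod N, k mod N}) * Var (x {i mod N, antipode N (j mod N)})
        - Var (x {i mod N, j mod N}) * Var (x {i mod N, antipode N (k mod N)})
        - Var (x {i mod N, antipode N (i mod N)}) ^ (2 div r) * Var (x {j mod N, k mod N})
        \<in> (polygon_exchange_polys_BC r N x :: ('f, 'k) mpoly set)"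
      unfolding polygon_exchange_polys_BC_def using ccw by blast
    from rel[OF this] have "X i k * X i (j + P) = X i j * X i (k + P) + X i (i + P) ^ e * X j k"
      unfolding anti by (simp add: presentation_simps emb X_def seg_def e_def algebra_simps)
    then show "X i k * X j (i + P) = X i j * X k (i + P) + X i (i + P) ^ e * X j k"
      using opp[of i j] opp[of i k] ord by simp
  next
    fix i j assume ord: "i < j" "j < i + P"
    have lt: "0 < j - i" "j - i < N" "0 < i + P - j" "i + P - j < N" using ord NP by linarith+
    have "j mod N \<noteq> i mod N" using add_mod_ne[OF lt(1,2), of i] ord by simp
    moreover have "j mod N \<noteq> antipode N (i mod N)"
      unfolding anti using add_mod_ne[OF lt(3,4), of j] ord by simp
    moreover have "i mod N < N" "j mod N < N" using N4 by auto
    ultimately have "Var (x {i mod N, antipode N (i mod N)}) * Var (x {j mod N, antipode N (j mod N)})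
        - Var (x {i mod N, j mod N}) ^ r - Var (x {i mod N, antipode N (j mod N)}) ^ r
        \<in> (polygon_exchange_polys_BC r N x :: ('f, 'k) mpoly set)"
      unfolding polygon_exchange_polys_BC_def by blast
    from rel[OF this] have "X i (i + P) * X j (j + P) = X i j ^ r + X i (j + P) ^ r"
      unfolding anti by (simp add: presentation_simps emb X_def seg_def algebra_simps)
    then show "X i (i + P) * X j (j + P) = X i j ^ r + X j (i + P) ^ r"
      using opp[OF ord] by simp
  qed
  \<comment> \<open>Up to the antipodal map half of the polygon is enough, so the sector ends at the
    antipode of 0.\<close>
  interpret polygon_sector N P e x P
  proof
    fix a b c d assume *: "a < b" "b \<le> P" "c < d" "d \<le> P"
    then have lt: "a < N" "b < N" "c < N" "d < N" using P_ge NP by auto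
    \<comment> \<open>With endpoints among \<open>0, ..., P\<close>, a segment has its antipode
      there only if it is the diameter \<open>[0, P]\<close>, which is its own antipode.\<close>
    have "a = c \<and> b = d" if "seg N c d = seg N (a + P) (b + P)"
    proof -
      have "(a + P) mod N = a + P" using * NP by simp
      moreover have "(b + P) mod N = (if b = P then 0 else b + P)" using * NP by (auto simp flip: mult_2)
      ultimately have "c = a + P \<and> d = (if b = P then 0 else b + P) \<or> c = (if b = P then 0 else b + P) \<and> d = a + P"
        using that lt by (simp add: seg_def doubleton_eq_iff)
      then show ?thesis using * by (auto split: if_splits)
    qed
    moreover have "seg N c d = seg N a b \<longleftrightarrow> a = c \<and> b = d"
      using * lt by (auto simp: seg_def doubleton_eq_iff)
    moreover have "a mod N \<noteq> b mod N" "c mod N \<noteq> d mod N" using lt * by auto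
    ultimately show "X a b = X c d \<longleftrightarrow> a = c \<and> b = d"
      using frame_eq[of a b c d] unfolding X_def by blast
  next
    fix i j assume *: "1 \<le> i" "Suc i < j" "j \<le> P"
    show "X 0 (Suc i) * X i j = X 0 i * X (Suc i) j + X 0 j ^ (if j = P then e else 1) * X i (Suc i)"
    proof (cases "j = P")
      case True
      then show ?thesis using rel2[of 0 i "Suc i"] * by simp
    next
      case False
      then show ?thesis using rel1[of 0 i "Suc i" j] * by simp
    qed
  qed (rule P_ge)
  let ?T = "(\<lambda>j. seg N 0 j) ` {2..P} \<union> (\<lambda>j. seg N P (j + P)) ` {2..P}"
  have C: "x ` ?T \<in> clusters n m s"
    unfolding cl using symmetric_fan_triangulation[OF P_ge] unfolding NP[symmetric] by blast
  let ?Y = "x ` ?T \<union> frozen_vars n m s"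
  have edge: "X i (Suc i) \<in> ?Y" for i
    using edgesI[of N i] N4 unfolding F[symmetric] X_def by auto
  have spoke: "X 0 j \<in> ?Y" if "j \<in> {1..P}" for j
  proof (cases "j = 1")
    case True then show ?thesis using edge[of 0] by simp
  next
    case False
    then have "j \<in> {2..P}" using that by auto
    then show ?thesis by (auto simp: X_def)
  qed
  have base_sub: "base \<subseteq> ?Y" unfolding base_def using edge spoke by blast
  interpret lf: laurent_family \<iota> ?Y base_weight by (rule laurent_family_cluster[OF emb seed C])
  interpret symmetric_laurent N P e x r \<tau> \<iota> ?Y
    by unfold_locales (use base_sub in auto)
  show ?thesis
    unfolding NP[symmetric]
  proof (rule rays_of_groebner_cone[OF emb V F])
    show "clusters n m s = (\<lambda>T. x ` T) ` {T \<in> triangulations N. rot N P ` T = T}"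
      unfolding cl symmetric_triangulations_def ant ..
  qed (use standard_independent straight[OF emb] separated_wall[OF emb] in blast)+
qed

theorem theorem5p2p1:
  fixes \<iota> :: "'k::field_char_0 \<Rightarrow> 'f::field"
    and n m :: nat
    and s :: "'f seed"
    and x :: "nat set \<Rightarrow> 'f"
    and ty :: cluster_type
  assumes "field_embedding \<iota>"
    and "min_rank ty \<le> n"
    and "is_seed \<iota> n m s"
    and "has_type ty n m s"
    and "polygon_model ty \<iota> (polygon_size ty n) n m s x"
  shows "generated_ray (lineality_space (groebner_cone \<iota> n m s))
           ` polygon_vectors (polygon_size ty n) x
         = rays_mod_lineality (groebner_cone \<iota> n m s)"
proof (cases ty)
  case TypeA
  then show ?thesis
    using type_A[OF assms(1,3), of "n + 3" x] assms(2,5) by (simp add: polygon_size_def min_rank_def)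
next
  case TypeB
  then show ?thesis
    using type_BC[OF assms(1,3), of "n + 1" 1 x] assms(2,5) by (simp add: polygon_size_def min_rank_def)
next
  case TypeC
  then show ?thesis
    using type_BC[OF assms(1,3), of "n + 1" 2 x] assms(2,5) by (simp add: polygon_size_def min_rank_def)
qed

end
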